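(* Let $P$ be a triod twist cycle (a cycle exhibiting a triod twist pattern) of rotation number $\frac pq$, let $f$ be the $P$-linear map, and let the branches of $T$ be numbered canonically for $P$. Let $\mathbb{S}=\mathbb{R}/\mathbb{Z}$ and let $R:\mathbb{S}\to\mathbb{S}$, $R(t)=t+\frac pq$. Then there exists a continuous map $\Theta:T\to\mathbb{S}$ which conjugates $P$ with the circle rotation by angle $\frac pq$, i.e. $\Theta|_P$ is a bijection of $P$ onto a periodic orbit of $R$ and $\Theta(f(x))=R(\Theta(x))$ for all $x\in P$. Further (when $\frac pq\neq\frac13$, so that concordant pieces are defined), $\Theta$ is monotone on the convex hull of each concordant piece of $P$.
   Context: The triod is $T=\{z\in\mathbb{C}: z^3\in[0,1]\}$, with central (branching) point $a=0$; the branches of $T$ are the three components of $T\setminus\{a\}$. For $x,y$ on the same branch, write $x>y$ if $x$ is farther from $a$ than $y$. Let $\mathcal{U}$ be the set of continuous maps $f:T\to T$ for which $a$ is the unique fixed point. A cycle is a periodic orbit $P\neq\{a\}$ of some $f\in\mathcal{U}$; $[P]$ is its convex hull in $T$. The $P$-linear map is the map that acts on $P$ as given, fixes $a$, is affine on each component of $[P]\setminus(P\cup\{a\})$ and constant on each component of $T\setminus[P]$. Cycles $P$ of $f$ and $Q$ of $g$ are equivalent if there is a homeomorphism $h:[P]\to[Q]$ with $h(P)=Q$ and $h\circ f=g\circ h$ on $P$, which fixes branches (points of each branch are sent into the same branch). The equivalence class of $P$ is its pattern, and $P$ exhibits that pattern. A pattern $A$ forces a pattern $B$ if every $f\in\mathcal{U}$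 with a cycle of pattern $A$ also has a cycle of pattern $B$. A cycle and its pattern are primitive if each point of the cycle lies on a different branch. A pattern is regular if it does not force a primitive pattern of period $2$; a cycle is regular if its pattern is. Number the branches $b_0,b_1,b_2$ (indices mod $3$). For $u\in b_i$, $v\in b_j$ put $d(u,v)=\frac k3$, where $k\in\{0,1,2\}$ and $j\equiv i+k \pmod 3$. For a cycle $P$ of $f$, a point $x\in P$ is green, black or red according as $d(x,f(x))=0,\frac13,\frac23$. If $P$ has period $n$, its rotation pair is $\left(\sum_{i=0}^{n-1}d(f^i(x),f^{i+1}(x)),\,n\right)$ for $x\in P$ (the first entry is an integer), and its rotation number is the quotient of the first entry by the second; these depend only on the pattern. The numbering is canonical for a regular cycle (or its pattern) if, for each $i$, the point of the cycle on $b_i$ closest to $a$ is black; every regular cycle admits a canonical numbering. All rotation numbers are computed with the fixed numbering. A triod twist is a regular pattern that does not force another pattern with the same rotation number. For a cycle $P$ of $f$ with rotation number $\rho\ne\frac13$, the code function $\psi:P\to\mathbb{R}$ is defined by choosing $x_0\in P$, setting $\psi(x_0)=0$ and $\psi(f^k(x_0))=\psi(x_0)+k\rho-[t_k]$ for $k\in\mathbb{N}$, where $t_k=\sum_{j=0}^{k-1}d(f^j(x_0),f^{j+1}(x_0))$ and $[\cdot]$ is the integer part (floor). Fix such a $\psi$. For $x,y\in P$ write $x\sim y$ if $x,y$ lie on the same branch and all points of $P$ in the interval $[x,y]$ have the same integral part of $\psi$; this is an equivalence relation whose classes are the concordant pieces of $P$. A map $F$ is monotone on a set $U$ if $F^{-1}(v)\cap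 U$ is connected for every $v\in F(U)$. *)

theory Defs
  imports "HOL-Analysis.Analysis" "HOL-Combinatorics.Orbits"
begin

section \<open>The triod\<close>

definition triod :: "complex set" where
  "triod = {z. z ^ 3 \<in> of_real ` {0..1}}"

definition triod_branches :: "complex set set" where
  "triod_branches = components (triod - {0})"

definition same_branch :: "complex \<Rightarrow> complex \<Rightarrow> bool" where
  "same_branch x y \<longleftrightarrow> (\<exists>B\<in>triod_branches. x \<in> B \<and> y \<in> B)"

text \<open>The convex hull in the tree \<^const>\<open>triod\<close>: the least connected subset containing \<open>A\<close>.\<close>

definition triod_hull :: "complex set \<Rightarrow> complex set" where
  "triod_hull A = \<Inter>{C. C \<subseteq> triod \<and> connected C \<and> A \<subseteq> C}"

text \<open>The path-length metric of the tree; two points not on a common branch are joined through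
  the branching point \<open>0\<close>.\<close>

definition triod_dist :: "complex \<Rightarrow> complex \<Rightarrow> real" where
  "triod_dist x y = (if same_branch x y then dist x y else norm x + norm y)"

section \<open>Maps and cycles\<close>

definition triod_maps :: "(complex \<Rightarrow> complex) set" where
  "triod_maps = {f. continuous_on triod f \<and> f ` triod \<subseteq> triod \<and> {x \<in> triod. f x = x} = {0}}"

definition cycle :: "(complex \<Rightarrow> complex) \<Rightarrow> complex set \<Rightarrow> bool" where
  "cycle f P \<longleftrightarrow> f \<in> triod_maps \<and> P \<subseteq> triod \<and> cyclic_on f P \<and> P \<noteq> {0}"

text \<open>Affine with respect to the path-length metric, i.e. constant speed along a path of the tree.
  Affinity in the complex plane would be wrong, since the image may pass from one branch to
  another through \<open>0\<close>. The sets \<open>J\<close> of interest are intervals inside one branch.\<close>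

definition tree_affine_on :: "complex set \<Rightarrow> (complex \<Rightarrow> complex) \<Rightarrow> bool" where
  "tree_affine_on J f \<longleftrightarrow>
     (\<exists>c\<ge>0. \<forall>x\<in>J. \<forall>y\<in>J. triod_dist (f x) (f y) = c * triod_dist x y)"

text \<open>\<open>f\<close> is the \<open>P\<close>-linear map, where the action on \<open>P\<close> is given by \<open>g\<close>.\<close>

definition linear_map_of :: "(complex \<Rightarrow> complex) \<Rightarrow> complex set \<Rightarrow> (complex \<Rightarrow> complex) \<Rightarrow> bool" where
  "linear_map_of g P f \<longleftrightarrow>
     continuous_on triod f \<and> f ` triod \<subseteq> triod \<and>
     (\<forall>x\<in>P. f x = g x) \<and> f 0 = 0 \<and>
     (\<forall>J\<in>components (triod_hull P - (P \<union> {0})). tree_affine_on J f) \<and>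
     (\<forall>J\<in>components (triod - triod_hull P). f constant_on J)"

section \<open>Patterns and forcing\<close>

definition cycle_equiv ::
    "(complex \<Rightarrow> complex) \<Rightarrow> complex set \<Rightarrow> (complex \<Rightarrow> complex) \<Rightarrow> complex set \<Rightarrow> bool" where
  "cycle_equiv f P g Q \<longleftrightarrow>
     (\<exists>h h'. homeomorphism (triod_hull P) (triod_hull Q) h h' \<and> h ` P = Q \<and>
        (\<forall>x\<in>P. h (f x) = g (h x)) \<and>
        (\<forall>B\<in>triod_branches. h ` (B \<inter> triod_hull P) \<subseteq> B))"

text \<open>A pattern is an equivalence class of cycles, a cycle being recorded together with a map
  having it; \<open>(f, P) \<in> A\<close> says that the cycle \<open>P\<close> of \<open>f\<close> exhibits \<open>A\<close>.\<close>

type_synonym pattern = "((complex \<Rightarrow> complex) \<times> complex set) set"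

definition pattern_of :: "(complex \<Rightarrow> complex) \<Rightarrow> complex set \<Rightarrow> pattern" where
  "pattern_of f P = {(g, Q). cycle g Q \<and> cycle_equiv f P g Q}"

definition patterns :: "pattern set" where
  "patterns = {pattern_of f P |f P. cycle f P}"

definition forces :: "pattern \<Rightarrow> pattern \<Rightarrow> bool" where
  "forces A B \<longleftrightarrow> (\<forall>f\<in>triod_maps. (\<exists>P. (f, P) \<in> A) \<longrightarrow> (\<exists>Q. (f, Q) \<in> B))"

definition primitive_cycle :: "complex set \<Rightarrow> bool" where
  "primitive_cycle P \<longleftrightarrow> (\<forall>x\<in>P. \<forall>y\<in>P. same_branch x y \<longrightarrow> x = y)"

definition primitive_pattern :: "pattern \<Rightarrow> bool" where
  "primitive_pattern A \<longleftrightarrow> A \<in> patterns \<and> (\<forall>(f, P)\<in>A. primitive_cycle P)"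

definition pattern_has_period :: "pattern \<Rightarrow> nat \<Rightarrow> bool" where
  "pattern_has_period A n \<longleftrightarrow> (\<forall>(f, P)\<in>A. card P = n)"

definition regular_pattern :: "pattern \<Rightarrow> bool" where
  "regular_pattern A \<longleftrightarrow>
     A \<in> patterns \<and> \<not> (\<exists>B. primitive_pattern B \<and> pattern_has_period B 2 \<and> forces A B)"

section \<open>Rotation numbers and triod twists\<close>

definition branch_numbering :: "(nat \<Rightarrow> complex set) \<Rightarrow> bool" where
  "branch_numbering b \<longleftrightarrow> bij_betw b {..<3} triod_branches"

definition branch_disp :: "(nat \<Rightarrow> complex set) \<Rightarrow> complex \<Rightarrow> complex \<Rightarrow> real" where
  "branch_disp b u v =
     (THE r. \<exists>i<3. \<exists>k<3. u \<in> b i \<and> v \<in> b ((i + k) mod 3) \<and> r = real k / 3)"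

definition black :: "(nat \<Rightarrow> complex set) \<Rightarrow> (complex \<Rightarrow> complex) \<Rightarrow> complex \<Rightarrow> bool" where
  "black b f x \<longleftrightarrow> branch_disp b x (f x) = 1 / 3"

text \<open>Since \<open>f\<close> permutes \<open>P\<close> cyclically, the sum over \<open>P\<close> is the sum along the orbit of any point
  of \<open>P\<close> over one period \<open>card P\<close>.\<close>

definition rotation_pair ::
    "(nat \<Rightarrow> complex set) \<Rightarrow> (complex \<Rightarrow> complex) \<Rightarrow> complex set \<Rightarrow> real \<times> nat" where
  "rotation_pair b f P = (\<Sum>x\<in>P. branch_disp b x (f x), card P)"

definition rotation_number ::
    "(nat \<Rightarrow> complex set) \<Rightarrow> (complex \<Rightarrow> complex) \<Rightarrow> complex set \<Rightarrow> real" where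
  "rotation_number b f P = fst (rotation_pair b f P) / real (snd (rotation_pair b f P))"

text \<open>All cycles exhibiting a pattern have the same rotation number.\<close>

definition pattern_rotation_number :: "(nat \<Rightarrow> complex set) \<Rightarrow> pattern \<Rightarrow> real" where
  "pattern_rotation_number b A = (THE r. \<exists>(f, P)\<in>A. rotation_number b f P = r)"

definition canonical_numbering ::
    "(nat \<Rightarrow> complex set) \<Rightarrow> (complex \<Rightarrow> complex) \<Rightarrow> complex set \<Rightarrow> bool" where
  "canonical_numbering b f P \<longleftrightarrow>
     branch_numbering b \<and>
     (\<forall>i<3. \<exists>x\<in>P \<inter> b i. (\<forall>y\<in>P \<inter> b i. norm x \<le> norm y) \<and> black b f x)"

definition triod_twist :: "(nat \<Rightarrow> complex set) \<Rightarrow> pattern \<Rightarrow> bool" where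
  "triod_twist b A \<longleftrightarrow>
     regular_pattern A \<and>
     \<not> (\<exists>B\<in>patterns. B \<noteq> A \<and> forces A B \<and>
          pattern_rotation_number b B = pattern_rotation_number b A)"

definition triod_twist_cycle ::
    "(nat \<Rightarrow> complex set) \<Rightarrow> (complex \<Rightarrow> complex) \<Rightarrow> complex set \<Rightarrow> bool" where
  "triod_twist_cycle b f P \<longleftrightarrow> cycle f P \<and> triod_twist b (pattern_of f P)"

section \<open>Code functions and concordant pieces\<close>

definition code_function ::
    "(nat \<Rightarrow> complex set) \<Rightarrow> (complex \<Rightarrow> complex) \<Rightarrow> complex set \<Rightarrow> (complex \<Rightarrow> real) \<Rightarrow> bool" where
  "code_function b f P \<psi> \<longleftrightarrow>
     (\<exists>x\<^sub>0\<in>P. \<psi> x\<^sub>0 = 0 \<and>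
        (\<forall>k. \<psi> ((f ^^ k) x\<^sub>0) = \<psi> x\<^sub>0 + real k * rotation_number b f P
            - of_int \<lfloor>\<Sum>j<k. branch_disp b ((f ^^ j) x\<^sub>0) ((f ^^ Suc j) x\<^sub>0)\<rfloor>))"

definition concordant :: "complex set \<Rightarrow> (complex \<Rightarrow> real) \<Rightarrow> (complex \<times> complex) set" where
  "concordant P \<psi> =
     {(x, y). x \<in> P \<and> y \<in> P \<and> same_branch x y \<and>
        (\<forall>u\<in>P \<inter> triod_hull {x, y}. \<forall>v\<in>P \<inter> triod_hull {x, y}. \<lfloor>\<psi> u\<rfloor> = \<lfloor>\<psi> v\<rfloor>)}"

definition concordant_pieces :: "complex set \<Rightarrow> (complex \<Rightarrow> real) \<Rightarrow> complex set set" where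
  "concordant_pieces P \<psi> = P // concordant P \<psi>"

definition fibre_monotone_on :: "'a::topological_space set \<Rightarrow> ('a \<Rightarrow> 'b) \<Rightarrow> bool" where
  "fibre_monotone_on U F \<longleftrightarrow> (\<forall>v\<in>F ` U. connected (F -` {v} \<inter> U))"

section \<open>The circle \<open>\<real>/\<int>\<close>\<close>

quotient_type circle = real / "\<lambda>s t. s - t \<in> \<int>"
proof (rule equivpI)
  show "reflp (\<lambda>s t::real. s - t \<in> \<int>)"
    by (simp add: reflp_def)
  show "symp (\<lambda>s t::real. s - t \<in> \<int>)"
    by (auto simp: symp_def dest: Ints_minus)
  show "transp (\<lambda>s t::real. s - t \<in> \<int>)"
    by (auto simp: transp_def dest: Ints_add)
qed

text \<open>The quotient topology.\<close>

instantiation circle :: topological_space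
begin

definition open_circle :: "circle set \<Rightarrow> bool" where
  "open_circle U \<longleftrightarrow> open (abs_circle -` U)"

instance
  by standard (auto simp: open_circle_def vimage_Int vimage_Union)

end

lift_definition circle_rotation :: "real \<Rightarrow> circle \<Rightarrow> circle" is "\<lambda>\<alpha> t. t + \<alpha>"
  by simp

end

theory Submission
  imports Defs
begin

text \<open>Call a sequence of points of \<open>P\<close> a walk if the image of the interval from the branching point
  to a member always contains the interval from the branching point to the next one. A closed walk
  with prescribed branches that is pushed as far inwards as possible crosses the intervals between
  neighbouring points of \<open>P\<close> in outward direction only. Every map with a cycle of the given pattern
  then has a periodic orbit along the walk, and the order of its points is determined by the walk,
  so that a pattern is forced. Hence a closed walk of rotation number \<open>p/q\<close> must be followed by \<open>P\<close>
  itself. Combining loops of rotation numbers on both sides of \<open>p/q\<close> (the points closest to the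
  branching point provide one of rotation number \<open>1/3\<close>) gives walks that deviate too much for
  that, and excluding them means that the code function is strictly monotone on each branch.

  If \<open>p/q > 1/3\<close> there are then no green points; if \<open>p/q < 1/3\<close>, regularity excludes red points. If
  \<open>k p/q\<close> were an integer for some \<open>k\<close> less than the period, the integers
  \<open>3 (t\<^sub>k - k p/q)\<close> would have mean zero along \<open>P\<close> without vanishing, and a change of their sign needs
  both a green and a red point. So the code function modulo \<open>1\<close> is injective on \<open>P\<close>, and interpolating
  it monotonically along the branches gives \<open>\<Theta>\<close>. For \<open>p/q = 1/3\<close> the pattern forces a primitive cycle
  of period three, hence is one.\<close>


section \<open>Geometry of the triod\<close>

text \<open>Forcing speaks of all maps in \<open>triod_maps\<close>, so a covering argument that
  only yields some periodic orbit along a walk leaves its pattern open. Least admissible sequences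
  settle it: as a tight walk crosses outwards only, raising a tail raises the beginning, so the
  points of the orbit compare like their itineraries, lexicographically and without the orientation
  reversals of kneading theory. The price is that a walk through points closest to the branching
  point has the zero sequence as its least one, which is the fixed point. By canonicity such walks
  have mean displacement 1/3. This makes 1/3 exceptional and calls for a separate construction of
  the cycle of period three. Monotonicity arises as follows. A piece of orbit from \<open>u\<close>
  to a point farther out on the same branch closes up to a loop at \<open>u\<close>, and its total
  deviation from the mean is the difference of a potential, \<open>lam\<close>. The loop through the
  lowest points deviates with the sign of \<open>1 / 3 - \<rho>\<close>, so a loop of the other sign
  cannot coexist with it.\<close>

lemma cube_root_norm:
  fixes e :: complex
  assumes "e ^ 3 = 1"
  shows "norm e = 1"
proof -
  have "norm e ^ 3 = 1" using assms by (metis norm_one norm_power)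
  then show ?thesis using power_eq_1_iff[of "norm e" 3] by simp
qed

lemma cube_root_mult_cnj:
  fixes e :: complex
  assumes "e ^ 3 = 1"
  shows "e * cnj e = 1"
  using cube_root_norm[OF assms] complex_norm_square[of e] by simp

lemma cube_root_nonzero: "(e::complex) ^ 3 = 1 \<Longrightarrow> e \<noteq> 0"
  by auto

lemma sgn_of_real_times:
  fixes e :: complex
  assumes "e ^ 3 = 1" "t > 0"
  shows "sgn (of_real t * e) = e"
  using cube_root_norm[OF assms(1)] assms(2)
  by (simp add: sgn_mult sgn_of_real sgn_div_norm[of e])

lemma norm_of_real_times:
  fixes e :: complex
  assumes "e ^ 3 = 1" "t \<ge> 0"
  shows "norm (of_real t * e) = t"
  using cube_root_norm[OF assms(1)] assms(2) by (simp add: norm_mult)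

lemma norm_times_sgn: "of_real (norm z) * sgn z = (z::complex)"
  by (cases "z = 0") (simp_all add: sgn_div_norm scaleR_conv_of_real)

lemma complex_polar_eqI: "sgn x = sgn y \<Longrightarrow> norm x = norm y \<Longrightarrow> x = (y::complex)"
  by (metis norm_times_sgn)

text \<open>Polar form: from here on \<open>sgn\<close> names the branch of a point and
  \<open>norm\<close> its position there.\<close>

lemma triod_iff: "z \<in> triod \<longleftrightarrow> z = 0 \<or> sgn z ^ 3 = 1 \<and> norm z \<le> 1"
proof (cases "z = 0")
  case True
  then show ?thesis by (force simp: triod_def)
next
  case False
  have z3: "z ^ 3 = of_real (norm z ^ 3) * sgn z ^ 3"
    by (metis norm_times_sgn of_real_power power_mult_distrib)
  have pos: "norm z > 0" using False by simp
  show ?thesis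
  proof
    assume "z \<in> triod"
    then obtain r where r: "0 \<le> r" "r \<le> 1" "z ^ 3 = of_real r" by (auto simp: triod_def)
    have "norm z ^ 3 = r" using r by (metis norm_of_real norm_power abs_of_nonneg)
    then have "of_real r * sgn z ^ 3 = of_real r" "r \<noteq> 0" using z3 r pos by auto
    then have "sgn z ^ 3 = 1" by simp
    moreover have "norm z \<le> 1"
    proof (rule ccontr)
      assume "\<not> norm z \<le> 1"
      then have "norm z ^ 3 > 1" by (intro one_less_power) auto
      then show False using \<open>norm z ^ 3 = r\<close> r by simp
    qed
    ultimately show "z = 0 \<or> sgn z ^ 3 = 1 \<and> norm z \<le> 1" by simp
  next
    assume "z = 0 \<or> sgn z ^ 3 = 1 \<and> norm z \<le> 1"
    then have "sgn z ^ 3 = 1" "norm z \<le> 1" using False by auto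
    then have "z ^ 3 = of_real (norm z ^ 3)" "norm z ^ 3 \<le> 1"
      using z3 by (auto intro: power_le_one)
    then show "z \<in> triod" unfolding triod_def by (metis (mono_tags, lifting) atLeastAtMost_iff
        imageI mem_Collect_eq norm_ge_zero zero_le_power)
  qed
qed

lemma zero_in_triod [simp]: "0 \<in> triod"
  by (simp add: triod_iff)

lemma triod_sgn: "z \<in> triod \<Longrightarrow> z \<noteq> 0 \<Longrightarrow> sgn z ^ 3 = 1"
  by (simp add: triod_iff)

lemma triod_norm_le: "z \<in> triod \<Longrightarrow> norm z \<le> 1"
  by (auto simp: triod_iff)

lemma of_real_times_in_triod:
  assumes "e ^ 3 = 1" "0 \<le> t" "t \<le> 1"
  shows "of_real t * e \<in> triod"
proof (cases "t = 0")
  case False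
  then have "t > 0" using assms by simp
  then show ?thesis
    using sgn_of_real_times[OF assms(1)] norm_of_real_times[OF assms(1,2)] assms
    by (simp add: triod_iff)
qed simp

text \<open>The distance from the branching point on the branch of direction \<open>e\<close>, and minus half of that
  distance on the other two branches.\<close>

definition coord :: "complex \<Rightarrow> complex \<Rightarrow> real" where
  "coord e z = Re (z * cnj e)"

lemma continuous_on_coord [continuous_intros]:
  "continuous_on S f \<Longrightarrow> continuous_on S (\<lambda>x. coord e (f x))"
  unfolding coord_def by (intro continuous_intros)

lemma coord_0 [simp]: "coord e 0 = 0"
  by (simp add: coord_def)

lemma coord_of_real_times: "e ^ 3 = 1 \<Longrightarrow> coord e (of_real t * e) = t"
  by (simp add: coord_def mult.assoc cube_root_mult_cnj)

lemma coord_le_norm: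
  assumes "e ^ 3 = 1"
  shows "coord e z \<le> norm z"
  using complex_Re_le_cmod[of "z * cnj e"] cube_root_norm[OF assms]
  by (simp add: coord_def norm_mult)

lemma Re_cube_root_neg:
  fixes w :: complex
  assumes "w ^ 3 = 1" "w \<noteq> 1"
  shows "Re w < 0"
proof -
  have "(w - 1) * (w\<^sup>2 + w + 1) = 0"
    using assms(1) by (simp add: algebra_simps power2_eq_square power3_eq_cube)
  then have w: "w\<^sup>2 + w + 1 = 0" using assms(2) by simp
  have n: "(Re w)\<^sup>2 + (Im w)\<^sup>2 = 1"
    using cube_root_norm[OF assms(1)] by (simp add: cmod_def)
  have re: "(Re w)\<^sup>2 - (Im w)\<^sup>2 + Re w + 1 = 0"
    using arg_cong[OF w, of Re] by (simp add: power2_eq_square)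
  have im: "Im w * (2 * Re w + 1) = 0"
    using arg_cong[OF w, of Im] by (simp add: power2_eq_square algebra_simps)
  show ?thesis
  proof (rule ccontr)
    assume "\<not> Re w < 0"
    then have "Im w = 0" using im by auto
    then have "(Re w)\<^sup>2 = 1" "(Re w)\<^sup>2 + Re w + 1 = 0" using n re by auto
    with \<open>\<not> Re w < 0\<close> show False by simp
  qed
qed

lemma coord_sgn:
  assumes "z \<in> triod" "e ^ 3 = 1"
  shows "sgn z = e \<Longrightarrow> coord e z = norm z"
    and "z \<noteq> 0 \<Longrightarrow> sgn z \<noteq> e \<Longrightarrow> coord e z < 0"
proof -
  show "coord e z = norm z" if "sgn z = e"
    using that coord_of_real_times[OF assms(2), of "norm z"] norm_times_sgn[of z] by simp
  show "coord e z < 0" if z: "z \<noteq> 0" "sgn z \<noteq> e"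
  proof -
    define w where "w = sgn z * cnj e"
    have "w ^ 3 = 1"
      using triod_sgn[OF assms(1) z(1)] assms(2)
      by (metis complex_cnj_one complex_cnj_power mult_1 power_mult_distrib w_def)
    moreover have "w \<noteq> 1"
    proof
      assume "w = 1"
      then have "sgn z * (cnj e * e) = e" by (simp add: w_def flip: mult.assoc)
      then show False using z cube_root_mult_cnj[OF assms(2)] by (simp add: mult.commute)
    qed
    ultimately have "Re w < 0" by (rule Re_cube_root_neg)
    moreover have "coord e z = norm z * Re w"
    proof -
      have "z * cnj e = of_real (norm z) * w"
        by (metis mult.assoc norm_times_sgn w_def)
      then show ?thesis by (simp add: coord_def)
    qed
    ultimately show ?thesis using z by (simp add: mult_pos_neg)
  qed
qed

text \<open>Turns a real equation solved by the intermediate value theorem back into a point of the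
  triod: \<open>coord e\<close> is negative on the other two branches, so a nonnegative value
  determines the point.\<close>

lemma coord_nonneg_iff:
  assumes "z \<in> triod" "e ^ 3 = 1"
  shows "coord e z \<ge> 0 \<longleftrightarrow> z = of_real (coord e z) * e"
proof
  assume nn: "coord e z \<ge> 0"
  show "z = of_real (coord e z) * e"
  proof (cases "z = 0")
    case False
    then have "sgn z = e" using coord_sgn(2)[OF assms] nn by fastforce
    then show ?thesis using coord_sgn(1)[OF assms] norm_times_sgn[of z] by simp
  qed simp
next
  assume a: "z = of_real (coord e z) * e"
  show "coord e z \<ge> 0"
  proof (rule ccontr)
    assume n: "\<not> coord e z \<ge> 0"
    then have "z \<noteq> 0" by auto
    define c where "c = coord e z"
    have c: "z = of_real c * e" "c < 0" using a n by (auto simp: c_def)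
    then have "z ^ 3 = of_real (c ^ 3)" using assms(2) by (simp add: power_mult_distrib)
    moreover have "c ^ 3 < 0" using c(2) by (simp add: power_less_zero_eq)
    ultimately have "z ^ 3 \<notin> of_real ` {0..1}"
      by (metis atLeastAtMost_iff image_iff linorder_not_less of_real_eq_iff)
    then show False using assms(1) by (simp add: triod_def)
  qed
qed

lemma coord_pos_sgn:
  assumes "z \<in> triod" "e ^ 3 = 1" "coord e z > 0"
  shows "sgn z = e"
  using coord_sgn(2)[OF assms(1,2)] assms(3) by fastforce

lemma coord_zeroD:
  assumes "z \<in> triod" "e ^ 3 = 1" "coord e z = 0"
  shows "z = 0"
  using coord_nonneg_iff[OF assms(1,2)] assms(3) by simp

text \<open>\<open>sgn\<close> is continuous away from 0 and takes only three values on the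
  triod.\<close>

lemma connected_sgn_constant:
  assumes "connected C" "C \<subseteq> triod - {0}" "x \<in> C" "y \<in> C"
  shows "sgn x = sgn y"
proof -
  have "finite {e::complex. e ^ 3 = 1}" by (rule finite_nth_roots) simp
  moreover have "sgn ` C \<subseteq> {e. e ^ 3 = 1}" using assms(2) triod_sgn by blast
  ultimately have "finite (sgn ` C)" by (rule rev_finite_subset)
  moreover have "continuous_on C (\<lambda>x. sgn x)"
    using assms(2) by (intro continuous_intros) auto
  then have "connected (sgn ` C)" using assms(1) connected_continuous_image by blast
  ultimately have "sgn ` C = {} \<or> (\<exists>a. sgn ` C = {a})"
    using connected_finite_iff_sing by blast
  then show ?thesis using imageI[OF assms(3), of sgn] imageI[OF assms(4), of sgn] by (metis empty_iff singletonD)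
qed

lemma open_ray_eq:
  assumes "e ^ 3 = 1"
  shows "{z \<in> triod. z \<noteq> 0 \<and> sgn z = e} = (\<lambda>t. of_real t * e) ` {0<..1}"
proof (intro equalityI subsetI)
  fix z assume z: "z \<in> {z \<in> triod. z \<noteq> 0 \<and> sgn z = e}"
  then show "z \<in> (\<lambda>t. of_real t * e) ` {0<..1}"
    using norm_times_sgn[of z] triod_norm_le[of z] by (intro image_eqI[of _ _ "norm z"]) auto
next
  fix z assume "z \<in> (\<lambda>t. of_real t * e) ` {0<..1}"
  then obtain t :: real where t: "0 < t" "t \<le> 1" "z = of_real t * e" by auto
  then show "z \<in> {z \<in> triod. z \<noteq> 0 \<and> sgn z = e}"
    using assms of_real_times_in_triod[OF assms, of t] sgn_of_real_times[OF assms, of t]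
    by (auto simp: cube_root_nonzero)
qed

lemma triod_branches_eq:
  "triod_branches = (\<lambda>e. {z \<in> triod. z \<noteq> 0 \<and> sgn z = e}) ` {e. e ^ 3 = 1}"
proof -
  have comp: "connected_component_set (triod - {0}) x = {z \<in> triod. z \<noteq> 0 \<and> sgn z = sgn x}"
    if x: "x \<in> triod - {0}" for x
  proof (rule set_eqI, rule iffI)
    fix z assume "z \<in> connected_component_set (triod - {0}) x"
    then obtain T where "connected T" "T \<subseteq> triod - {0}" "x \<in> T" "z \<in> T"
      unfolding connected_component_def by auto
    then show "z \<in> {z \<in> triod. z \<noteq> 0 \<and> sgn z = sgn x}"
      using connected_sgn_constant by blast
  next
    fix z assume z: "z \<in> {z \<in> triod. z \<noteq> 0 \<and> sgn z = sgn x}"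
    have "sgn x ^ 3 = 1" using x triod_sgn by blast
    then have "{z \<in> triod. z \<noteq> 0 \<and> sgn z = sgn x} = (\<lambda>t. of_real t * sgn x) ` {0<..1}"
      by (rule open_ray_eq)
    moreover have "connected ((\<lambda>t. of_real t * sgn x) ` {0<..1::real})"
      by (intro connected_continuous_image continuous_intros) auto
    ultimately have "connected {z \<in> triod. z \<noteq> 0 \<and> sgn z = sgn x}" by simp
    then show "z \<in> connected_component_set (triod - {0}) x"
      using z x unfolding connected_component_def by blast
  qed
  have ex: "\<exists>x\<in>triod - {0}. sgn x = e" if "e ^ 3 = 1" for e
    using that of_real_times_in_triod[OF that, of 1] sgn_of_real_times[OF that, of 1]
    by (intro bexI[of _ e]) auto
  show ?thesis
    unfolding triod_branches_def components_def
  proof (intro equalityI subsetI)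
    fix B assume "B \<in> connected_component_set (triod - {0}) ` (triod - {0})"
    then obtain x where "x \<in> triod - {0}" "B = {z \<in> triod. z \<noteq> 0 \<and> sgn z = sgn x}"
      using comp by auto
    then show "B \<in> (\<lambda>e. {z \<in> triod. z \<noteq> 0 \<and> sgn z = e}) ` {e. e ^ 3 = 1}"
      using triod_sgn by (intro image_eqI[of _ _ "sgn x"]) auto
  next
    fix B assume "B \<in> (\<lambda>e. {z \<in> triod. z \<noteq> 0 \<and> sgn z = e}) ` {e. e ^ 3 = 1}"
    then obtain e where e: "e ^ 3 = 1" "B = {z \<in> triod. z \<noteq> 0 \<and> sgn z = e}" by auto
    obtain x where "x \<in> triod - {0}" "sgn x = e" using ex e by blast
    then show "B \<in> connected_component_set (triod - {0}) ` (triod - {0})"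
      using comp e by (intro image_eqI[of _ _ x]) auto
  qed
qed

lemma same_branch_iff:
  "same_branch x y \<longleftrightarrow> x \<in> triod \<and> y \<in> triod \<and> x \<noteq> 0 \<and> y \<noteq> 0 \<and> sgn x = sgn y"
  unfolding same_branch_def triod_branches_eq using triod_sgn by auto


section \<open>Cycles\<close>

lemma triod_mapsD:
  assumes "f \<in> triod_maps"
  shows "continuous_on triod f" "\<And>z. z \<in> triod \<Longrightarrow> f z \<in> triod" "f 0 = 0"
    "\<And>z. z \<in> triod \<Longrightarrow> f z = z \<Longrightarrow> z = 0"
  using assms unfolding triod_maps_def by auto

lemma continuous_on_ray:
  assumes "continuous_on triod f" "e ^ 3 = 1" "A \<subseteq> {0..1}"
  shows "continuous_on A (\<lambda>t. f (of_real t * e))"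
proof (rule continuous_on_compose2[OF assms(1)])
  show "continuous_on A (\<lambda>t. of_real t * e)" by (intro continuous_intros)
  show "(\<lambda>t. of_real t * e) ` A \<subseteq> triod" using assms of_real_times_in_triod by fastforce
qed

text \<open>Since the only fixed point is the branching point, and the endpoint of a branch cannot be
  mapped beyond itself, no point stays on its branch and moves outwards.\<close>

lemma same_branch_moves_inward:
  assumes f: "f \<in> triod_maps" and z: "z \<in> triod" "z \<noteq> 0" "sgn (f z) = sgn z"
  shows "norm (f z) < norm z"
proof (rule ccontr)
  assume c: "\<not> norm (f z) < norm z"
  define e where "e = sgn z"
  have e: "e ^ 3 = 1" using triod_sgn z e_def by simp
  define F where "F = (\<lambda>t. coord e (f (of_real t * e)) - t)"
  have "continuous_on {norm z..1} F"
    unfolding F_def by (intro continuous_intros continuous_on_ray triod_mapsD[OF f] e) auto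
  moreover have "F (norm z) \<ge> 0"
    using c coord_sgn(1)[OF triod_mapsD(2)[OF f z(1)] e] z norm_times_sgn[of z]
    by (simp add: F_def e_def)
  moreover have "F 1 \<le> 0"
    using coord_le_norm[OF e, of "f e"] triod_norm_le[OF triod_mapsD(2)[OF f, of e]]
      of_real_times_in_triod[OF e, of 1] by (simp add: F_def)
  ultimately obtain t where t: "norm z \<le> t" "t \<le> 1" "F t = 0"
    using IVT2'[of F 1 0 "norm z"] triod_norm_le[OF z(1)] by auto
  have T: "of_real t * e \<in> triod"
    using of_real_times_in_triod[OF e, of t] t norm_ge_zero[of z] by linarith
  have "coord e (f (of_real t * e)) = t" using t by (simp add: F_def)
  then have "f (of_real t * e) = of_real t * e"
    using coord_nonneg_iff[OF triod_mapsD(2)[OF f T] e] t norm_ge_zero[of z] by auto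
  then have "of_real t * e = 0" using triod_mapsD(4)[OF f T] by simp
  then show False using t z e by (auto simp: cube_root_nonzero)
qed

lemma cyclic_on_bij_betw:
  assumes "cyclic_on g P" "x \<in> P"
  shows "bij_betw (\<lambda>k. (g ^^ k) x) {..<card P} P"
proof -
  have P: "P = orbit g x" using assms orbit_cyclic_eq3 by metis
  define n where "n = (LEAST n. 0 < n \<and> (g ^^ n) x = x)"
  have "\<exists>n. 0 < n \<and> (g ^^ n) x = x"
    using assms(2) unfolding P orbit_altdef by fastforce
  then have n: "0 < n" "(g ^^ n) x = x" and least: "\<And>m. 0 < m \<Longrightarrow> (g ^^ m) x = x \<Longrightarrow> n \<le> m"
    using LeastI_ex[of "\<lambda>n. 0 < n \<and> (g ^^ n) x = x"] unfolding n_def by (auto intro: Least_le)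
  have img: "(\<lambda>k. (g ^^ k) x) ` {..<n} = P"
    unfolding P orbit_altdef_bounded[OF n(2,1)] by auto
  have inj: "inj_on (\<lambda>k. (g ^^ k) x) {..<n}"
  proof (rule linorder_inj_onI')
    fix i j assume ij: "i \<in> {..<n}" "j \<in> {..<n}" "i < j"
    show "(g ^^ i) x \<noteq> (g ^^ j) x"
    proof
      assume eq: "(g ^^ i) x = (g ^^ j) x"
      have "(g ^^ (n - j + i)) x = (g ^^ (n - j)) ((g ^^ i) x)" by (simp add: funpow_add)
      also have "\<dots> = (g ^^ (n - j + j)) x" by (simp only: eq funpow_add o_apply)
      also have "\<dots> = x" using ij n by simp
      finally show False using least[of "n - j + i"] ij by simp
    qed
  qed
  have "card P = n" using card_image[OF inj] img by simp
  then show ?thesis using inj img by (simp add: bij_betw_def)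
qed

locale triod_cycle =
  fixes g :: "complex \<Rightarrow> complex" and P :: "complex set"
  assumes cycle: "cycle g P"
begin

lemma map_in: "g \<in> triod_maps" and P_triod: "x \<in> P \<Longrightarrow> x \<in> triod"
  and cyclic: "cyclic_on g P"
  using cycle by (auto simp: cycle_def)

lemma finite_P: "finite P"
  using finite_cyclic_on[OF cyclic] .

lemma g_in: "x \<in> P \<Longrightarrow> g x \<in> P"
  using cyclic_on_inI[OF cyclic] .

lemma funpow_in: "x \<in> P \<Longrightarrow> (g ^^ k) x \<in> P"
  using cyclic_on_funpow_in[OF cyclic] .

lemma P_nonempty: "P \<noteq> {}"
  using cyclic by (auto simp: cyclic_on_def)

lemma card_pos: "card P > 0"
  using finite_P P_nonempty by (simp add: card_gt_0_iff)

lemma zero_notin_P: "0 \<notin> P"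
proof
  assume "0 \<in> P"
  then have "P = orbit g 0" using orbit_cyclic_eq3[OF cyclic] by simp
  also have "\<dots> = {0}" using triod_mapsD(3)[OF map_in] by (simp add: orbit_eq_singleton_iff)
  finally show False using cycle by (simp add: cycle_def)
qed

lemma P_nonzero: "x \<in> P \<Longrightarrow> x \<noteq> 0"
  using zero_notin_P by auto

lemma sgn_cube: "x \<in> P \<Longrightarrow> sgn x ^ 3 = 1"
  using triod_sgn P_triod P_nonzero by blast

lemma orbit_bij: "x \<in> P \<Longrightarrow> bij_betw (\<lambda>k. (g ^^ k) x) {..<card P} P"
  using cyclic_on_bij_betw[OF cyclic] .

lemma funpow_reach:
  assumes "x \<in> P" "y \<in> P"
  obtains k where "k < card P" "y = (g ^^ k) x"
proof -
  have "y \<in> (\<lambda>k. (g ^^ k) x) ` {..<card P}"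
    using orbit_bij[OF assms(1)] assms(2) by (simp add: bij_betw_def)
  then show ?thesis using that by auto
qed

lemma funpow_neq:
  assumes "x \<in> P" "0 < k" "k < card P"
  shows "(g ^^ k) x \<noteq> x"
proof
  assume "(g ^^ k) x = x"
  then have "(g ^^ k) x = (g ^^ 0) x" by simp
  then have "k = 0"
    using inj_onD[OF bij_betw_imp_inj_on[OF orbit_bij[OF assms(1)]], of k 0] assms by auto
  then show False using assms by simp
qed

lemma bij_g: "bij_betw g P P"
proof -
  have "g ` P = P"
  proof (intro equalityI subsetI)
    fix y assume "y \<in> P"
    then have "y \<in> orbit g y" using orbit_cyclic_eq3[OF cyclic] by simp
    then show "y \<in> g ` P"
      using \<open>y \<in> P\<close> by cases (use orbit_cyclic_eq3[OF cyclic] in auto)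
  qed (use g_in in auto)
  then show ?thesis using finite_P by (simp add: bij_betw_def finite_surj_inj)
qed

lemma sum_orbit:
  assumes "x \<in> P"
  shows "(\<Sum>k<card P. F ((g ^^ k) x)) = sum F P"
  using sum.reindex_bij_betw[OF orbit_bij[OF assms], of F] .

lemma sum_shift: "(\<Sum>x\<in>P. F ((g ^^ k) x)) = sum F P"
proof (induction k)
  case (Suc k)
  have "(\<Sum>x\<in>P. F ((g ^^ Suc k) x)) = (\<Sum>x\<in>P. F ((g ^^ k) (g x)))"
    by (simp only: funpow_swap1 funpow.simps o_apply)
  also have "\<dots> = (\<Sum>x\<in>P. F ((g ^^ k) x))"
    using sum.reindex_bij_betw[OF bij_g, of "\<lambda>x. F ((g ^^ k) x)"] .
  finally show ?case using Suc by simp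
qed simp

text \<open>\<open>N\<close> may be a proper multiple of the period. Sums over \<open>N\<close>
  steps are constant along the cycle, so averaging them over \<open>P\<close> and exchanging the
  sums gives the claim.\<close>

lemma sum_period:
  fixes F :: "complex \<Rightarrow> real"
  assumes "y \<in> P" "(g ^^ N) y = y"
  shows "real (card P) * (\<Sum>k<N. F ((g ^^ k) y)) = real N * sum F P"
proof -
  define G where "G = (\<lambda>x. \<Sum>k<N. F ((g ^^ k) x))"
  have per: "(g ^^ N) x = x" if x: "x \<in> P" for x
  proof -
    obtain k where k: "x = (g ^^ k) y" using funpow_reach[OF assms(1) x] by metis
    then have "(g ^^ N) x = (g ^^ k) ((g ^^ N) y)"
      by (metis add.commute comp_apply funpow_add)
    then show ?thesis using assms k by simp
  qed
  have shift: "G (g x) = G x" if x: "x \<in> P" for x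
  proof -
    have "G (g x) + F x = (\<Sum>k<Suc N. F ((g ^^ k) x))"
      unfolding G_def sum.lessThan_Suc_shift by (simp add: funpow_swap1)
    also have "\<dots> = G x + F x" using per[OF x] by (simp add: G_def)
    finally show ?thesis by simp
  qed
  have step: "G ((g ^^ k) y) = G y" for k
    using shift funpow_in[OF assms(1)] by (induction k) auto
  have "G x = G y" if x: "x \<in> P" for x
    using funpow_reach[OF assms(1) x] step by metis
  then have "real (card P) * G y = sum G P" by simp
  also have "\<dots> = (\<Sum>k<N. \<Sum>x\<in>P. F ((g ^^ k) x))"
    unfolding G_def by (rule sum.swap)
  also have "\<dots> = real N * sum F P" by (simp add: sum_shift)
  finally show ?thesis by (simp add: G_def)
qed

text \<open>On a single branch the innermost point would have to move farther inwards. This is what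
  puts 0 into the hull of a cycle.\<close>

lemma ex_two_branches: "\<exists>x\<in>P. \<exists>y\<in>P. sgn x \<noteq> sgn y"
proof (rule ccontr)
  assume "\<not> ?thesis"
  then have same: "sgn x = sgn y" if "x \<in> P" "y \<in> P" for x y using that by blast
  obtain x where x: "x \<in> P" "\<And>y. y \<in> P \<Longrightarrow> norm x \<le> norm y"
    using ex_min_if_finite[of "norm ` P"] finite_P P_nonempty
    by (metis (no_types, lifting) arg_min_if_finite(1,2) not_le)
  have "norm (g x) < norm x"
    using same_branch_moves_inward[OF map_in P_triod P_nonzero same] x g_in by blast
  then show False using x g_in[OF x(1)] by force
qed

end

section \<open>Convex hulls\<close>

lemma triod_hull_superset: "A \<subseteq> triod_hull A"
  unfolding triod_hull_def by auto

lemma triod_hull_least: "C \<subseteq> triod \<Longrightarrow> connected C \<Longrightarrow> A \<subseteq> C \<Longrightarrow> triod_hull A \<subseteq> C"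
  unfolding triod_hull_def by auto

lemma closed_segment_0_triod:
  assumes "x \<in> triod"
  shows "closed_segment 0 x \<subseteq> triod"
proof (cases "x = 0")
  case False
  have "u *\<^sub>R x \<in> triod" if "0 \<le> u" "u \<le> 1" for u
  proof -
    have "u *\<^sub>R x = of_real (u * norm x) * sgn x"
      using norm_times_sgn[of x] by (simp add: scaleR_conv_of_real mult.assoc)
    then show ?thesis
      using of_real_times_in_triod[OF triod_sgn[OF assms False], of "u * norm x"] that
        triod_norm_le[OF assms] by (simp add: mult_le_one)
  qed
  then show ?thesis by (auto simp: closed_segment_def)
qed simp

lemma connected_contains_segment:
  assumes "connected C" "C \<subseteq> triod" "0 \<in> C" "x \<in> C"
  shows "closed_segment 0 x \<subseteq> C"
proof (cases "x = 0")
  case False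
  have e: "sgn x ^ 3 = 1" using assms False triod_sgn by blast
  show ?thesis
  proof
    fix z assume "z \<in> closed_segment 0 x"
    then obtain u where u: "0 \<le> u" "u \<le> 1" "z = u *\<^sub>R x" by (auto simp: closed_segment_def)
    have z: "z = of_real (u * norm x) * sgn x"
      using norm_times_sgn[of x] u by (simp add: scaleR_conv_of_real mult.assoc)
    have "connected (coord (sgn x) ` C)"
      by (intro connected_continuous_image continuous_intros assms)
    moreover have "0 \<in> coord (sgn x) ` C" using assms(3) by (metis coord_0 imageI)
    moreover have "norm x \<in> coord (sgn x) ` C"
      using coord_sgn(1)[OF _ e, of x] assms by (metis image_eqI subsetD)
    ultimately have "u * norm x \<in> coord (sgn x) ` C"
      using u by (meson connected_contains_Icc[of _ 0 "norm x"] atLeastAtMost_iff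
          mult_left_le_one_le mult_nonneg_nonneg norm_ge_zero subsetD)
    then obtain w where w: "w \<in> C" "coord (sgn x) w = u * norm x" by auto
    then have "w = of_real (u * norm x) * sgn x"
      using coord_nonneg_iff[OF _ e, of w] assms(2) u by auto
    then show "z \<in> C" using z w by simp
  qed
qed (use assms in simp)

text \<open>A connected set containing \<open>P\<close> meets two branches, hence contains 0, and
  with 0 it contains every segment from 0 to its points.\<close>

lemma (in triod_cycle) hull_eq: "triod_hull P = (\<Union>x\<in>P. closed_segment 0 x)"
proof
  show "triod_hull P \<subseteq> (\<Union>x\<in>P. closed_segment 0 x)"
  proof (rule triod_hull_least)
    show "connected (\<Union>x\<in>P. closed_segment 0 x)"
      by (rule connected_Union) (auto intro: exI[of _ 0])
  qed (use closed_segment_0_triod P_triod in auto)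
  obtain a b where ab: "a \<in> P" "b \<in> P" "sgn a \<noteq> sgn b" using ex_two_branches by blast
  show "(\<Union>x\<in>P. closed_segment 0 x) \<subseteq> triod_hull P"
    unfolding triod_hull_def
  proof (rule Inter_greatest)
    fix C assume "C \<in> {C. C \<subseteq> triod \<and> connected C \<and> P \<subseteq> C}"
    then have C: "C \<subseteq> triod" "connected C" "P \<subseteq> C" by auto
    have "0 \<in> C"
    proof (rule ccontr)
      assume "0 \<notin> C"
      then have "C \<subseteq> triod - {0}" using C by auto
      then show False using connected_sgn_constant[OF C(2)] ab C(3) by blast
    qed
    then show "(\<Union>x\<in>P. closed_segment 0 x) \<subseteq> C"
      using connected_contains_segment[OF C(2,1)] C(3) by blast
  qed
qed


section \<open>Order conjugacy\<close>

lemma finite_strict_mono_extension: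
  fixes A :: "real set" and f :: "real \<Rightarrow> real"
  assumes "finite A" "strict_mono_on A f"
  shows "\<exists>F. continuous_on UNIV F \<and> strict_mono F \<and> (\<forall>a\<in>A. F a = f a)"
  using assms
proof (induction A rule: finite_linorder_max_induct)
  case empty
  show ?case by (intro exI[of _ "\<lambda>x. x"]) (auto simp: strict_mono_def)
next
  case (insert b A)
  have "strict_mono_on A f" using insert.prems by (auto simp: strict_mono_on_def)
  then obtain F where F: "continuous_on UNIV F" "strict_mono F" "\<And>a. a \<in> A \<Longrightarrow> F a = f a"
    using insert.IH by auto
  show ?case
  proof (cases "A = {}")
    case True
    show ?thesis
      using F(1,2) True
      by (intro exI[of _ "\<lambda>x. F x + (f b - F b)"])
        (auto simp: strict_mono_def intro!: continuous_intros)
  next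
    case False
    define a where "a = Max A"
    have a: "a \<in> A" "a < b" "\<And>x. x \<in> A \<Longrightarrow> x \<le> a"
      using False insert.hyps unfolding a_def by auto
    have fab: "f a < f b" using insert.prems a by (auto simp: strict_mono_on_def)
    define c where "c = (f b - f a) / (b - a)"
    have c: "c > 0" using fab a by (simp add: c_def)
    \<comment> \<open>Right of the old maximum \<open>a\<close> the previous extension is frozen and
      a line of slope \<open>c\<close> takes over; \<open>c\<close> makes it hit
      \<open>f b\<close>.\<close>
    define G where "G = (\<lambda>x. F (min x a) + max 0 (x - a) * c)"
    have "continuous_on UNIV G" unfolding G_def
      by (intro continuous_intros continuous_on_compose2[OF F(1)]) auto
    moreover have "strict_mono G"
    proof (rule strict_monoI)
      fix x y :: real assume "x < y"
      show "G x < G y"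
      proof (cases "y \<le> a")
        case True
        then show ?thesis using \<open>x < y\<close> strict_monoD[OF F(2), of x y] by (simp add: G_def)
      next
        case False
        have "F (min x a) \<le> F a" using strict_mono_less_eq[OF F(2)] by simp
        moreover have "F x < F a" if "x < a" using strict_monoD[OF F(2) that] .
        moreover have "max 0 (x - a) * c \<le> (y - a) * c"
          using False \<open>x < y\<close> c by (intro mult_right_mono) auto
        moreover have "(x - a) * c < (y - a) * c" using \<open>x < y\<close> c by simp
        ultimately show ?thesis using False \<open>x < y\<close>
          by (cases "x < a") (auto simp: G_def)
      qed
    qed
    moreover have "G x = f x" if "x \<in> insert b A" for x
      using that a F(3) by (auto simp: G_def c_def max_def min_def)
    ultimately show ?thesis by blast
  qed
qed

text \<open>The combinatorial form of \<^const>\<open>cycle_equiv\<close>.\<close>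

definition order_conj ::
    "(complex \<Rightarrow> complex) \<Rightarrow> complex set \<Rightarrow> (complex \<Rightarrow> complex) \<Rightarrow> complex set
      \<Rightarrow> (complex \<Rightarrow> complex) \<Rightarrow> bool" where
  "order_conj g P h Q \<phi> \<longleftrightarrow>
     bij_betw \<phi> P Q \<and> (\<forall>x\<in>P. \<phi> (g x) = h (\<phi> x) \<and> sgn (\<phi> x) = sgn x) \<and>
     (\<forall>x\<in>P. \<forall>y\<in>P. sgn x = sgn y \<longrightarrow> norm x < norm y \<longrightarrow> norm (\<phi> x) < norm (\<phi> y))"

lemma order_conjD:
  assumes "order_conj g P h Q \<phi>"
  shows "bij_betw \<phi> P Q" "\<And>x. x \<in> P \<Longrightarrow> \<phi> x \<in> Q" "\<And>x. x \<in> P \<Longrightarrow> \<phi> (g x) = h (\<phi> x)"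
    "\<And>x. x \<in> P \<Longrightarrow> sgn (\<phi> x) = sgn x"
    "\<And>x y. x \<in> P \<Longrightarrow> y \<in> P \<Longrightarrow> sgn x = sgn y \<Longrightarrow> norm (\<phi> x) < norm (\<phi> y) \<longleftrightarrow> norm x < norm y"
proof -
  show b: "bij_betw \<phi> P Q" and "\<And>x. x \<in> P \<Longrightarrow> \<phi> (g x) = h (\<phi> x)"
    and "\<And>x. x \<in> P \<Longrightarrow> sgn (\<phi> x) = sgn x"
    using assms by (auto simp: order_conj_def)
  show "\<And>x. x \<in> P \<Longrightarrow> \<phi> x \<in> Q" using b by (auto simp: bij_betw_def)
  have m: "norm (\<phi> x) < norm (\<phi> y)" if "x \<in> P" "y \<in> P" "sgn x = sgn y" "norm x < norm y" for x y
    using assms that by (auto simp: order_conj_def)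
  show "norm (\<phi> x) < norm (\<phi> y) \<longleftrightarrow> norm x < norm y"
    if "x \<in> P" "y \<in> P" "sgn x = sgn y" for x y
    using m[OF that] m[OF that(2,1)] that(3) complex_polar_eqI[OF that(3)]
    by (metis linorder_less_linear order_less_asym)
qed

text \<open>Nonzero points keep their branch, so only 0 can be mapped to 0. If the order of
  \<open>x\<close> and \<open>y\<close> were reversed, the intermediate value theorem on the segment
  from 0 to \<open>x\<close> would give a second point with the image of \<open>y\<close>, against
  injectivity.\<close>

lemma cycle_equiv_imp_order_conj:
  assumes "cycle g P" "cycle h Q" "cycle_equiv g P h Q"
  obtains \<phi> where "order_conj g P h Q \<phi>"
proof -
  interpret P: triod_cycle g P using assms by unfold_locales
  interpret Q: triod_cycle h Q using assms by unfold_locales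
  obtain H H' where H: "homeomorphism (triod_hull P) (triod_hull Q) H H'" "H ` P = Q"
    "\<And>x. x \<in> P \<Longrightarrow> H (g x) = h (H x)"
    and B: "\<And>B. B \<in> triod_branches \<Longrightarrow> H ` (B \<inter> triod_hull P) \<subseteq> B"
    using assms(3) unfolding cycle_equiv_def by blast
  have inj: "inj_on H (triod_hull P)"
    using H(1) unfolding homeomorphism_def by (metis inj_on_inverseI)
  have hullP: "triod_hull P \<subseteq> triod" unfolding P.hull_eq using closed_segment_0_triod P.P_triod by auto
  have br: "H z \<in> triod \<and> H z \<noteq> 0 \<and> sgn (H z) = sgn z" if z: "z \<in> triod_hull P" "z \<noteq> 0" for z
  proof -
    have zt: "z \<in> triod" using z hullP by auto
    then have "{w \<in> triod. w \<noteq> 0 \<and> sgn w = sgn z} \<in> triod_branches"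
      unfolding triod_branches_eq using triod_sgn[OF zt z(2)] by blast
    from B[OF this] show ?thesis using z zt by blast
  qed
  have zero: "0 \<in> triod_hull P" "0 \<in> triod_hull Q"
    unfolding P.hull_eq Q.hull_eq using P.P_nonempty Q.P_nonempty by auto
  have H0: "H 0 = 0"
  proof -
    have "0 \<in> H ` triod_hull P" using H(1) zero unfolding homeomorphism_def by auto
    then show ?thesis using br by force
  qed
  have mono: "norm (H x) < norm (H y)"
    if xy: "x \<in> P" "y \<in> P" "sgn x = sgn y" "norm x < norm y" for x y
  proof (rule ccontr)
    assume nl: "\<not> norm (H x) < norm (H y)"
    define \<gamma> where "\<gamma> = (\<lambda>t. norm (H (t *\<^sub>R y)))"
    have y0: "norm y > 0" using P.P_nonzero xy by auto
    have seg: "t *\<^sub>R y \<in> triod_hull P" if "0 \<le> t" "t \<le> 1" for t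
      unfolding P.hull_eq using xy that by (auto simp: closed_segment_def)
    define s where "s = norm x / norm y"
    have s: "0 \<le> s" "s < 1" using xy y0 by (auto simp: s_def)
    have "x = s *\<^sub>R y"
    proof (rule complex_polar_eqI)
      show "sgn x = sgn (s *\<^sub>R y)"
        using xy P.P_nonzero[OF xy(1)] P.P_nonzero[OF xy(2)] by (simp add: sgn_scaleR s_def)
    qed (use s y0 in \<open>simp add: s_def\<close>)
    then have "\<gamma> s \<ge> \<gamma> 1" using nl by (simp add: \<gamma>_def)
    moreover have "\<gamma> 0 \<le> \<gamma> 1" by (simp add: \<gamma>_def H0)
    moreover have "continuous_on {0..s} \<gamma>"
    proof -
      have "continuous_on (triod_hull P) H" using H(1) by (auto simp: homeomorphism_def)
      then have "continuous_on {0..s} (\<lambda>t. H (t *\<^sub>R y))"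
      proof (rule continuous_on_compose2)
        show "continuous_on {0..s} (\<lambda>t. t *\<^sub>R y)" by (intro continuous_intros)
        show "(\<lambda>t. t *\<^sub>R y) ` {0..s} \<subseteq> triod_hull P" using seg s by auto
      qed
      then show ?thesis unfolding \<gamma>_def by (rule continuous_on_norm)
    qed
    ultimately obtain t where t: "0 \<le> t" "t \<le> s" "\<gamma> t = \<gamma> 1"
      using IVT'[of \<gamma> 0 "\<gamma> 1" s] s by auto
    have y: "y \<noteq> 0" "y \<in> triod_hull P" using P.P_nonzero xy seg[of 1] by auto
    have "t \<noteq> 0"
    proof
      assume "t = 0"
      then have "H y = 0" using t by (simp add: \<gamma>_def H0)
      then show False using br[OF y(2,1)] by simp
    qed
    then have "sgn (H (t *\<^sub>R y)) = sgn (H y)"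
      using br[OF y(2,1)] br[OF seg[of t]] t s y by (simp add: sgn_scaleR)
    then have "H (t *\<^sub>R y) = H y"
      by (rule complex_polar_eqI) (use t(3) in \<open>simp add: \<gamma>_def\<close>)
    then have "t *\<^sub>R y = y" using inj_onD[OF inj] seg[of t] y t s by auto
    then have "t = 1" using y(1) by (metis scaleR_cancel_right scaleR_one)
    then show False using t s by simp
  qed
  have "P \<subseteq> triod_hull P" by (rule triod_hull_superset)
  then have "bij_betw H P Q" using inj H(2) by (auto simp: bij_betw_def intro: inj_on_subset)
  then have "order_conj g P h Q H"
    unfolding order_conj_def using H(3) br P.P_nonzero mono \<open>P \<subseteq> triod_hull P\<close> by blast
  then show ?thesis by (rule that)
qed

text \<open>The homeomorphism acts radially: on each branch the distance from 0 is reparametrised by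
  an increasing function interpolating \<open>\<phi>\<close>.\<close>

lemma order_conj_imp_cycle_equiv:
  assumes "cycle g P" "cycle h Q" "order_conj g P h Q \<phi>"
  shows "cycle_equiv g P h Q"
proof -
  interpret P: triod_cycle g P using assms by unfold_locales
  interpret Q: triod_cycle h Q using assms by unfold_locales
  note oc = order_conjD[OF assms(3)]
  have "\<exists>F. continuous_on UNIV F \<and> strict_mono F \<and> F 0 = 0 \<and>
      (\<forall>x\<in>P. sgn x = e \<longrightarrow> F (norm x) = norm (\<phi> x))" for e
  proof -
    \<comment> \<open>The node 0 is added so that the interpolations of the three branches agree at
      the branching point.\<close>
    define A where "A = insert 0 (norm ` {x \<in> P. sgn x = e})"
    define f where "f = (\<lambda>t. if t = 0 then 0 else norm (\<phi> (of_real t * e)))"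
    have f: "f (norm x) = norm (\<phi> x)" if "x \<in> P" "sgn x = e" for x
      using that norm_times_sgn[of x] P.P_nonzero by (simp add: f_def)
    have "strict_mono_on A f"
    proof (rule strict_mono_onI)
      fix r s assume rs: "r \<in> A" "s \<in> A" "r < s"
      then have "s \<noteq> 0" unfolding A_def by auto
      then obtain y where y: "y \<in> P" "sgn y = e" "s = norm y" using rs by (auto simp: A_def)
      show "f r < f s"
      proof (cases "r = 0")
        case True
        then show ?thesis using f[OF y(1,2)] y oc(2)[OF y(1)] Q.P_nonzero by (auto simp: f_def)
      next
        case False
        then obtain x where x: "x \<in> P" "sgn x = e" "r = norm x" using rs by (auto simp: A_def)
        then show ?thesis using f[OF y(1,2)] f[OF x(1,2)] oc(5)[OF x(1) y(1)] rs y by simp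
      qed
    qed
    moreover have "finite A" using P.finite_P by (simp add: A_def)
    ultimately obtain F where F: "continuous_on UNIV F" "strict_mono F" "\<And>a. a \<in> A \<Longrightarrow> F a = f a"
      using finite_strict_mono_extension by blast
    moreover have "F 0 = 0" using F(3)[of 0] by (simp add: A_def f_def)
    moreover have "F (norm x) = norm (\<phi> x)" if "x \<in> P" "sgn x = e" for x
      using F(3)[of "norm x"] f[OF that] that by (simp add: A_def)
    ultimately show ?thesis by blast
  qed
  then obtain F where F: "\<And>e. continuous_on UNIV (F e)" "\<And>e. strict_mono (F e)" "\<And>e. F e 0 = 0"
    "\<And>x. x \<in> P \<Longrightarrow> F (sgn x) (norm x) = norm (\<phi> x)" by metis
  define H where "H = (\<lambda>z. of_real (F (sgn z) (norm z)) * sgn z)"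
  have Fpos: "F e t > 0" if "t > 0" for e t using strict_monoD[OF F(2) that, of e] F(3) by simp
  have H0: "H 0 = 0" by (simp add: H_def)
  have Hray: "H (u *\<^sub>R x) = of_real (F (sgn x) (u * norm x)) * sgn x" if "u \<ge> 0" for u x
    using that F(3) by (cases "u = 0") (auto simp: H_def sgn_scaleR)
  have seg: "H ` closed_segment 0 x = closed_segment 0 (\<phi> x)" if x: "x \<in> P" for x
  proof -
    have nx: "norm x > 0" "norm (\<phi> x) > 0" using x P.P_nonzero Q.P_nonzero oc(2) by auto
    have px: "\<phi> x = of_real (norm (\<phi> x)) * sgn x"
      using norm_times_sgn[of "\<phi> x"] oc(4)[OF x] by simp
    show ?thesis
    proof (intro equalityI subsetI)
      fix w assume "w \<in> H ` closed_segment 0 x"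
      then obtain u where u: "0 \<le> u" "u \<le> 1" "w = H (u *\<^sub>R x)" by (auto simp: closed_segment_def)
      define r where "r = F (sgn x) (u * norm x)"
      have "F (sgn x) 0 \<le> r" "r \<le> F (sgn x) (norm x)"
        unfolding r_def using u nx by (auto simp: strict_mono_less_eq[OF F(2)] mult_left_le_one_le)
      then have r: "0 \<le> r" "r \<le> norm (\<phi> x)" using F(3,4) x by auto
      have "w = (r / norm (\<phi> x)) *\<^sub>R \<phi> x"
        using u(3) Hray[OF u(1), of x] nx
        by (subst px) (simp add: r_def scaleR_conv_of_real)
      then show "w \<in> closed_segment 0 (\<phi> x)"
        unfolding closed_segment_def using r nx by (auto intro!: exI[of _ "r / norm (\<phi> x)"])
    next
      fix w assume "w \<in> closed_segment 0 (\<phi> x)"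
      then obtain v where v: "0 \<le> v" "v \<le> 1" "w = v *\<^sub>R \<phi> x" by (auto simp: closed_segment_def)
      have "F (sgn x) 0 \<le> v * norm (\<phi> x)" "v * norm (\<phi> x) \<le> F (sgn x) (norm x)"
        using v nx F(3,4) x by (auto simp: mult_left_le_one_le)
      then obtain t where t: "0 \<le> t" "t \<le> norm x" "F (sgn x) t = v * norm (\<phi> x)"
        using IVT'[of "F (sgn x)" 0 "v * norm (\<phi> x)" "norm x"] nx
          continuous_on_subset[OF F(1), of "{0..norm x}"] by auto
      have "H ((t / norm x) *\<^sub>R x) = of_real (F (sgn x) t) * sgn x"
        using Hray[of "t / norm x" x] t nx by simp
      also have "\<dots> = v *\<^sub>R (of_real (norm (\<phi> x)) * sgn x)"
        using t by (simp add: scaleR_conv_of_real)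
      also have "\<dots> = w" using v px by simp
      finally have "H ((t / norm x) *\<^sub>R x) = w" .
      moreover have "(t / norm x) *\<^sub>R x \<in> closed_segment 0 x"
        using t nx unfolding closed_segment_def by (auto intro!: exI[of _ "t / norm x"])
      ultimately show "w \<in> H ` closed_segment 0 x" by blast
    qed
  qed
  have img: "H ` triod_hull P = triod_hull Q"
    unfolding P.hull_eq Q.hull_eq image_UN using seg oc(1) by (auto simp: bij_betw_def)
  have inj: "inj_on H A" for A
  proof (rule inj_onI)
    fix z w assume "H z = H w"
    have sg: "sgn (H z) = sgn z" for z
      by (cases "z = 0") (use Fpos[of "norm z" "sgn z"] in
          \<open>auto simp: H_def sgn_mult sgn_of_real sgn_sgn\<close>)
    have nm: "norm (H z) = F (sgn z) (norm z)" for z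
      by (cases "z = 0") (use Fpos[of "norm z" "sgn z"] F(3) in
          \<open>auto simp: H_def norm_mult norm_sgn\<close>)
    have s: "sgn z = sgn w" using \<open>H z = H w\<close> sg by metis
    moreover have "norm z = norm w"
      using nm[of z] nm[of w] \<open>H z = H w\<close> s strict_mono_eq[OF F(2)] by metis
    ultimately show "z = w" by (rule complex_polar_eqI)
  qed
  have cont: "continuous_on (triod_hull P) H"
    unfolding P.hull_eq
  proof (rule continuous_on_closed_Union)
    fix x assume "x \<in> P"
    have "continuous_on (closed_segment 0 x) (\<lambda>z. of_real (F (sgn x) (norm z)) * sgn x)"
      by (intro continuous_intros continuous_on_compose2[OF F(1)]) auto
    moreover have "H z = of_real (F (sgn x) (norm z)) * sgn x" if "z \<in> closed_segment 0 x" for z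
      using that Hray[of _ x] by (auto simp: closed_segment_def)
    ultimately show "continuous_on (closed_segment 0 x) H"
      by (simp cong: continuous_on_cong)
  qed (use P.finite_P in auto)
  have "compact (triod_hull P)"
    unfolding P.hull_eq using P.finite_P by (intro compact_UN) auto
  then obtain H' where "homeomorphism (triod_hull P) (triod_hull Q) H H'"
    using homeomorphism_compact[OF _ cont img inj] by blast
  moreover have HP: "H x = \<phi> x" if "x \<in> P" for x
    using that F(4) oc(4) norm_times_sgn[of "\<phi> x"] by (simp add: H_def)
  then have "H ` P = Q" using oc(1) by (auto simp: bij_betw_def)
  moreover have "\<forall>x\<in>P. H (g x) = h (H x)" using HP oc(3) P.g_in by auto
  moreover have "H ` (B \<inter> triod_hull P) \<subseteq> B" if B: "B \<in> triod_branches" for B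
  proof -
    obtain e where e: "B = {z \<in> triod. z \<noteq> 0 \<and> sgn z = e}" "e ^ 3 = 1"
      using B unfolding triod_branches_eq by auto
    show ?thesis
    proof
      fix w assume "w \<in> H ` (B \<inter> triod_hull P)"
      then obtain z where z: "z \<in> triod" "z \<noteq> 0" "sgn z = e" "z \<in> triod_hull P" "w = H z"
        using e by auto
      have "w \<in> triod_hull Q" using z img by auto
      then have "w \<in> triod" unfolding Q.hull_eq using closed_segment_0_triod Q.P_triod by auto
      moreover have "w = of_real (F e (norm z)) * e" using z by (simp add: H_def)
      ultimately show "w \<in> B"
        using e sgn_of_real_times[OF e(2) Fpos] Fpos[of "norm z" e] z by (auto simp: cube_root_nonzero)
    qed
  qed
  ultimately show ?thesis unfolding cycle_equiv_def by blast
qed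


section \<open>Covering walks and the cycles that realise them\<close>

text \<open>For points of a cycle: the image of the interval between the branching point and \<open>x\<close> contains
  the interval between the branching point and \<open>y\<close>.\<close>

definition covers :: "(complex \<Rightarrow> complex) \<Rightarrow> complex \<Rightarrow> complex \<Rightarrow> bool" where
  "covers g x y \<longleftrightarrow> sgn y = sgn (g x) \<and> norm y \<le> norm (g x)"

text \<open>Together with \<open>norm x\<close> this bounds the gap of \<open>P\<close> just inside
  \<open>x\<close>; the value 0 stands for the branching point as inner neighbour.\<close>

definition below :: "complex set \<Rightarrow> complex \<Rightarrow> real" where
  "below P x = Max (insert 0 (norm ` {u \<in> P. sgn u = sgn x \<and> norm u < norm x}))"

text \<open>In a tight walk the interval between \<open>\<xi> i\<close> and its inner neighbour crosses the interval between
  \<open>\<xi> (Suc i)\<close> and its inner neighbour in outward direction.\<close>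

definition tight_walk :: "(complex \<Rightarrow> complex) \<Rightarrow> complex set \<Rightarrow> (nat \<Rightarrow> complex) \<Rightarrow> bool" where
  "tight_walk g P \<xi> \<longleftrightarrow>
     (\<forall>i. \<xi> i \<in> P \<and> covers g (\<xi> i) (\<xi> (Suc i)) \<and>
       (\<forall>u\<in>P. sgn u = sgn (\<xi> i) \<longrightarrow> norm u < norm (\<xi> i) \<longrightarrow> \<not> covers g u (\<xi> (Suc i))))"

text \<open>Only an inequality is asked of the image, so that the walk's own norms qualify and an
  infimum can be taken. For the least sequence it becomes an equation, see
  \<open>shadow_step\<close>.\<close>

definition admissible ::
    "(complex \<Rightarrow> complex) \<Rightarrow> complex set \<Rightarrow> (nat \<Rightarrow> complex) \<Rightarrow> (nat \<Rightarrow> real) \<Rightarrow> bool" where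
  "admissible g P \<xi> z \<longleftrightarrow>
     (\<forall>i. below P (\<xi> i) \<le> z i \<and> z i \<le> norm (\<xi> i) \<and>
       z (Suc i) \<le> coord (sgn (\<xi> (Suc i))) (g (of_real (z i) * sgn (\<xi> i))))"

text \<open>The pointwise least admissible sequence is an orbit. It depends on the walk monotonically,
  which makes the order of the points of the orbit independent of the map.\<close>

definition shadow :: "(complex \<Rightarrow> complex) \<Rightarrow> complex set \<Rightarrow> (nat \<Rightarrow> complex) \<Rightarrow> real" where
  "shadow g P \<xi> = Inf {z 0 |z. admissible g P \<xi> z}"

definition shadow_point :: "(complex \<Rightarrow> complex) \<Rightarrow> complex set \<Rightarrow> (nat \<Rightarrow> complex) \<Rightarrow> complex" where
  "shadow_point g P \<xi> = of_real (shadow g P \<xi>) * sgn (\<xi> 0)"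

text \<open>The order is lexicographic because outward crossings carry a comparison back to earlier
  members unchanged.\<close>

definition walk_less :: "(nat \<Rightarrow> complex) \<Rightarrow> (nat \<Rightarrow> complex) \<Rightarrow> bool" where
  "walk_less \<xi> \<xi>' \<longleftrightarrow> (\<exists>m. (\<forall>l<m. \<xi> l = \<xi>' l) \<and> norm (\<xi> m) < norm (\<xi>' m))"

abbreviation (input) tail :: "nat \<Rightarrow> (nat \<Rightarrow> 'a) \<Rightarrow> nat \<Rightarrow> 'a" where
  "tail i \<xi> \<equiv> (\<lambda>l. \<xi> (l + i))"

lemma tight_walkD:
  assumes "tight_walk g P \<xi>"
  shows "\<xi> i \<in> P" "sgn (\<xi> (Suc i)) = sgn (g (\<xi> i))" "norm (\<xi> (Suc i)) \<le> norm (g (\<xi> i))"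
    "\<And>u. u \<in> P \<Longrightarrow> sgn u = sgn (\<xi> i) \<Longrightarrow> norm u < norm (\<xi> i) \<Longrightarrow> \<not> covers g u (\<xi> (Suc i))"
  using assms unfolding tight_walk_def covers_def by auto

lemma tight_walk_tail: "tight_walk g P \<xi> \<Longrightarrow> tight_walk g P (tail i \<xi>)"
  unfolding tight_walk_def by auto

lemma admissible_tail: "admissible g P \<xi> z \<Longrightarrow> admissible g P (tail (Suc 0) \<xi>) (tail (Suc 0) z)"
  unfolding admissible_def by auto

lemma admissible_Cons:
  assumes "admissible g P (tail (Suc 0) \<xi>) w" "below P (\<xi> 0) \<le> u" "u \<le> norm (\<xi> 0)"
    "w 0 \<le> coord (sgn (\<xi> (Suc 0))) (g (of_real u * sgn (\<xi> 0)))"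
  shows "admissible g P \<xi> (case_nat u w)"
  unfolding admissible_def
proof
  fix i
  show "below P (\<xi> i) \<le> case_nat u w i \<and> case_nat u w i \<le> norm (\<xi> i) \<and>
    case_nat u w (Suc i) \<le> coord (sgn (\<xi> (Suc i))) (g (of_real (case_nat u w i) * sgn (\<xi> i)))"
    using assms unfolding admissible_def by (cases i) auto
qed

section \<open>Least admissible sequences of tight walks\<close>

context triod_cycle
begin

lemma below_finite: "finite (insert 0 (norm ` {u \<in> P. sgn u = sgn x \<and> norm u < norm x}))"
  using finite_P by simp

lemma below_nonneg: "0 \<le> below P x"
  unfolding below_def using below_finite by (intro Max_ge) auto

lemma below_less: "x \<in> P \<Longrightarrow> below P x < norm x"
  unfolding below_def using below_finite P_nonzero by (subst Max_less_iff) auto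

lemma le_below: "u \<in> P \<Longrightarrow> sgn u = sgn x \<Longrightarrow> norm u < norm x \<Longrightarrow> norm u \<le> below P x"
  unfolding below_def using below_finite by (intro Max_ge) auto

lemma below_cases:
  obtains "below P x = 0"
  | u where "u \<in> P" "sgn u = sgn x" "norm u < norm x" "below P x = norm u"
proof -
  have "below P x \<in> insert 0 (norm ` {u \<in> P. sgn u = sgn x \<and> norm u < norm x})"
    unfolding below_def by (rule Max_in[OF below_finite]) simp
  then show ?thesis using that by auto
qed

lemma admissible_norm:
  assumes "tight_walk g P \<xi>"
  shows "admissible g P \<xi> (\<lambda>i. norm (\<xi> i))"
  unfolding admissible_def
proof
  fix i
  note W = tight_walkD[OF assms]
  have "coord (sgn (\<xi> (Suc i))) (g (\<xi> i)) = norm (g (\<xi> i))"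
    using coord_sgn(1) P_triod g_in sgn_cube W(1,2) by metis
  then show "below P (\<xi> i) \<le> norm (\<xi> i) \<and> norm (\<xi> i) \<le> norm (\<xi> i) \<and> norm (\<xi> (Suc i)) \<le>
      coord (sgn (\<xi> (Suc i))) (g (of_real (norm (\<xi> i)) * sgn (\<xi> i)))"
    using W(1,3)[of i] below_less[of "\<xi> i"] by (simp add: norm_times_sgn)
qed

lemma shadow_bdd: "bdd_below {z 0 |z. admissible g P \<xi> z}"
  by (rule bdd_belowI[of _ "below P (\<xi> 0)"]) (auto simp: admissible_def)

lemma shadow_le: "admissible g P \<xi> z \<Longrightarrow> shadow g P \<xi> \<le> z 0"
  unfolding shadow_def using shadow_bdd by (intro cInf_lower) auto

lemma shadow_ge:
  assumes "tight_walk g P \<xi>" "\<And>z. admissible g P \<xi> z \<Longrightarrow> c \<le> z 0"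
  shows "c \<le> shadow g P \<xi>"
  unfolding shadow_def using admissible_norm[OF assms(1)] assms(2) by (intro cInf_greatest) auto

lemma shadow_bounds:
  assumes "tight_walk g P \<xi>"
  shows "below P (\<xi> 0) \<le> shadow g P \<xi>" "shadow g P \<xi> \<le> norm (\<xi> 0)"
proof -
  show "below P (\<xi> 0) \<le> shadow g P \<xi>"
    using assms by (rule shadow_ge) (auto simp: admissible_def)
  show "shadow g P \<xi> \<le> norm (\<xi> 0)" using shadow_le[OF admissible_norm[OF assms]] .
qed

text \<open>This is the outward crossing. By tightness the inner neighbour does not cover
  \<open>\<xi> (Suc 0)\<close>, so its image is on another branch, where the coordinate is negative,
  or at most at the inner end of the next gap.\<close>

lemma coord_below_le:
  assumes "tight_walk g P \<xi>"
  shows "coord (sgn (\<xi> (Suc 0))) (g (of_real (below P (\<xi> 0)) * sgn (\<xi> 0))) \<le> below P (\<xi> (Suc 0))"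
proof (cases rule: below_cases[of "\<xi> 0"])
  case 1
  then show ?thesis using below_nonneg triod_mapsD(3)[OF map_in] by simp
next
  case (2 u)
  note W = tight_walkD[OF assms]
  have "of_real (below P (\<xi> 0)) * sgn (\<xi> 0) = u" using 2 norm_times_sgn[of u] by simp
  moreover have "coord (sgn (\<xi> (Suc 0))) (g u) \<le> below P (\<xi> (Suc 0))"
  proof (cases "sgn (g u) = sgn (\<xi> (Suc 0))")
    case True
    then have "norm (g u) < norm (\<xi> (Suc 0))"
      using W(4)[OF 2(1-3)] by (auto simp: covers_def)
    then show ?thesis
      using True coord_sgn(1) le_below g_in[OF 2(1)] P_triod sgn_cube W(1) by metis
  next
    case False
    then show ?thesis
      using coord_sgn(2)[of "g u" "sgn (\<xi> (Suc 0))"] g_in[OF 2(1)] P_triod P_nonzero sgn_cube W(1)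
        below_nonneg by (metis order_less_imp_le order_trans)
  qed
  ultimately show ?thesis by simp
qed

text \<open>The condition that the image reaches \<open>t\<close> is closed, so it survives the
  infimum. If the image went beyond \<open>t\<close>, continuity would allow a smaller first entry
  followed by an admissible tail.\<close>

lemma shadow_step:
  assumes "tight_walk g P \<xi>"
  shows "g (shadow_point g P \<xi>) = shadow_point g P (tail (Suc 0) \<xi>)"
proof -
  note W = tight_walkD[OF assms]
  note T = tight_walk_tail[OF assms, of "Suc 0"]
  define e0 e1 where "e0 = sgn (\<xi> 0)" and "e1 = sgn (\<xi> (Suc 0))"
  have e: "e0 ^ 3 = 1" "e1 ^ 3 = 1" using sgn_cube W(1) by (auto simp: e0_def e1_def)
  define C where "C = (\<lambda>u. coord e1 (g (of_real u * e0)))"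
  define u t where "u = shadow g P \<xi>" and "t = shadow g P (tail (Suc 0) \<xi>)"
  have cont: "continuous_on {0..1} C" unfolding C_def
    by (intro continuous_intros continuous_on_ray[OF triod_mapsD(1)[OF map_in] e(1)]) simp
  have range: "0 \<le> v \<and> v \<le> 1" if "below P (\<xi> 0) \<le> v" "v \<le> norm (\<xi> 0)" for v
    using that below_nonneg[of "\<xi> 0"] triod_norm_le[OF P_triod[OF W(1)[of 0]]] by auto
  have ub: "below P (\<xi> 0) \<le> u" "u \<le> norm (\<xi> 0)" using shadow_bounds[OF assms] by (auto simp: u_def)
  have tb: "below P (\<xi> (Suc 0)) \<le> t" using shadow_bounds[OF T] by (simp add: t_def)
  have ge: "t \<le> C u"
  proof -
    have "closed {v \<in> {0..1}. t \<le> C v}"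
      by (rule continuous_on_closed_Collect_le) (auto intro: cont)
    moreover have "{z 0 |z. admissible g P \<xi> z} \<subseteq> {v \<in> {0..1}. t \<le> C v}"
    proof safe
      fix z assume z: "admissible g P \<xi> z"
      show "z 0 \<in> {0..1}" using z range by (simp add: admissible_def)
      have "t \<le> z (Suc 0)" using shadow_le[OF admissible_tail[OF z]] by (simp add: t_def)
      also have "\<dots> \<le> C (z 0)" using z by (simp add: admissible_def C_def e0_def e1_def)
      finally show "t \<le> C (z 0)" .
    qed
    ultimately have "u \<in> {v \<in> {0..1}. t \<le> C v}"
      unfolding u_def shadow_def using admissible_norm[OF assms] shadow_bdd
      by (intro closed_subset_contains_Inf) auto
    then show ?thesis by simp
  qed
  have "C u \<le> t"
  proof (rule ccontr)
    assume "\<not> C u \<le> t"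
    then have lt: "Inf {z 0 |z. admissible g P (tail (Suc 0) \<xi>) z} < C u" by (simp add: t_def shadow_def)
    have "{z 0 |z. admissible g P (tail (Suc 0) \<xi>) z} \<noteq> {}"
      using admissible_norm[OF T] by auto
    from cInf_lessD[OF this lt] obtain w
      where w: "admissible g P (tail (Suc 0) \<xi>) w" "w 0 < C u" by auto
    \<comment> \<open>There is room to lower \<open>u\<close>: at the inner end of the gap
      \<open>coord_below_le\<close> already bounds the image by \<open>t\<close>.\<close>
    have "below P (\<xi> 0) \<noteq> u"
    proof
      assume "below P (\<xi> 0) = u"
      then show False
        using coord_below_le[OF assms] tb \<open>\<not> C u \<le> t\<close> by (simp add: C_def e0_def e1_def)
    qed
    then have lt: "below P (\<xi> 0) < u" using ub by simp
    have "u \<in> {0..1}" using range[OF ub] by simp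
    then obtain d where d: "d > 0" "\<And>v. v \<in> {0..1} \<Longrightarrow> dist v u < d \<Longrightarrow> dist (C v) (C u) < C u - w 0"
      using cont w(2) unfolding continuous_on_iff by (metis diff_gt_0_iff_gt)
    define v where "v = max (below P (\<xi> 0)) (u - d / 2)"
    have v: "below P (\<xi> 0) \<le> v" "v < u" "dist v u < d"
      using lt d(1) by (auto simp: v_def dist_real_def max_def)
    then have "dist (C v) (C u) < C u - w 0" using d(2)[of v] range[of v] ub by auto
    then have "w 0 \<le> C v" by (simp add: dist_real_def abs_if split: if_splits)
    then have "admissible g P \<xi> (case_nat v w)"
      using v ub by (intro admissible_Cons w(1)) (auto simp: C_def e0_def e1_def)
    then have "u \<le> v" using shadow_le by (fastforce simp: u_def)
    then show False using v by simp
  qed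
  then have Cu: "C u = t" using ge by simp
  have "of_real u * e0 \<in> triod" using of_real_times_in_triod[OF e(1)] range[OF ub] by blast
  then have "g (of_real u * e0) = of_real t * e1"
    using coord_nonneg_iff[OF triod_mapsD(2)[OF map_in] e(2), of "of_real u * e0"] Cu tb
      below_nonneg[of "\<xi> (Suc 0)"] by (simp add: C_def)
  then show ?thesis by (simp add: shadow_point_def u_def t_def e0_def e1_def)
qed

lemma shadow_point_sgn:
  assumes "tight_walk g P \<xi>"
  shows "norm (shadow_point g P \<xi>) = shadow g P \<xi>"
    and "shadow_point g P \<xi> \<noteq> 0 \<Longrightarrow> sgn (shadow_point g P \<xi>) = sgn (\<xi> 0)"
    and "shadow_point g P \<xi> \<in> triod"
proof -
  have e: "sgn (\<xi> 0) ^ 3 = 1" using sgn_cube tight_walkD(1)[OF assms] by blast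
  have nn: "0 \<le> shadow g P \<xi>" using shadow_bounds[OF assms] below_nonneg[of "\<xi> 0"] by linarith
  show "norm (shadow_point g P \<xi>) = shadow g P \<xi>"
    unfolding shadow_point_def using norm_of_real_times[OF e nn] .
  show "sgn (shadow_point g P \<xi>) = sgn (\<xi> 0)" if "shadow_point g P \<xi> \<noteq> 0"
  proof -
    have "shadow g P \<xi> > 0" using that nn by (auto simp: shadow_point_def less_le)
    then show ?thesis unfolding shadow_point_def by (rule sgn_of_real_times[OF e])
  qed
  show "shadow_point g P \<xi> \<in> triod"
    unfolding shadow_point_def using shadow_bounds[OF assms] tight_walkD(1)[OF assms, of 0] P_triod
    by (intro of_real_times_in_triod[OF e nn]) (meson order_trans triod_norm_le)
qed

text \<open>A first entry admissible for \<open>\<xi>'\<close> can be followed by a sequence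
  admissible for the lower tail, which gives the weak inequality. Equal shadows with the same first
  member would have equal images.\<close>

lemma shadow_mono:
  assumes "tight_walk g P \<xi>" "tight_walk g P \<xi>'" "\<xi> 0 = \<xi>' 0"
    "shadow g P (tail (Suc 0) \<xi>) < shadow g P (tail (Suc 0) \<xi>')"
  shows "shadow g P \<xi> < shadow g P \<xi>'"
proof -
  have s: "sgn (\<xi> (Suc 0)) = sgn (\<xi>' (Suc 0))"
    using tight_walkD(2)[OF assms(1)] tight_walkD(2)[OF assms(2)] assms(3) by metis
  note T = tight_walk_tail[OF assms(1), of "Suc 0"] tight_walk_tail[OF assms(2), of "Suc 0"]
  have "shadow g P \<xi> \<le> shadow g P \<xi>'"
  proof (rule shadow_ge[OF assms(2)])
    fix z assume z: "admissible g P \<xi>' z"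
    have "shadow g P (tail (Suc 0) \<xi>') \<le> z (Suc 0)" using shadow_le[OF admissible_tail[OF z]] by simp
    then have lt: "Inf {z 0 |z. admissible g P (tail (Suc 0) \<xi>) z} < z (Suc 0)"
      using assms(4) by (simp add: shadow_def)
    have "{z 0 |z. admissible g P (tail (Suc 0) \<xi>) z} \<noteq> {}"
      using admissible_norm[OF T(1)] by auto
    from cInf_lessD[OF this lt] obtain w
      where w: "admissible g P (tail (Suc 0) \<xi>) w" "w 0 < z (Suc 0)" by auto
    have "admissible g P \<xi> (case_nat (z 0) w)"
    proof (rule admissible_Cons[OF w(1)])
      show "w 0 \<le> coord (sgn (\<xi> (Suc 0))) (g (of_real (z 0) * sgn (\<xi> 0)))"
        using z w(2) s assms(3) unfolding admissible_def by (smt (verit))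
    qed (use z assms(3) in \<open>auto simp: admissible_def\<close>)
    then show "shadow g P \<xi> \<le> z 0" using shadow_le by fastforce
  qed
  moreover have "shadow g P \<xi> \<noteq> shadow g P \<xi>'"
  proof
    assume "shadow g P \<xi> = shadow g P \<xi>'"
    then have "shadow_point g P \<xi> = shadow_point g P \<xi>'" using assms(3) by (simp add: shadow_point_def)
    then have "norm (shadow_point g P (tail (Suc 0) \<xi>)) = norm (shadow_point g P (tail (Suc 0) \<xi>'))"
      using shadow_step[OF assms(1)] shadow_step[OF assms(2)] by metis
    then show False using assms(4) shadow_point_sgn(1)[OF T(1)] shadow_point_sgn(1)[OF T(2)] by simp
  qed
  ultimately show ?thesis by simp
qed

text \<open>At the first difference the gap of \<open>\<xi>\<close> lies inside that of
  \<open>\<xi>'\<close>, but they may share an end point. Avoiding \<open>P\<close> makes the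
  inequality strict there, and \<open>shadow_mono\<close> carries it back.\<close>

lemma shadow_less:
  assumes "tight_walk g P \<xi>" "tight_walk g P \<xi>'" "sgn (\<xi> 0) = sgn (\<xi>' 0)"
    "walk_less \<xi> \<xi>'" "\<And>i. shadow_point g P (tail i \<xi>) \<notin> P"
  shows "shadow g P \<xi> < shadow g P \<xi>'"
proof -
  obtain m where "\<forall>l<m. \<xi> l = \<xi>' l" "norm (\<xi> m) < norm (\<xi>' m)"
    using assms(4) by (auto simp: walk_less_def)
  then show ?thesis using assms(1,2,3,5)
  proof (induction m arbitrary: \<xi> \<xi>')
    case 0
    have "shadow g P \<xi> \<noteq> norm (\<xi> 0)"
    proof
      assume "shadow g P \<xi> = norm (\<xi> 0)"
      then have "shadow_point g P (tail 0 \<xi>) = \<xi> 0" by (simp add: shadow_point_def norm_times_sgn)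
      then show False using "0.prems"(6)[of 0] tight_walkD(1)[OF "0.prems"(3), of 0] by simp
    qed
    then have "shadow g P \<xi> < norm (\<xi> 0)" using shadow_bounds[OF "0.prems"(3)] by simp
    also have "\<dots> \<le> below P (\<xi>' 0)"
      using le_below 0 tight_walkD(1) by metis
    also have "\<dots> \<le> shadow g P \<xi>'" using shadow_bounds[OF "0.prems"(4)] by simp
    finally show ?case .
  next
    case (Suc m)
    have "shadow g P (tail (Suc 0) \<xi>) < shadow g P (tail (Suc 0) \<xi>')"
    proof (rule Suc.IH)
      show "sgn (tail (Suc 0) \<xi> 0) = sgn (tail (Suc 0) \<xi>' 0)"
        using tight_walkD(2)[OF Suc.prems(3)] tight_walkD(2)[OF Suc.prems(4)] Suc.prems(1)
        by (metis add_0 zero_less_Suc)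
      show "shadow_point g P (tail i (tail (Suc 0) \<xi>)) \<notin> P" for i
        using Suc.prems(6)[of "Suc i"] by (simp add: add.commute)
    qed (use Suc.prems tight_walk_tail[OF Suc.prems(3), of "Suc 0"]
          tight_walk_tail[OF Suc.prems(4), of "Suc 0"] in auto)
    then show ?case using shadow_mono Suc.prems by blast
  qed
qed

end

text \<open>Each member determines the branch of the next one, so walks starting on the same branch
  first differ in a norm.\<close>

lemma walk_less_linear:
  assumes "tight_walk g P \<xi>" "tight_walk g P \<xi>'" "sgn (\<xi> 0) = sgn (\<xi>' 0)"
  shows "\<xi> = \<xi>' \<or> walk_less \<xi> \<xi>' \<or> walk_less \<xi>' \<xi>"
proof (rule disjCI)
  assume n: "\<not> (walk_less \<xi> \<xi>' \<or> walk_less \<xi>' \<xi>)"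
  have "\<xi> l = \<xi>' l" for l
  proof (induction l rule: less_induct)
    case (less l)
    have "norm (\<xi> l) = norm (\<xi>' l)" using n less unfolding walk_less_def by (metis linorder_less_linear)
    moreover have "sgn (\<xi> l) = sgn (\<xi>' l)"
      using assms(3) less tight_walkD(2)[OF assms(1)] tight_walkD(2)[OF assms(2)]
      by (cases l) auto
    ultimately show ?case using complex_polar_eqI by blast
  qed
  then show "\<xi> = \<xi>'" by auto
qed


text \<open>The member with a point of \<open>P\<close> inside it keeps the shadow orbit from
  collapsing to the fixed point 0. The last condition keeps it from being \<open>P\<close> itself,
  or a copy of \<open>P\<close> with the same pattern.\<close>

definition realisable_walk ::
    "(complex \<Rightarrow> complex) \<Rightarrow> complex set \<Rightarrow> nat \<Rightarrow> (nat \<Rightarrow> complex) \<Rightarrow> bool" where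
  "realisable_walk g P N \<xi> \<longleftrightarrow>
     tight_walk g P \<xi> \<and> 0 < N \<and> (\<forall>i. \<xi> (i + N) = \<xi> i) \<and>
     (\<exists>i. \<exists>u\<in>P. sgn u = sgn (\<xi> i) \<and> norm u < norm (\<xi> i)) \<and>
     \<not> (\<exists>x\<in>P. (g ^^ N) x = x \<and> (\<forall>k. sgn ((g ^^ k) x) = sgn (\<xi> k)))"

locale realised_walk = triod_cycle +
  fixes N :: nat and \<xi> :: "nat \<Rightarrow> complex"
  assumes walk: "realisable_walk g P N \<xi>"
begin

definition pt :: "nat \<Rightarrow> complex" where
  "pt i = shadow_point g P (tail i \<xi>)"

lemma tight: "tight_walk g P \<xi>" and N_pos: "0 < N" and \<xi>_period: "\<xi> (i + N) = \<xi> i"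
  using walk by (auto simp: realisable_walk_def)

lemma tight_tail: "tight_walk g P (tail i \<xi>)"
  using tight by (rule tight_walk_tail)

lemma pt_step: "g (pt i) = pt (Suc i)"
  using shadow_step[OF tight_tail[of i]] by (simp add: pt_def)

lemma pt_funpow: "(g ^^ k) (pt i) = pt (k + i)"
  by (induction k) (auto simp: pt_step)

lemma pt_period: "pt (i + j * N) = pt i"
proof -
  have "\<xi> (l + j * N) = \<xi> l" for l
  proof (induction j)
    case (Suc j)
    then show ?case using \<xi>_period[of "l + j * N"] by (simp add: ac_simps)
  qed simp
  then have "tail (i + j * N) \<xi> = tail i \<xi>" by (metis add.assoc)
  then show ?thesis by (simp add: pt_def)
qed

lemma pt_reach:
  obtains k where "pt j = (g ^^ k) (pt i)"
proof
  \<comment> \<open>Index \<open>j\<close> is advanced by \<open>i\<close> full periods so that it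
    is reached from \<open>i\<close> by a nonnegative number of steps.\<close>
  have "i \<le> i * N" using N_pos by simp
  then have "(j + i * N - i) + i = j + i * N" by linarith
  then show "pt j = (g ^^ (j + i * N - i)) (pt i)" by (metis pt_funpow pt_period)
qed

lemma pt_norm: "norm (pt i) = shadow g P (tail i \<xi>)" and pt_triod: "pt i \<in> triod"
  using shadow_point_sgn(1,3)[OF tight_tail[of i]] by (auto simp: pt_def)

text \<open>A member that is not lowest has a positive shadow, and an orbit that once hits the fixed
  point 0 would stay there.\<close>

lemma pt_nonzero: "pt i \<noteq> 0"
proof
  assume "pt i = 0"
  obtain j u where u: "u \<in> P" "sgn u = sgn (\<xi> j)" "norm u < norm (\<xi> j)"
    using walk by (auto simp: realisable_walk_def)
  have "0 < norm u" using u P_nonzero by auto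
  also have "\<dots> \<le> below P (\<xi> j)" using u by (rule le_below)
  also have "\<dots> \<le> norm (pt j)" using shadow_bounds(1)[OF tight_tail[of j]] by (simp add: pt_norm)
  finally have "pt j \<noteq> 0" by auto
  moreover have "(g ^^ k) 0 = 0" for k
    using triod_mapsD(3)[OF map_in] by (induction k) auto
  ultimately show False using pt_reach \<open>pt i = 0\<close> by metis
qed

lemma pt_sgn: "sgn (pt i) = sgn (\<xi> i)"
  using shadow_point_sgn(2)[OF tight_tail[of i]] pt_nonzero[of i] by (simp add: pt_def)

lemma pt_notin: "pt i \<notin> P"
proof
  assume "pt i \<in> P"
  then have "pt 0 \<in> P" using pt_reach[of 0 i] funpow_in by metis
  moreover have "(g ^^ N) (pt 0) = pt 0" using pt_funpow[of N 0] pt_period[of 0 1] by simp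
  moreover have "sgn ((g ^^ k) (pt 0)) = sgn (\<xi> k)" for k by (simp add: pt_funpow pt_sgn)
  ultimately show False using walk by (auto simp: realisable_walk_def)
qed

lemma pt_less_iff:
  assumes "sgn (\<xi> i) = sgn (\<xi> j)"
  shows "norm (pt i) < norm (pt j) \<longleftrightarrow> walk_less (tail i \<xi>) (tail j \<xi>)"
proof -
  have less: "norm (pt i) < norm (pt j)"
    if "sgn (\<xi> i) = sgn (\<xi> j)" "walk_less (tail i \<xi>) (tail j \<xi>)" for i j
    unfolding pt_norm
  proof (rule shadow_less[OF tight_tail tight_tail _ that(2)])
    fix k show "shadow_point g P (tail k (tail i \<xi>)) \<notin> P"
      using pt_notin[of "k + i"] by (simp add: pt_def add.assoc)
  qed (use that in simp)
  have "tail i \<xi> = tail j \<xi> \<or> walk_less (tail i \<xi>) (tail j \<xi>) \<or> walk_less (tail j \<xi>) (tail i \<xi>)"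
    using walk_less_linear[OF tight_tail tight_tail] assms by simp
  then show ?thesis
    using less[of i j] less[of j i] assms by (auto simp: pt_norm)
qed

lemma pt_eq_iff: "pt i = pt j \<longleftrightarrow> tail i \<xi> = tail j \<xi>"
proof
  assume eq: "pt i = pt j"
  then have s: "sgn (\<xi> i) = sgn (\<xi> j)" using pt_sgn by metis
  then show "tail i \<xi> = tail j \<xi>"
    using walk_less_linear[OF tight_tail[of i] tight_tail[of j]] pt_less_iff[OF s]
      pt_less_iff[OF s[symmetric]] eq by auto
qed (simp add: pt_def)

lemma cycle_pt: "cycle g (range pt)"
proof -
  have "(g ^^ N) (pt 0) = pt 0" using pt_funpow[of N 0] pt_period[of 0 1] by simp
  have "range pt = orbit g (pt 0)"
  proof (intro equalityI subsetI)
    fix y assume "y \<in> range pt"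
    then obtain i where "y = pt (i + 1 * N)" using pt_period[of _ 1] by auto
    then have "y = (g ^^ (i + N)) (pt 0)" by (simp add: pt_funpow)
    then show "y \<in> orbit g (pt 0)" using N_pos unfolding orbit_altdef by blast
  qed (auto simp: orbit_altdef pt_funpow)
  then have "cyclic_on g (range pt)" unfolding cyclic_on_def by blast
  moreover have "range pt \<noteq> {0}" using pt_nonzero by (metis rangeI singletonD)
  ultimately show ?thesis unfolding cycle_def using map_in pt_triod by auto
qed

end

section \<open>Transport of walks to other maps with the same pattern\<close>

lemma order_conj_funpow:
  assumes "order_conj g P h Q \<phi>" "cycle g P" "x \<in> P"
  shows "(h ^^ k) (\<phi> x) = \<phi> ((g ^^ k) x)"
proof -
  interpret triod_cycle g P using assms(2) by unfold_locales
  show ?thesis using order_conjD(3)[OF assms(1) funpow_in[OF assms(3)]] by (induction k) auto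
qed

lemma order_conj_covers:
  assumes "order_conj g P h Q \<phi>" "cycle g P" "x \<in> P" "y \<in> P"
  shows "covers h (\<phi> x) (\<phi> y) \<longleftrightarrow> covers g x y"
proof -
  interpret triod_cycle g P using assms(2) by unfold_locales
  note oc = order_conjD[OF assms(1)]
  have "h (\<phi> x) = \<phi> (g x)" using oc(3)[OF assms(3)] by simp
  then show ?thesis
    using oc(4)[OF assms(4)] oc(4)[OF g_in[OF assms(3)]] oc(5)[OF g_in[OF assms(3)] assms(4)]
    unfolding covers_def by (metis linorder_not_less)
qed

text \<open>All conditions on a realisable walk concern only branches, order and dynamics on
  \<open>P\<close>, and these are what an order conjugacy preserves.\<close>

lemma order_conj_realisable:
  assumes oc: "order_conj g P h Q \<phi>" and c: "cycle g P" and w: "realisable_walk g P N \<xi>"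
  shows "realisable_walk h Q N (\<lambda>i. \<phi> (\<xi> i))"
proof -
  interpret realised_walk g P N \<xi> using c w by unfold_locales
  note D = order_conjD[OF oc]
  note W = tight_walkD[OF tight]
  have surj: "\<exists>x\<in>P. y = \<phi> x" if "y \<in> Q" for y using D(1) that by (auto simp: bij_betw_def)
  have inj: "inj_on \<phi> P" using D(1) by (rule bij_betw_imp_inj_on)
  have "tight_walk h Q (\<lambda>i. \<phi> (\<xi> i))"
    unfolding tight_walk_def
  proof (intro allI conjI ballI impI)
    fix i show "\<phi> (\<xi> i) \<in> Q" using D(2) W(1) by blast
    show "covers h (\<phi> (\<xi> i)) (\<phi> (\<xi> (Suc i)))"
      using order_conj_covers[OF oc c] tight by (auto simp: tight_walk_def)
    fix u assume u: "u \<in> Q" "sgn u = sgn (\<phi> (\<xi> i))" "norm u < norm (\<phi> (\<xi> i))"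
    obtain v where v: "v \<in> P" "u = \<phi> v" using surj u(1) by blast
    then have "\<not> covers g v (\<xi> (Suc i))"
      using W(4)[of v i] u D(4,5) W(1) by metis
    then show "\<not> covers h u (\<phi> (\<xi> (Suc i)))" using order_conj_covers[OF oc c v(1) W(1)] v by simp
  qed
  moreover have "\<exists>i. \<exists>u\<in>Q. sgn u = sgn (\<phi> (\<xi> i)) \<and> norm u < norm (\<phi> (\<xi> i))"
  proof -
    obtain j u where "u \<in> P" "sgn u = sgn (\<xi> j)" "norm u < norm (\<xi> j)"
      using walk by (auto simp: realisable_walk_def)
    then show ?thesis using D(2,4,5) W(1) by metis
  qed
  moreover have "\<not> (\<exists>y\<in>Q. (h ^^ N) y = y \<and> (\<forall>k. sgn ((h ^^ k) y) = sgn (\<phi> (\<xi> k))))"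
  proof
    assume "\<exists>y\<in>Q. (h ^^ N) y = y \<and> (\<forall>k. sgn ((h ^^ k) y) = sgn (\<phi> (\<xi> k)))"
    then obtain y where y: "y \<in> Q" "(h ^^ N) y = y" "\<And>k. sgn ((h ^^ k) y) = sgn (\<phi> (\<xi> k))"
      by blast
    obtain x where x: "x \<in> P" "y = \<phi> x" using surj y(1) by blast
    have "(g ^^ N) x = x"
      using y(2) order_conj_funpow[OF oc c x(1)] inj_onD[OF inj] funpow_in x by metis
    moreover have "sgn ((g ^^ k) x) = sgn (\<xi> k)" for k
      using y(3)[of k] order_conj_funpow[OF oc c x(1)] D(4) W(1) funpow_in x by metis
    ultimately show False using walk x(1) by (auto simp: realisable_walk_def)
  qed
  ultimately show ?thesis unfolding realisable_walk_def using N_pos \<xi>_period by auto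
qed

lemma order_conj_of_sequences:
  fixes y :: "nat \<Rightarrow> complex" and z :: "nat \<Rightarrow> complex"
  assumes "\<And>i j. y i = y j \<longleftrightarrow> z i = z j" "\<And>i. g (y i) = y (Suc i)" "\<And>i. h (z i) = z (Suc i)"
    "\<And>i. sgn (z i) = sgn (y i)"
    "\<And>i j. sgn (y i) = sgn (y j) \<Longrightarrow> norm (y i) < norm (y j) \<Longrightarrow> norm (z i) < norm (z j)"
  shows "\<exists>\<eta>. order_conj g (range y) h (range z) \<eta>"
proof -
  define \<eta> where "\<eta> = (\<lambda>w. z (SOME i. y i = w))"
  have \<eta>: "\<eta> (y i) = z i" for i
  proof -
    have "y (SOME j. y j = y i) = y i" by (rule someI) simp
    then show ?thesis using assms(1) by (simp add: \<eta>_def)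
  qed
  have "inj_on \<eta> (range y)" by (rule inj_onI) (use \<eta> assms(1) in auto)
  moreover have "\<eta> ` range y = range z" using \<eta> by (auto simp: image_iff)
  ultimately have "bij_betw \<eta> (range y) (range z)" by (simp add: bij_betw_def)
  then show ?thesis
    unfolding order_conj_def using \<eta> assms by (intro exI[of _ \<eta>]) auto
qed

lemma order_conj_id: "order_conj g P g P (\<lambda>x. x)"
  by (auto simp: order_conj_def bij_betw_def)

lemma pattern_of_refl: "cycle g P \<Longrightarrow> (g, P) \<in> pattern_of g P"
  using order_conj_imp_cycle_equiv[OF _ _ order_conj_id] by (auto simp: pattern_of_def)

lemma pattern_of_order_conj:
  assumes "cycle g P" "(h, Q) \<in> pattern_of g P"
  obtains \<phi> where "cycle h Q" "order_conj g P h Q \<phi>"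
proof -
  have "cycle h Q" "cycle_equiv g P h Q" using assms(2) by (auto simp: pattern_of_def)
  then show ?thesis using cycle_equiv_imp_order_conj[OF assms(1)] that by metis
qed

context realised_walk
begin

text \<open>A map \<open>h\<close> with a cycle of the pattern has its own shadow of the transported
  walk. Its points coincide and compare as the itineraries do, so it is order conjugate to the
  shadow for \<open>g\<close>.\<close>

lemma forces_pt: "forces (pattern_of g P) (pattern_of g (range pt))"
  unfolding forces_def
proof (intro ballI impI)
  fix h assume "h \<in> triod_maps" "\<exists>Q. (h, Q) \<in> pattern_of g P"
  then obtain Q \<phi> where Q: "cycle h Q" and oc: "order_conj g P h Q \<phi>"
    using pattern_of_order_conj[OF cycle] by metis
  interpret h: realised_walk h Q N "\<lambda>i. \<phi> (\<xi> i)"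
    using Q order_conj_realisable[OF oc cycle walk] by unfold_locales
  note D = order_conjD[OF oc]
  note W = tight_walkD(1)[OF tight]
  have \<phi>_eq: "\<phi> (\<xi> i) = \<phi> (\<xi> j) \<longleftrightarrow> \<xi> i = \<xi> j" for i j
    using inj_on_eq_iff[OF bij_betw_imp_inj_on[OF D(1)] W W] .
  have "\<exists>\<eta>. order_conj g (range pt) h (range h.pt) \<eta>"
  proof (rule order_conj_of_sequences)
    show "pt i = pt j \<longleftrightarrow> h.pt i = h.pt j" for i j
      using \<phi>_eq by (auto simp: pt_eq_iff h.pt_eq_iff fun_eq_iff)
    show s: "sgn (h.pt i) = sgn (pt i)" for i
      by (simp add: h.pt_sgn pt_sgn D(4)[OF W])
    fix i j assume eq: "sgn (pt i) = sgn (pt j)" and "norm (pt i) < norm (pt j)"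
    then have "walk_less (tail i \<xi>) (tail j \<xi>)" using pt_less_iff pt_sgn by metis
    then obtain m where m: "\<forall>l<m. \<xi> (l + i) = \<xi> (l + j)" "norm (\<xi> (m + i)) < norm (\<xi> (m + j))"
      by (auto simp: walk_less_def)
    \<comment> \<open>\<open>\<phi>\<close> respects norms only within a branch. For
      \<open>m > 0\<close> the equal members just before have their images on a common
      branch.\<close>
    have "sgn (\<xi> (m + i)) = sgn (\<xi> (m + j))"
    proof (cases m)
      case 0
      then show ?thesis using eq by (simp add: pt_sgn)
    next
      case (Suc n)
      then show ?thesis using m(1) tight_walkD(2)[OF tight] by (metis add_Suc lessI)
    qed
    then have "norm (\<phi> (\<xi> (m + i))) < norm (\<phi> (\<xi> (m + j)))" using m(2) D(5)[OF W W] by blast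
    then have "walk_less (tail i (\<lambda>i. \<phi> (\<xi> i))) (tail j (\<lambda>i. \<phi> (\<xi> i)))"
      unfolding walk_less_def using m(1) by (intro exI[of _ m]) auto
    then show "norm (h.pt i) < norm (h.pt j)"
      using h.pt_less_iff s eq h.pt_sgn by metis
  qed (auto simp: pt_step h.pt_step)
  then have "cycle_equiv g (range pt) h (range h.pt)"
    using order_conj_imp_cycle_equiv[OF cycle_pt h.cycle_pt] by blast
  then show "\<exists>Q. (h, Q) \<in> pattern_of g (range pt)"
    using h.cycle_pt by (auto simp: pattern_of_def)
qed

text \<open>An order conjugacy would pull the shadow back to a point of \<open>P\<close> that
  returns after \<open>N\<close> steps along the branches of the walk.\<close>

lemma pattern_pt_neq: "pattern_of g (range pt) \<noteq> pattern_of g P"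
proof
  assume "pattern_of g (range pt) = pattern_of g P"
  then have "(g, range pt) \<in> pattern_of g P" using pattern_of_refl[OF cycle_pt] by simp
  then obtain \<phi> where oc: "order_conj g P g (range pt) \<phi>"
    using pattern_of_order_conj[OF cycle] by metis
  note D = order_conjD[OF oc]
  obtain x where x: "x \<in> P" "pt 0 = \<phi> x"
    using D(1) by (metis bij_betw_imp_surj_on imageE rangeI)
  have "(g ^^ N) (\<phi> x) = \<phi> x" using pt_funpow[of N 0] pt_period[of 0 1] x by simp
  then have "(g ^^ N) x = x"
    using order_conj_funpow[OF oc cycle x(1)] inj_onD[OF bij_betw_imp_inj_on[OF D(1)]] funpow_in x
    by metis
  moreover have "sgn ((g ^^ k) x) = sgn (\<xi> k)" for k
    using pt_funpow[of k 0] order_conj_funpow[OF oc cycle x(1)] D(4) funpow_in x pt_sgn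
    by (metis add.right_neutral)
  ultimately show False using walk x(1) by (auto simp: realisable_walk_def)
qed

end

section \<open>Closed walks and their tightening\<close>

definition closed_walk :: "(complex \<Rightarrow> complex) \<Rightarrow> complex set \<Rightarrow> complex list \<Rightarrow> bool" where
  "closed_walk g P xs \<longleftrightarrow> xs \<noteq> [] \<and> set xs \<subseteq> P \<and>
     (\<forall>i<length xs. covers g (xs ! i) (xs ! (Suc i mod length xs)))"

lemma covers_mono: "covers g x y \<Longrightarrow> sgn y' = sgn y \<Longrightarrow> norm y' \<le> norm y \<Longrightarrow> covers g x y'"
  by (auto simp: covers_def)

text \<open>A closed walk with prescribed branches that is as close to the branching point as possible
  is tight.\<close>

lemma (in triod_cycle) closed_walk_tighten:
  assumes "closed_walk g P xs"
  obtains ys where "map sgn ys = map sgn xs" "tight_walk g P (\<lambda>i. ys ! (i mod length ys))"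
proof -
  define S where "S = {ys. set ys \<subseteq> P \<and> length ys = length xs \<and> closed_walk g P ys \<and>
    map sgn ys = map sgn xs}"
  have "finite S"
    unfolding S_def using finite_lists_length_eq[OF finite_P, of "length xs"]
    by (rule rev_finite_subset) auto
  moreover have "xs \<in> S" using assms by (auto simp: S_def closed_walk_def)
  ultimately obtain ys where ys: "ys \<in> S"
    and least: "\<And>zs. zs \<in> S \<Longrightarrow> \<not> (\<Sum>i<length xs. norm (zs ! i)) < (\<Sum>i<length xs. norm (ys ! i))"
    using arg_min_if_finite[of S "\<lambda>ys. \<Sum>i<length xs. norm (ys ! i)"] by blast
  define N where "N = length ys"
  have len: "length xs = N" and Y: "set ys \<subseteq> P" "N > 0" "map sgn ys = map sgn xs"
    "\<And>i. i < N \<Longrightarrow> covers g (ys ! i) (ys ! (Suc i mod N))"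
    using ys by (auto simp: S_def closed_walk_def N_def)
  have "\<not> covers g u (ys ! (Suc j mod N))"
    if u: "u \<in> P" "sgn u = sgn (ys ! j)" "norm u < norm (ys ! j)" and j: "j < N" for u j
  proof
    assume c: "covers g u (ys ! (Suc j mod N))"
    \<comment> \<open>Lowering entry \<open>j\<close> keeps the step into it by
      \<open>covers_mono\<close> and the step out of it by \<open>c\<close>, so the minimality of
      the sum of norms is contradicted.\<close>
    define zs where "zs = ys[j := u]"
    have z: "sgn (zs ! k) = sgn (ys ! k)" "norm (zs ! k) \<le> norm (ys ! k)" if "k < N" for k
      using u that j by (auto simp: zs_def nth_list_update N_def)
    have "covers g (zs ! k) (zs ! (Suc k mod N))" if "k < N" for k
    proof -
      have "covers g (zs ! k) (ys ! (Suc k mod N))"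
        using Y(4)[OF that] c j by (cases "k = j") (auto simp: zs_def N_def)
      then show ?thesis using z[of "Suc k mod N"] Y(2) by (auto intro: covers_mono)
    qed
    moreover have "map sgn zs = map sgn xs"
      using Y(3) z(1) len by (auto simp: list_eq_iff_nth_eq zs_def N_def)
    moreover have "set zs \<subseteq> P" using Y(1) u(1) set_update_subset_insert[of ys j u] by (auto simp: zs_def)
    ultimately have "zs \<in> S"
      using Y(2) len by (auto simp: S_def closed_walk_def zs_def N_def)
    moreover have "(\<Sum>i<length xs. norm (zs ! i)) < (\<Sum>i<length xs. norm (ys ! i))"
      using z j u(3) len by (intro sum_strict_mono_ex1) (auto simp: zs_def N_def intro!: bexI[of _ j])
    ultimately show False using least by blast
  qed
  then have "ys ! (i mod N) \<in> P \<and> covers g (ys ! (i mod N)) (ys ! (Suc i mod N)) \<and>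
      (\<forall>u\<in>P. sgn u = sgn (ys ! (i mod N)) \<longrightarrow> norm u < norm (ys ! (i mod N)) \<longrightarrow>
        \<not> covers g u (ys ! (Suc i mod N)))" for i
    using Y(1,2) Y(4)[of "i mod N"] mod_less_divisor[OF Y(2), of i] nth_mem[of "i mod N" ys]
    by (metis N_def mod_Suc_eq subsetD)
  then have "tight_walk g P (\<lambda>i. ys ! (i mod N))" by (simp add: tight_walk_def)
  then show ?thesis unfolding N_def by (rule that[OF Y(3)])
qed


section \<open>Displacements and rotation numbers\<close>

lemma mod_3_arith:
  fixes i j k :: nat
  assumes "i < 3" "j < 3"
  shows "(i + (j + 3 - i) mod 3) mod 3 = j" "((i + j) mod 3 + 3 - i) mod 3 = j"
    "i \<noteq> j \<Longrightarrow> (j + 3 - i) mod 3 + (i + 3 - j) mod 3 = 3"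
    "real ((j + 3 - i) mod 3) = real j - real i \<or> real ((j + 3 - i) mod 3) = real j - real i + 3"
proof -
  have "i = 0 \<or> i = 1 \<or> i = 2" "j = 0 \<or> j = 1 \<or> j = 2" using assms by auto
  then show "(i + (j + 3 - i) mod 3) mod 3 = j" "((i + j) mod 3 + 3 - i) mod 3 = j"
    "i \<noteq> j \<Longrightarrow> (j + 3 - i) mod 3 + (i + 3 - j) mod 3 = 3"
    "real ((j + 3 - i) mod 3) = real j - real i \<or> real ((j + 3 - i) mod 3) = real j - real i + 3"
    by (elim disjE; simp)+
qed

definition branch_idx :: "(nat \<Rightarrow> complex set) \<Rightarrow> complex \<Rightarrow> nat" where
  "branch_idx b x = (THE i. i < 3 \<and> x \<in> b i)"

context
  fixes b :: "nat \<Rightarrow> complex set"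
  assumes b: "branch_numbering b"
begin

lemma numbered_branchE:
  assumes "i < 3"
  obtains e where "e ^ 3 = 1" "b i = {z \<in> triod. z \<noteq> 0 \<and> sgn z = e}"
proof -
  have "b i \<in> triod_branches" using b assms by (auto simp: branch_numbering_def bij_betw_def)
  then show ?thesis using that unfolding triod_branches_eq by auto
qed

lemma numbered_branch_sgn: "i < 3 \<Longrightarrow> x \<in> b i \<Longrightarrow> y \<in> b i \<longleftrightarrow> y \<in> triod \<and> y \<noteq> 0 \<and> sgn y = sgn x"
  by (erule numbered_branchE) simp

lemma numbered_branch_unique:
  assumes "i < 3" "j < 3" "x \<in> b i" "x \<in> b j"
  shows "i = j"
proof -
  have "b i = b j"
    using numbered_branch_sgn[OF assms(1,3)] numbered_branch_sgn[OF assms(2,4)] by blast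
  moreover have "inj_on b {..<3}" using b by (auto simp: branch_numbering_def bij_betw_def)
  ultimately show ?thesis using assms by (auto dest: inj_onD)
qed

lemma branch_idx_eqI: "i < 3 \<Longrightarrow> x \<in> b i \<Longrightarrow> branch_idx b x = i"
  unfolding branch_idx_def using numbered_branch_unique by blast

lemma branch_idx:
  assumes "x \<in> triod" "x \<noteq> 0"
  shows "branch_idx b x < 3" "x \<in> b (branch_idx b x)"
proof -
  have "{z \<in> triod. z \<noteq> 0 \<and> sgn z = sgn x} \<in> triod_branches"
    unfolding triod_branches_eq using triod_sgn[OF assms] by blast
  moreover have "b ` {..<3} = triod_branches"
    using b by (simp add: branch_numbering_def bij_betw_def)
  ultimately have "{z \<in> triod. z \<noteq> 0 \<and> sgn z = sgn x} \<in> b ` {..<3}" by simp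
  then obtain i where i: "i \<in> {..<3}" "{z \<in> triod. z \<noteq> 0 \<and> sgn z = sgn x} = b i" by blast
  then have "i < 3" "x \<in> b i" using assms by auto
  then show "branch_idx b x < 3" "x \<in> b (branch_idx b x)" using branch_idx_eqI by auto
qed

lemma branch_idx_eq_iff:
  assumes "x \<in> triod" "x \<noteq> 0" "y \<in> triod" "y \<noteq> 0"
  shows "branch_idx b x = branch_idx b y \<longleftrightarrow> sgn x = sgn y"
  using branch_idx[OF assms(1,2)] branch_idx[OF assms(3,4)] numbered_branch_sgn assms branch_idx_eqI
  by metis

lemma branch_disp_eq:
  assumes "x \<in> triod" "x \<noteq> 0" "y \<in> triod" "y \<noteq> 0"
  shows "branch_disp b x y = real ((branch_idx b y + 3 - branch_idx b x) mod 3) / 3"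
  unfolding branch_disp_def
proof (rule the_equality)
  note x = branch_idx[OF assms(1,2)] and y = branch_idx[OF assms(3,4)]
  have "(branch_idx b x + (branch_idx b y + 3 - branch_idx b x) mod 3) mod 3 = branch_idx b y"
    using mod_3_arith(1)[OF x(1) y(1)] .
  then show "\<exists>i<3. \<exists>k<3. x \<in> b i \<and> y \<in> b ((i + k) mod 3) \<and>
      real ((branch_idx b y + 3 - branch_idx b x) mod 3) / 3 = real k / 3"
    using x y by (intro exI[of _ "branch_idx b x"] conjI
        exI[of _ "(branch_idx b y + 3 - branch_idx b x) mod 3"]) auto
  fix r assume "\<exists>i<3. \<exists>k<3. x \<in> b i \<and> y \<in> b ((i + k) mod 3) \<and> r = real k / 3"
  then obtain i k where ik: "i < 3" "k < 3" "x \<in> b i" "y \<in> b ((i + k) mod 3)" "r = real k / 3"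
    by blast
  have "branch_idx b x = i" "branch_idx b y = (i + k) mod 3"
    using ik by (auto intro: branch_idx_eqI)
  moreover have "k = ((i + k) mod 3 + 3 - i) mod 3" using mod_3_arith(2)[OF ik(1,2)] by simp
  ultimately show "r = real ((branch_idx b y + 3 - branch_idx b x) mod 3) / 3" using ik(5) by simp
qed

lemma branch_disp_cong:
  assumes "x \<in> triod" "x \<noteq> 0" "y \<in> triod" "y \<noteq> 0"
    and "x' \<in> triod" "x' \<noteq> 0" "y' \<in> triod" "y' \<noteq> 0"
    and "sgn x = sgn x'" "sgn y = sgn y'"
  shows "branch_disp b x y = branch_disp b x' y'"
proof -
  have "branch_idx b x = branch_idx b x'" "branch_idx b y = branch_idx b y'"
    using assms branch_idx_eq_iff by blast+
  then show ?thesis using assms by (simp add: branch_disp_eq)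
qed

text \<open>Modulo 1, sums of displacements along a path thus depend on its end points only.\<close>

lemma branch_disp_mod:
  assumes "x \<in> triod" "x \<noteq> 0" "y \<in> triod" "y \<noteq> 0"
  shows "branch_disp b x y - (real (branch_idx b y) - real (branch_idx b x)) / 3 \<in> \<int>"
proof -
  define i j k where "i = branch_idx b x" and "j = branch_idx b y" and "k = (j + 3 - i) mod 3"
  have "i < 3" "j < 3" using branch_idx assms by (auto simp: i_def j_def)
  then have "real k = real j - real i \<or> real k = real j - real i + 3"
    unfolding k_def by (rule mod_3_arith(4))
  then have "real k / 3 - (real j - real i) / 3 = 0 \<or> real k / 3 - (real j - real i) / 3 = 1"
    by (auto simp: field_simps)
  then have "real k / 3 - (real j - real i) / 3 \<in> \<int>" by (metis Ints_0 Ints_1)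
  then show ?thesis unfolding branch_disp_eq[OF assms] i_def j_def k_def .
qed

lemma rotation_number_order_conj:
  assumes "order_conj g P h Q \<phi>" "cycle g P" "cycle h Q"
  shows "rotation_number b h Q = rotation_number b g P"
proof -
  interpret P: triod_cycle g P using assms by unfold_locales
  interpret Q: triod_cycle h Q using assms by unfold_locales
  note D = order_conjD[OF assms(1)]
  have "branch_disp b (\<phi> x) (h (\<phi> x)) = branch_disp b x (g x)" if x: "x \<in> P" for x
  proof (rule branch_disp_cong)
    show "sgn (\<phi> x) = sgn x" "sgn (h (\<phi> x)) = sgn (g x)"
      using D(3,4)[OF x] D(4)[OF P.g_in[OF x]] by simp_all
  qed (use x D(2) P.g_in Q.g_in P.P_triod Q.P_triod P.P_nonzero Q.P_nonzero in blast)+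
  then have "(\<Sum>x\<in>P. branch_disp b x (g x)) = (\<Sum>x\<in>Q. branch_disp b x (h x))"
    using sum.reindex_bij_betw[OF D(1), of "\<lambda>x. branch_disp b x (h x)"] by simp
  then show ?thesis
    using bij_betw_same_card[OF D(1)] by (simp add: rotation_number_def rotation_pair_def)
qed

lemma pattern_rotation_number_eq:
  assumes "cycle g P"
  shows "pattern_rotation_number b (pattern_of g P) = rotation_number b g P"
  unfolding pattern_rotation_number_def
proof (rule the_equality)
  show "\<exists>(f, Q)\<in>pattern_of g P. rotation_number b f Q = rotation_number b g P"
    using pattern_of_refl[OF assms] by (intro bexI[of _ "(g, P)"]) auto
  fix r assume "\<exists>(f, Q)\<in>pattern_of g P. rotation_number b f Q = r"
  then obtain f Q where Q: "(f, Q) \<in> pattern_of g P" "rotation_number b f Q = r" by auto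
  obtain \<phi> where "cycle f Q" "order_conj g P f Q \<phi>"
    using pattern_of_order_conj[OF assms Q(1)] by metis
  then show "r = rotation_number b g P" using rotation_number_order_conj assms Q(2) by metis
qed

end

section \<open>Canonically numbered cycles\<close>

locale numbered_cycle = triod_cycle +
  fixes b :: "nat \<Rightarrow> complex set"
  assumes canonical: "canonical_numbering b g P"
begin

abbreviation idx :: "complex \<Rightarrow> nat" where "idx \<equiv> branch_idx b"

definition d :: "complex \<Rightarrow> real" where "d x = branch_disp b x (g x)"

definition \<rho> :: real where "\<rho> = rotation_number b g P"

lemma numbering: "branch_numbering b"
  using canonical by (simp add: canonical_numbering_def)

lemma idx_less: "x \<in> P \<Longrightarrow> idx x < 3"
  using branch_idx(1)[OF numbering] P_triod P_nonzero by blast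

lemma idx_eq_iff: "x \<in> P \<Longrightarrow> y \<in> P \<Longrightarrow> idx x = idx y \<longleftrightarrow> sgn x = sgn y"
  using branch_idx_eq_iff[OF numbering] P_triod P_nonzero by blast

lemma d_eq: "x \<in> P \<Longrightarrow> d x = real ((idx (g x) + 3 - idx x) mod 3) / 3"
  unfolding d_def using branch_disp_eq[OF numbering] P_triod P_nonzero g_in by blast

lemma idx_g:
  assumes "x \<in> P"
  obtains k where "k < 3" "d x = real k / 3" "idx (g x) = (idx x + k) mod 3"
proof
  show "(idx (g x) + 3 - idx x) mod 3 < 3" by simp
  show "idx (g x) = (idx x + (idx (g x) + 3 - idx x) mod 3) mod 3"
    using mod_3_arith(1)[OF idx_less[OF assms] idx_less[OF g_in[OF assms]]] by simp
qed (rule d_eq[OF assms])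

lemma d_cases: "x \<in> P \<Longrightarrow> d x = 0 \<or> d x = 1 / 3 \<or> d x = 2 / 3"
  using idx_g[of x] by (metis One_nat_def Suc_1 less_Suc_eq not_less0 numeral_3_eq_3 of_nat_0
      of_nat_1 of_nat_numeral div_0)

lemma black_idx: "x \<in> P \<Longrightarrow> d x = 1 / 3 \<Longrightarrow> idx (g x) = (idx x + 1) mod 3"
  and red_idx: "x \<in> P \<Longrightarrow> d x = 2 / 3 \<Longrightarrow> idx (g x) = (idx x + 2) mod 3"
  and green_idx: "x \<in> P \<Longrightarrow> d x = 0 \<Longrightarrow> idx (g x) = idx x"
  using idx_less[of x] by - (rule idx_g[of x], auto)+

lemma green_inward: "x \<in> P \<Longrightarrow> d x = 0 \<Longrightarrow> sgn (g x) = sgn x \<and> norm (g x) < norm x"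
  using same_branch_moves_inward[OF map_in] green_idx idx_eq_iff g_in P_triod P_nonzero by metis

lemma sum_d: "sum d P = real (card P) * \<rho>"
  using card_pos by (simp add: \<rho>_def rotation_number_def rotation_pair_def d_def)

lemma \<rho>_nonneg: "\<rho> \<ge> 0"
proof -
  have "sum d P \<ge> 0" by (rule sum_nonneg) (use d_cases in fastforce)
  then show ?thesis using card_pos by (simp add: sum_d zero_le_mult_iff)
qed

lemma lowest_black:
  assumes "x \<in> P" "\<And>u. u \<in> P \<Longrightarrow> sgn u = sgn x \<Longrightarrow> norm x \<le> norm u"
  shows "d x = 1 / 3"
proof -
  have ix: "idx x < 3" "x \<in> b (idx x)" using branch_idx[OF numbering] assms P_triod P_nonzero by auto
  then obtain y where y: "y \<in> P" "y \<in> b (idx x)" "\<And>z. z \<in> P \<Longrightarrow> z \<in> b (idx x) \<Longrightarrow> norm y \<le> norm z"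
    "black b g y" using canonical unfolding canonical_numbering_def by blast
  have s: "sgn y = sgn x" using numbered_branch_sgn[OF numbering ix] y by blast
  moreover have "norm y = norm x" using y(3)[OF assms(1) ix(2)] assms(2)[OF y(1) s] by simp
  ultimately have "y = x" by (rule complex_polar_eqI)
  then show ?thesis using y(4) by (simp add: black_def d_def)
qed

lemma ex_lowest:
  assumes "i < 3"
  obtains x where "x \<in> P" "idx x = i" "\<And>u. u \<in> P \<Longrightarrow> sgn u = sgn x \<Longrightarrow> norm x \<le> norm u"
proof -
  obtain x where x: "x \<in> P" "x \<in> b i" "\<And>y. y \<in> P \<Longrightarrow> y \<in> b i \<Longrightarrow> norm x \<le> norm y"
    using canonical assms unfolding canonical_numbering_def by blast
  show ?thesis
  proof (rule that[OF x(1)])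
    show "idx x = i" using branch_idx_eqI[OF numbering assms x(2)] .
    fix u assume "u \<in> P" "sgn u = sgn x"
    then show "norm x \<le> norm u"
      using x(3) numbered_branch_sgn[OF numbering assms x(2)] P_triod P_nonzero by blast
  qed
qed

lemma card_ge_3: "card P \<ge> 3"
proof -
  have "{..<3} \<subseteq> idx ` P" using ex_lowest by (metis image_eqI lessThan_iff subsetI)
  then show ?thesis using surj_card_le[OF finite_P, of "{..<3}" idx] by simp
qed

lemma disp_walk:
  assumes "x \<in> P" "y \<in> P" "sgn y = sgn (g x)" "x' \<in> triod" "x' \<noteq> 0" "y' \<in> triod" "y' \<noteq> 0"
    "sgn x' = sgn x" "sgn y' = sgn y"
  shows "branch_disp b x' y' = d x"
  unfolding d_def using assms P_triod P_nonzero g_in by (intro branch_disp_cong[OF numbering]) auto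

text \<open>Tightening keeps the branches and hence the displacements. A walk through lowest points
  only would be entirely black, of mean displacement 1/3, which \<open>nb\<close> rules out.\<close>

lemma closed_walk_realisable:
  assumes xs: "closed_walk g P xs" and N: "N = length xs"
    and nb: "(\<Sum>i<N. d (xs ! i)) \<noteq> real N / 3"
    and np: "\<not> (\<exists>x\<in>P. (g ^^ N) x = x \<and> (\<forall>k. sgn ((g ^^ k) x) = sgn (xs ! (k mod N))))"
  obtains \<xi> where "realisable_walk g P N \<xi>" "\<And>k. sgn (\<xi> k) = sgn (xs ! (k mod N))"
    "\<And>k. d (\<xi> k) = d (xs ! (k mod N))"
proof -
  obtain ys where ys: "map sgn ys = map sgn xs" "tight_walk g P (\<lambda>i. ys ! (i mod length ys))"
    using closed_walk_tighten[OF xs] .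
  have len: "length ys = N" using ys(1) N map_eq_imp_length_eq by blast
  have Npos: "N > 0" using xs N by (auto simp: closed_walk_def)
  define \<xi> where "\<xi> = (\<lambda>i. ys ! (i mod N))"
  have tw: "tight_walk g P \<xi>" using ys(2) len by (simp add: \<xi>_def)
  note W = tight_walkD[OF tw]
  have s: "sgn (\<xi> k) = sgn (xs ! (k mod N))" for k
    using ys(1) N len Npos by (metis \<xi>_def mod_less_divisor nth_map)
  have xsP: "xs ! (k mod N) \<in> P" for k using xs N Npos by (auto simp: closed_walk_def)
  have d: "d (\<xi> k) = d (xs ! (k mod N))" for k
  proof -
    have "k mod N < length xs" using N Npos by simp
    then have "covers g (xs ! (k mod N)) (xs ! (Suc (k mod N) mod N))"
      using xs N unfolding closed_walk_def by blast
    then have "sgn (xs ! (Suc k mod N)) = sgn (g (xs ! (k mod N)))"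
      by (simp add: covers_def mod_Suc_eq)
    then have "branch_disp b (\<xi> k) (\<xi> (Suc k)) = d (xs ! (k mod N))"
      using xsP W(1) P_triod P_nonzero s by (intro disp_walk[of _ "xs ! (Suc k mod N)"]) auto
    moreover have "branch_disp b (\<xi> k) (\<xi> (Suc k)) = d (\<xi> k)"
      using W(1,2) P_triod P_nonzero by (intro disp_walk[of _ "\<xi> (Suc k)"]) auto
    ultimately show ?thesis by simp
  qed
  have "\<exists>i. \<exists>u\<in>P. sgn u = sgn (\<xi> i) \<and> norm u < norm (\<xi> i)"
  proof (rule ccontr)
    assume "\<not> ?thesis"
    then have "d (\<xi> i) = 1 / 3" for i using lowest_black[OF W(1)] by (meson not_le)
    then have "(\<Sum>i<N. d (xs ! i)) = (\<Sum>i<N. 1 / 3)"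
      using d by (intro sum.cong) (auto, metis mod_less)
    then show False using nb by simp
  qed
  moreover have "\<xi> (i + N) = \<xi> i" for i by (simp add: \<xi>_def)
  ultimately have "realisable_walk g P N \<xi>"
    unfolding realisable_walk_def using tw Npos np s by simp
  then show ?thesis using that s d by blast
qed

text \<open>The pair is a closed walk of length two on two branches; \<open>P\<close>, having at
  least three points, cannot follow it, so a primitive pattern of period 2 would be forced, against
  regularity.\<close>

lemma no_returning_pair:
  assumes "regular_pattern (pattern_of g P)" "v \<in> P" "w \<in> P" "sgn v \<noteq> sgn w"
    "covers g v w" "covers g w v"
  shows False
proof -
  have cw: "closed_walk g P [v, w]"
    using assms by (auto simp: closed_walk_def less_Suc_eq numeral_2_eq_2)
  have idx: "idx (g v) = idx w" "idx (g w) = idx v" "idx v \<noteq> idx w" "idx v < 3" "idx w < 3"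
    using assms idx_eq_iff g_in idx_less by (auto simp: covers_def)
  \<comment> \<open>Going to another branch and back makes one full turn: the sum is 1.\<close>
  have "d v + d w \<noteq> 2 / 3"
  proof -
    have "(idx w + 3 - idx v) mod 3 + (idx v + 3 - idx w) mod 3 = 3" using mod_3_arith(3)[OF idx(4,5,3)] .
    then have "real ((idx w + 3 - idx v) mod 3) + real ((idx v + 3 - idx w) mod 3) = 3"
      by (metis of_nat_add of_nat_numeral)
    then show ?thesis using d_eq[OF assms(2)] d_eq[OF assms(3)] idx(1,2) by simp
  qed
  then have nb: "(\<Sum>i<2. d ([v, w] ! i)) \<noteq> real 2 / 3" by (simp add: numeral_2_eq_2)
  have np: "\<not> (\<exists>x\<in>P. (g ^^ 2) x = x \<and> (\<forall>k. sgn ((g ^^ k) x) = sgn ([v, w] ! (k mod 2))))"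
    using funpow_neq[of _ 2] card_ge_3 by auto
  have "2 = length [v, w]" by simp
  from closed_walk_realisable[OF cw this nb np] obtain \<xi> where \<xi>: "realisable_walk g P 2 \<xi>"
    "\<And>k. sgn (\<xi> k) = sgn ([v, w] ! (k mod 2))" by metis
  interpret R: realised_walk g P 2 \<xi> using \<xi>(1) by unfold_locales
  have range: "range R.pt = {R.pt 0, R.pt 1}"
  proof -
    have "R.pt i \<in> {R.pt 0, R.pt 1}" for i
      using R.pt_period[of "i mod 2" "i div 2"] by (cases "even i") (auto simp: even_iff_mod_2_eq_zero
          odd_iff_mod_2_eq_one simp flip: One_nat_def)
    then show ?thesis by blast
  qed
  have ns: "sgn (R.pt 0) \<noteq> sgn (R.pt 1)" using \<xi>(2)[of 0] \<xi>(2)[of 1] assms(4) by (simp add: R.pt_sgn)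
  have all: "primitive_cycle Q \<and> card Q = 2" if hQ: "(h, Q) \<in> pattern_of g (range R.pt)" for h Q
  proof -
    obtain \<phi> where "order_conj g (range R.pt) h Q \<phi>"
      using pattern_of_order_conj[OF R.cycle_pt hQ] by metis
    note D = order_conjD[OF this]
    have "Q = {\<phi> (R.pt 0), \<phi> (R.pt 1)}"
      using bij_betw_imp_surj_on[OF D(1)] range by auto
    moreover have "sgn (\<phi> (R.pt 0)) \<noteq> sgn (\<phi> (R.pt 1))" using D(4) ns by simp
    moreover from this have "\<phi> (R.pt 0) \<noteq> \<phi> (R.pt 1)" by metis
    ultimately show ?thesis by (auto simp: primitive_cycle_def same_branch_iff)
  qed
  define B where "B = pattern_of g (range R.pt)"
  have "B \<in> patterns" using R.cycle_pt by (auto simp: B_def patterns_def)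
  then have "primitive_pattern B" "pattern_has_period B 2"
    using all by (auto simp: primitive_pattern_def pattern_has_period_def B_def)
  then show False using assms(1) R.forces_pt by (auto simp: regular_pattern_def B_def)
qed

end

locale twist_cycle = numbered_cycle +
  assumes twist: "triod_twist b (pattern_of g P)"
begin

lemma no_other_forced:
  assumes "cycle g Q" "pattern_of g Q \<noteq> pattern_of g P" "forces (pattern_of g P) (pattern_of g Q)"
  shows "rotation_number b g Q \<noteq> \<rho>"
proof -
  have "pattern_of g Q \<in> patterns" using assms(1) by (auto simp: patterns_def)
  then show ?thesis
    using twist assms(2,3) pattern_rotation_number_eq[OF numbering cycle]
      pattern_rotation_number_eq[OF numbering assms(1)]
    unfolding triod_twist_def \<rho>_def by metis
qed

text \<open>Closed walks with the rotation number of \<open>P\<close> would force further patterns, unless the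
  cycle itself follows the same branches.\<close>

lemma closed_walk_tracked:
  assumes "\<rho> \<noteq> 1 / 3" "closed_walk g P xs" "N = length xs" "(\<Sum>i<N. d (xs ! i)) = real N * \<rho>"
  shows "\<exists>x\<in>P. (g ^^ N) x = x \<and> (\<forall>k. sgn ((g ^^ k) x) = sgn (xs ! (k mod N)))"
proof (rule ccontr)
  assume np: "\<not> ?thesis"
  have N: "N > 0" using assms by (auto simp: closed_walk_def)
  have nb: "(\<Sum>i<N. d (xs ! i)) \<noteq> real N / 3" using assms(1,4) N by simp
  obtain \<xi> where \<xi>: "realisable_walk g P N \<xi>" "\<And>k. d (\<xi> k) = d (xs ! (k mod N))"
    using closed_walk_realisable[OF assms(2,3) nb np] by metis
  interpret R: realised_walk g P N \<xi> using \<xi>(1) by unfold_locales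
  interpret Q: triod_cycle g "range R.pt" using R.cycle_pt by unfold_locales
  note W = tight_walkD[OF R.tight]
  define F where "F = (\<lambda>x. branch_disp b x (g x))"
  have "F ((g ^^ k) (R.pt 0)) = d (xs ! k)" if "k < N" for k
  proof -
    have "F ((g ^^ k) (R.pt 0)) = branch_disp b (R.pt k) (R.pt (Suc k))"
      by (simp add: F_def R.pt_funpow R.pt_step)
    also have "\<dots> = d (\<xi> k)"
      using W(1,2) R.pt_triod R.pt_nonzero R.pt_sgn by (intro disp_walk[of _ "\<xi> (Suc k)"]) auto
    finally show ?thesis using \<xi>(2)[of k] that by simp
  qed
  then have "(\<Sum>k<N. F ((g ^^ k) (R.pt 0))) = real N * \<rho>" using assms(4) by simp
  moreover have "(g ^^ N) (R.pt 0) = R.pt 0" using R.pt_funpow[of N 0] R.pt_period[of 0 1] by simp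
  \<comment> \<open>The shadow may close up before \<open>N\<close> steps, so the mean is compared
    through \<open>sum_period\<close>.\<close>
  ultimately have "real (card (range R.pt)) * (real N * \<rho>) = real N * sum F (range R.pt)"
    using Q.sum_period[of "R.pt 0" N F] by simp
  then have "sum F (range R.pt) = real (card (range R.pt)) * \<rho>" using N by simp
  then have "rotation_number b g (range R.pt) = \<rho>"
    using Q.card_pos by (simp add: rotation_number_def rotation_pair_def F_def)
  then show False using no_other_forced[OF R.cycle_pt R.pattern_pt_neq R.forces_pt] by simp
qed

end


section \<open>Loops and the deviation from the mean displacement\<close>

context numbered_cycle
begin

definition \<delta> :: "complex \<Rightarrow> real" where "\<delta> x = d x - \<rho>"

text \<open>The potential of \<open>\<delta>\<close> along the cycle; averaging over the end point of the partial sums avoids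
  the choice of a base point.\<close>

definition lam :: "complex \<Rightarrow> real" where
  "lam x = - (\<Sum>j<card P. \<Sum>i<j. \<delta> ((g ^^ i) x)) / real (card P)"

text \<open>Shifting the base point subtracts \<open>\<delta> x\<close> from every partial sum and
  adds the next term; over a full period these terms sum to 0.\<close>

lemma lam_step:
  assumes "x \<in> P"
  shows "lam (g x) = lam x + \<delta> x"
proof -
  define n where "n = card P"
  have n: "real n > 0" using card_pos by (simp add: n_def)
  have "(\<Sum>i<j. \<delta> ((g ^^ i) (g x))) = (\<Sum>i<j. \<delta> ((g ^^ i) x)) + (\<delta> ((g ^^ j) x) - \<delta> x)" for j
    by (induction j) (auto simp: funpow_swap1)
  then have "(\<Sum>j<n. \<Sum>i<j. \<delta> ((g ^^ i) (g x))) =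
      (\<Sum>j<n. \<Sum>i<j. \<delta> ((g ^^ i) x)) + ((\<Sum>j<n. \<delta> ((g ^^ j) x)) - real n * \<delta> x)"
    by (simp add: sum.distrib sum_subtractf)
  also have "(\<Sum>j<n. \<delta> ((g ^^ j) x)) = 0"
    unfolding n_def sum_orbit[OF assms] by (simp add: \<delta>_def sum_subtractf sum_d)
  finally show ?thesis using n by (simp add: lam_def n_def field_simps)
qed

lemma lam_funpow: "x \<in> P \<Longrightarrow> lam ((g ^^ k) x) = lam x + (\<Sum>i<k. \<delta> ((g ^^ i) x))"
  by (induction k) (auto simp: lam_step funpow_in)

text \<open>Unlike a \<open>closed_walk\<close>, a loop has a base point, so that loops at the same
  point can be concatenated; the appended \<open>p\<close> records the closing step.\<close>

definition loop_at :: "complex \<Rightarrow> complex list \<Rightarrow> bool" where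
  "loop_at p xs \<longleftrightarrow> xs \<noteq> [] \<and> hd xs = p \<and> set xs \<subseteq> P \<and> successively (covers g) (xs @ [p])"

definition wt :: "complex list \<Rightarrow> real" where "wt xs = sum_list (map \<delta> xs)"

lemma wt_append [simp]: "wt (xs @ ys) = wt xs + wt ys"
  by (simp add: wt_def)

lemma wt_nth: "wt xs = (\<Sum>i<length xs. \<delta> (xs ! i))"
  by (simp add: wt_def sum_list_sum_nth atLeast0LessThan)

lemma loop_at_append: "loop_at p xs \<Longrightarrow> loop_at p ys \<Longrightarrow> loop_at p (xs @ ys)"
  by (auto simp: loop_at_def successively_append_iff)

lemma loop_at_closed_walk:
  assumes "loop_at p xs"
  shows "closed_walk g P xs"
  unfolding closed_walk_def
proof (intro conjI allI impI)
  show "xs \<noteq> []" "set xs \<subseteq> P" using assms by (auto simp: loop_at_def)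
  fix i assume i: "i < length xs"
  have "covers g ((xs @ [p]) ! i) ((xs @ [p]) ! Suc i)"
    using assms i by (auto simp: loop_at_def successively_conv_nth)
  moreover have "(xs @ [p]) ! Suc i = xs ! (Suc i mod length xs)"
  proof (cases "Suc i = length xs")
    case True
    then show ?thesis using assms by (auto simp: loop_at_def hd_conv_nth nth_append)
  next
    case False
    then show ?thesis using i by (simp add: nth_append)
  qed
  ultimately show "covers g (xs ! i) (xs ! (Suc i mod length xs))" using i by (simp add: nth_append)
qed

lemma loop_at_repeat:
  assumes "loop_at p xs" "K > 0"
  shows "loop_at p (concat (replicate K xs))" "wt (concat (replicate K xs)) = real K * wt xs"
proof -
  have "loop_at p (concat (replicate (Suc k) xs)) \<and>
      wt (concat (replicate (Suc k) xs)) = real (Suc k) * wt xs" for k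
  proof (induction k)
    case (Suc k)
    have "concat (replicate (Suc (Suc k)) xs) = xs @ concat (replicate (Suc k) xs)" by simp
    then show ?case using Suc loop_at_append[OF assms(1), of "concat (replicate (Suc k) xs)"]
      by (simp add: algebra_simps)
  qed (simp add: assms)
  then show "loop_at p (concat (replicate K xs))" "wt (concat (replicate K xs)) = real K * wt xs"
    using assms(2) by (metis Suc_pred)+
qed

text \<open>\<open>\<rho>\<close> is a sum of thirds divided by \<open>card P\<close>, so all
  deviations are commensurable. This permits loops of opposite sign to be repeated until their
  weights cancel exactly.\<close>

lemma \<delta>_integral:
  assumes "x \<in> P"
  shows "3 * real (card P) * \<delta> x \<in> \<int>"
proof -
  have d: "3 * d y \<in> \<int>" if "y \<in> P" for y
    using idx_g[OF that] by (metis Ints_of_nat nonzero_mult_div_cancel_left times_divide_eq_right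
        zero_neq_numeral)
  have "3 * real (card P) * \<delta> x = real (card P) * (3 * d x) - (\<Sum>y\<in>P. 3 * d y)"
    by (simp add: \<delta>_def sum_d algebra_simps flip: sum_distrib_left)
  moreover have "real (card P) * (3 * d x) \<in> \<int>" by (rule Ints_mult[OF Ints_of_nat d[OF assms]])
  moreover have "(\<Sum>y\<in>P. 3 * d y) \<in> \<int>" using d by (rule Ints_sum)
  ultimately show ?thesis by simp
qed

lemma wt_integral: "set xs \<subseteq> P \<Longrightarrow> 3 * real (card P) * wt xs \<in> \<int>"
proof (induction xs)
  case (Cons x xs)
  then have "3 * real (card P) * \<delta> x + 3 * real (card P) * wt xs \<in> \<int>"
    using \<delta>_integral by (intro Ints_add) auto
  then show ?case by (simp add: wt_def distrib_left)
qed (simp add: wt_def)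

lemma tracked_d:
  assumes "closed_walk g P xs" "N = length xs" "x \<in> P"
    and "\<And>k. sgn ((g ^^ k) x) = sgn (xs ! (k mod N))"
  shows "d ((g ^^ k) x) = d (xs ! (k mod N))"
proof -
  have N: "N > 0" using assms(1,2) by (auto simp: closed_walk_def)
  have xsP: "xs ! (k mod N) \<in> P" for k using assms(1,2) N by (auto simp: closed_walk_def)
  have "covers g (xs ! (k mod N)) (xs ! (Suc (k mod N) mod N))"
    using assms(1,2) N by (simp add: closed_walk_def)
  then have s: "sgn (xs ! (Suc k mod N)) = sgn (g (xs ! (k mod N)))"
    by (simp add: covers_def mod_Suc_eq)
  have "branch_disp b ((g ^^ k) x) ((g ^^ Suc k) x) = d (xs ! (k mod N))"
    using disp_walk[OF xsP xsP s] assms(3,4) funpow_in P_triod P_nonzero by blast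
  then show ?thesis by (simp add: d_def)
qed

lemma orbit_walk:
  assumes "x \<in> P" "k > 0" "covers g ((g ^^ (k - 1)) x) z"
  shows "successively (covers g) (map (\<lambda>i. (g ^^ i) x) [0..<k] @ [z])"
  unfolding successively_conv_nth
proof (intro allI impI)
  fix i assume "Suc i < length (map (\<lambda>i. (g ^^ i) x) [0..<k] @ [z])"
  then have i: "i < k" by simp
  show "covers g ((map (\<lambda>i. (g ^^ i) x) [0..<k] @ [z]) ! i) ((map (\<lambda>i. (g ^^ i) x) [0..<k] @ [z]) ! Suc i)"
  proof (cases "Suc i = k")
    case True
    then show ?thesis using assms(3) by (auto simp: nth_append)
  next
    case False
    then show ?thesis using i by (auto simp: nth_append covers_def)
  qed
qed

lemma orbit_wt: "x \<in> P \<Longrightarrow> wt (map (\<lambda>i. (g ^^ i) x) [0..<k]) = lam ((g ^^ k) x) - lam x"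
  by (simp add: wt_nth lam_funpow)

lemma covers_pred:
  assumes "x \<in> P" "k > 0" "sgn z = sgn ((g ^^ k) x)" "norm z \<le> norm ((g ^^ k) x)"
  shows "covers g ((g ^^ (k - 1)) x) z"
proof -
  have "g ((g ^^ (k - 1)) x) = (g ^^ k) x" using assms(2) by (cases k) auto
  then show ?thesis using assms by (simp add: covers_def)
qed

text \<open>When the orbit returns to the branch of \<open>x\<close> no farther in, its last step
  may end at \<open>x\<close> instead. By \<open>orbit_wt\<close> the weight of this loop is still a
  difference of \<open>lam\<close>.\<close>

lemma orbit_loop:
  assumes "x \<in> P" "k > 0" "sgn x = sgn ((g ^^ k) x)" "norm x \<le> norm ((g ^^ k) x)"
  shows "loop_at x (map (\<lambda>i. (g ^^ i) x) [0..<k])"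
  unfolding loop_at_def using orbit_walk[OF assms(1,2) covers_pred[OF assms]] assms(1,2) funpow_in
  by (auto simp: hd_map)

definition lowest :: "complex \<Rightarrow> bool" where
  "lowest x \<longleftrightarrow> x \<in> P \<and> (\<forall>u\<in>P. sgn u = sgn x \<longrightarrow> norm x \<le> norm u)"

lemma lowest_d: "lowest x \<Longrightarrow> d x = 1 / 3"
  using lowest_black by (auto simp: lowest_def)

lemma ex_lowest_idx: "i < 3 \<Longrightarrow> \<exists>x. lowest x \<and> idx x = i"
  using ex_lowest[of i] unfolding lowest_def by metis

lemma ex_lowest_branch:
  assumes "x \<in> P"
  obtains p where "lowest p" "sgn p = sgn x" "norm p \<le> norm x"
  using ex_lowest_idx[OF idx_less[OF assms]] idx_eq_iff assms unfolding lowest_def by metis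

lemma lowest_covers:
  assumes "x \<in> P" "lowest y" "d x = 1 / 3" "idx y = (idx x + 1) mod 3"
  shows "covers g x y"
proof -
  have "y \<in> P" using assms by (simp add: lowest_def)
  moreover have "idx (g x) = idx y" using black_idx assms by simp
  ultimately have "sgn (g x) = sgn y" using idx_eq_iff[OF g_in[OF assms(1)]] by blast
  then show ?thesis using assms g_in by (auto simp: covers_def lowest_def)
qed

text \<open>Lowest points are black, and the image of one lies no farther in than the lowest point
  of the next branch, so three such steps close up after one turn.\<close>

lemma lowest_loop:
  assumes "lowest p"
  obtains xs where "loop_at p xs" "wt xs = 1 - 3 * \<rho>"
proof -
  have ip: "idx p < 3" using assms idx_less by (simp add: lowest_def)
  obtain p' p'' where p': "lowest p'" "idx p' = (idx p + 1) mod 3"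
    and p'': "lowest p''" "idx p'' = (idx p' + 1) mod 3"
    using ex_lowest_idx by (metis mod_less_divisor zero_less_numeral)
  have "idx p = (idx p'' + 1) mod 3" using ip p' p'' by (simp add: mod_simps)
  then have "covers g p p'" "covers g p' p''" "covers g p'' p"
    using lowest_covers assms p' p'' lowest_d by (auto simp: lowest_def)
  then have "loop_at p [p, p', p'']" using assms p' p'' by (simp add: loop_at_def lowest_def)
  moreover have "wt [p, p', p''] = 1 - 3 * \<rho>"
    using lowest_d[OF assms] lowest_d[OF p'(1)] lowest_d[OF p''(1)] by (simp add: wt_def \<delta>_def)
  ultimately show ?thesis by (rule that)
qed

end

context twist_cycle
begin

text \<open>Running many times through one loop and then many times through the other gives a closed walk
  of the rotation number of \<open>P\<close> whose deviation is too large for \<open>P\<close> to follow it.\<close>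

lemma no_opposite_loops:
  assumes "\<rho> \<noteq> 1 / 3" "loop_at p xs" "loop_at p ys" "wt xs > 0" "wt ys < 0"
  shows False
proof -
  define n where "n = 3 * real (card P)"
  have n: "n > 0" using card_pos by (simp add: n_def)
  obtain i j where ij: "n * wt xs = of_int i" "n * wt ys = of_int j"
    using wt_integral assms(2,3) unfolding loop_at_def n_def Ints_def by (metis imageE)
  have "0 < real_of_int i" "real_of_int j < 0"
    using ij n assms(4,5) by (metis zero_less_mult_iff, metis mult_pos_neg)
  then have "i > 0" "j < 0" by auto
  define A B where "A = nat i" and "B = nat (- j)"
  have AB: "A > 0" "B > 0" "n * wt xs = real A" "n * wt ys = - real B"
    using \<open>i > 0\<close> \<open>j < 0\<close> ij by (auto simp: A_def B_def)
  \<comment> \<open>An orbit segment of \<open>P\<close> accumulates a difference of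
    \<open>lam\<close>, hence at most \<open>M\<close>.\<close>
  define M where "M = Max ((\<lambda>(x, y). lam y - lam x) ` (P \<times> P))"
  have M: "lam y - lam x \<le> M" if "x \<in> P" "y \<in> P" for x y
    unfolding M_def using finite_P that by (intro Max_ge) auto
  obtain K where K: "real K > n * M" "K > 0"
    using reals_Archimedean2[of "max 1 (n * M)"] by auto
  \<comment> \<open>After scaling by \<open>n\<close> the loops weigh \<open>A\<close> and
    \<open>- B\<close>, so these repetition counts cancel, while \<open>K\<close> makes the first
    half alone exceed \<open>M\<close>.\<close>
  define us vs where "us = concat (replicate (B * K) xs)" and "vs = concat (replicate (A * K) ys)"
  have us: "loop_at p us" "wt us = real (B * K) * wt xs"
    unfolding us_def using loop_at_repeat[OF assms(2), of "B * K"] AB K by auto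
  have vs: "loop_at p vs" "wt vs = real (A * K) * wt ys"
    unfolding vs_def using loop_at_repeat[OF assms(3), of "A * K"] AB K by auto
  have cw: "closed_walk g P (us @ vs)"
    using loop_at_closed_walk[OF loop_at_append[OF us(1) vs(1)]] .
  define N where "N = length (us @ vs)"
  have "n * wt (us @ vs) = real (B * K) * (n * wt xs) + real (A * K) * (n * wt ys)"
    using us(2) vs(2) by (simp add: algebra_simps)
  also have "\<dots> = 0" using AB by simp
  finally have "wt (us @ vs) = 0" using n by simp
  then have "(\<Sum>i<N. d ((us @ vs) ! i)) = real N * \<rho>"
    unfolding wt_nth N_def by (simp add: \<delta>_def sum_subtractf)
  then obtain x where x: "x \<in> P" "\<And>k. sgn ((g ^^ k) x) = sgn ((us @ vs) ! (k mod N))"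
    using closed_walk_tracked[OF assms(1) cw N_def] by blast
  have "\<delta> ((g ^^ k) x) = \<delta> (us ! k)" if "k < length us" for k
    using tracked_d[OF cw N_def x] that by (simp add: \<delta>_def N_def nth_append)
  then have "lam ((g ^^ length us) x) = lam x + wt us"
    using lam_funpow[OF x(1)] by (simp add: wt_nth)
  then have "wt us \<le> M" using M[OF x(1) funpow_in[OF x(1)], of "length us"] by simp
  then have "n * wt us \<le> n * M" using n by simp
  moreover have "n * wt us = real (B * K) * real A" using us(2) AB by simp
  moreover have "real K \<le> real (B * K) * real A"
  proof -
    have "K \<le> B * K * A" using AB by simp
    then show ?thesis by (metis of_nat_le_iff of_nat_mult)
  qed
  ultimately show False using K by linarith
qed

text \<open>This is the monotonicity of the code function: on a branch, \<open>lam\<close> and the negated code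
  function differ by a constant.\<close>

lemma lam_mono:
  assumes "\<rho> \<noteq> 1 / 3" "u \<in> P" "w \<in> P" "sgn u = sgn w" "norm u < norm w"
  shows "(1 / 3 - \<rho>) * (lam w - lam u) > 0"
proof (rule ccontr)
  assume neg: "\<not> (1 / 3 - \<rho>) * (lam w - lam u) > 0"
  obtain k where k: "k < card P" "w = (g ^^ k) u" using funpow_reach[OF assms(2,3)] .
  have "k > 0" using k assms(5) by (cases k) auto
  define ws where "ws = map (\<lambda>i. (g ^^ i) u) [0..<k]"
  have ws: "loop_at u ws" "wt ws = lam w - lam u"
    unfolding ws_def using orbit_loop[OF assms(2) \<open>k > 0\<close>] orbit_wt[OF assms(2)] k assms by auto
  \<comment> \<open>A loop of weight 0 has mean displacement \<open>\<rho>\<close>, so a point of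
    \<open>P\<close> would follow it and return after \<open>k < card P\<close> steps.\<close>
  have "wt ws \<noteq> 0"
  proof
    assume "wt ws = 0"
    then have "(\<Sum>i<length ws. d (ws ! i)) = real (length ws) * \<rho>"
      unfolding wt_nth by (simp add: \<delta>_def sum_subtractf)
    then obtain x where "x \<in> P" "(g ^^ length ws) x = x"
      using closed_walk_tracked[OF assms(1) loop_at_closed_walk[OF ws(1)] refl] by blast
    then show False using funpow_neq \<open>k > 0\<close> k by (simp add: ws_def)
  qed
  then have neg': "(1 / 3 - \<rho>) * wt ws < 0"
    using neg ws(2) assms(1) by (metis diff_0_right linorder_neqE_linordered_idom mult_eq_0_iff
        right_minus_eq)
  obtain p where p: "lowest p" "sgn p = sgn u" "norm p \<le> norm u" using ex_lowest_branch[OF assms(2)] .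
  have pP: "p \<in> P" using p by (simp add: lowest_def)
  obtain xs where xs: "loop_at p xs" "wt xs = 1 - 3 * \<rho>" using lowest_loop[OF p(1)] .
  \<comment> \<open>The loop at \<open>u\<close> is moved to the lowest point \<open>p\<close> of
    the branch: follow the orbit from \<open>p\<close> to \<open>u\<close>, run through the loop,
    and close up at \<open>p\<close>, which is covered because it lies inside
    \<open>u\<close>.\<close>
  obtain ys where ys: "loop_at p ys" "(1 / 3 - \<rho>) * wt ys < 0"
  proof (cases "p = u")
    case True
    then show ?thesis using that ws(1) neg' by simp
  next
    case False
    obtain l where l: "u = (g ^^ l) p" using funpow_reach[OF pP assms(2)] by metis
    have "l > 0" using l False by (cases l) auto
    define vs where "vs = map (\<lambda>i. (g ^^ i) p) [0..<l]"
    define c where "c = 1 / 3 - \<rho>"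
    \<comment> \<open>\<open>C\<close> repetitions outweigh whatever the way from \<open>p\<close>
      to \<open>u\<close> contributes.\<close>
    obtain C :: nat where C: "real C > (c * wt vs) / - (c * wt ws)" "C > 0"
      using reals_Archimedean2[of "max 1 ((c * wt vs) / - (c * wt ws))"] by auto
    have pos: "0 < - (c * wt ws)" using neg' by (simp add: c_def)
    have "c * wt vs < real C * - (c * wt ws)" using C(1) unfolding pos_divide_less_eq[OF pos] .
    then have "c * (wt vs + real C * wt ws) < 0" by (simp add: algebra_simps)
    moreover define us where "us = concat (replicate C ws)"
    have us: "loop_at u us" "wt us = real C * wt ws"
      unfolding us_def using loop_at_repeat[OF ws(1) C(2)] by auto
    have "loop_at p (vs @ us)"
    proof -
      have "successively (covers g) (vs @ [u])"
        unfolding vs_def using l by (intro orbit_walk[OF pP \<open>l > 0\<close>] covers_pred[OF pP \<open>l > 0\<close>]) auto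
      moreover have "successively (covers g) us" "covers g (last us) u" "us \<noteq> []" "hd us = u"
        using us(1) by (auto simp: loop_at_def successively_append_iff)
      moreover have "covers g (last us) p" using \<open>covers g (last us) u\<close> p by (auto intro: covers_mono)
      moreover have "vs \<noteq> []" "hd vs = p" "set vs \<subseteq> P" "set us \<subseteq> P"
        using \<open>l > 0\<close> us(1) funpow_in[OF pP] by (auto simp: vs_def hd_map loop_at_def)
      ultimately show ?thesis by (auto simp: loop_at_def successively_append_iff)
    qed
    ultimately show ?thesis using that us(2) by (simp add: c_def)
  qed
  show False
  proof (cases "\<rho> < 1 / 3")
    case True
    then have "wt xs > 0" "wt ys < 0" using xs(2) ys(2) by (auto simp: mult_less_0_iff)
    then show ?thesis using no_opposite_loops[OF assms(1) xs(1) ys(1)] by simp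
  next
    case False
    then have "wt xs < 0" "wt ys > 0" using xs(2) ys(2) assms(1) by (auto simp: mult_less_0_iff)
    then show ?thesis using no_opposite_loops[OF assms(1) ys(1) xs(1)] by simp
  qed
qed

lemma lam_inj:
  assumes "\<rho> \<noteq> 1 / 3" "u \<in> P" "w \<in> P" "sgn u = sgn w" "lam u = lam w"
  shows "u = w"
  using lam_mono[OF assms(1-4)] lam_mono[OF assms(1,3,2) assms(4)[symmetric]] assms(4,5)
    complex_polar_eqI by (metis diff_self less_irrefl linorder_less_linear mult_zero_right)

text \<open>A green step goes inwards and lowers \<open>lam\<close> by \<open>\<rho>\<close>, but
  for \<open>\<rho> > 1 / 3\<close> the potential is larger farther in.\<close>

lemma no_green:
  assumes "\<rho> > 1 / 3" "x \<in> P"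
  shows "d x \<noteq> 0"
proof
  assume "d x = 0"
  then have "(1 / 3 - \<rho>) * (lam x - lam (g x)) > 0"
    using green_inward[OF assms(2)] assms by (intro lam_mono g_in) auto
  then have "(1 / 3 - \<rho>) * \<rho> > 0" using lam_step[OF assms(2)] \<open>d x = 0\<close> by (simp add: \<delta>_def)
  then show False using assms(1) by (simp add: zero_less_mult_iff)
qed

text \<open>A shortest path from a lowest point to a red point \<open>v\<close> has only black points before \<open>v\<close>.
  Following it backwards, regularity and the monotonicity of \<open>lam\<close> keep its points on the branch of
  \<open>g v\<close> outside \<open>g v\<close>, which is impossible for the lowest one.\<close>

lemma no_red:
  assumes "\<rho> < 1 / 3" "x \<in> P"
  shows "d x \<noteq> 2 / 3"
proof
  assume red: "d x = 2 / 3"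
  define path where "path = (\<lambda>c m. lowest (c 0) \<and> d (c m) = 2 / 3 \<and> (\<forall>j. c j \<in> P) \<and>
    (\<forall>j<m. covers g (c j) (c (Suc j))))"
  have "\<exists>m c. path c m"
  proof -
    obtain p where p: "lowest p" using ex_lowest_branch[OF assms(2)] by metis
    then have pP: "p \<in> P" by (simp add: lowest_def)
    obtain k where "x = (g ^^ k) p" using funpow_reach[OF pP assms(2)] by metis
    then have "path (\<lambda>j. (g ^^ j) p) k"
      using p red funpow_in[OF pP] by (auto simp: path_def covers_def)
    then show ?thesis by blast
  qed
  then obtain m where "\<exists>c. path c m" and least: "\<And>k. k < m \<Longrightarrow> \<not> (\<exists>c. path c k)"
    unfolding exists_least_iff[of "\<lambda>m. \<exists>c. path c m"] by blast
  then obtain c where c: "path c m" by blast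
  have cP: "c j \<in> P" for j using c by (simp add: path_def)
  have "lowest (c 0)" using c by (simp add: path_def)
  then have dc0: "d (c 0) = 1 / 3" by (rule lowest_d)
  define v where "v = c m"
  have v: "v \<in> P" "d v = 2 / 3" using c by (auto simp: v_def path_def)
  have black: "d (c j) = 1 / 3" if j: "j < m" for j
  proof (rule ccontr)
    assume "d (c j) \<noteq> 1 / 3"
    then consider "d (c j) = 2 / 3" | "d (c j) = 0" using d_cases[OF cP] by blast
    then show False
    proof cases
      case 1
      then have "path c j" using c j by (simp add: path_def)
      then show ?thesis using least[OF j] by blast
    next
      case 2
      then have "j \<noteq> 0" using dc0 by (cases j) auto
      then obtain i where i: "j = Suc i" by (cases j) auto
      \<comment> \<open>A green point can be skipped: its image lies on the same branch farther in,
        so its predecessor already covers its successor. The path gets shorter.\<close>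
      define c' where "c' = (\<lambda>l. if l < j then c l else c (Suc l))"
      have "covers g (c i) (c j)" "covers g (c j) (c (Suc j))" using c j i by (auto simp: path_def)
      then have "covers g (c i) (c (Suc j))"
        using green_inward[OF cP 2] by (auto simp: covers_def)
      then have "path c' (m - 1)"
        using c i j unfolding path_def c'_def by (auto simp: less_Suc_eq)
      then show ?thesis using least[of "m - 1"] j by auto
    qed
  qed
  have c0: "lowest (c 0)" "idx (c 0) < 3" using c idx_less cP by (auto simp: path_def)
  obtain low where low: "\<And>i. i < 3 \<Longrightarrow> lowest (low i) \<and> idx (low i) = i"
    using ex_lowest_idx by metis
  \<comment> \<open>The path is read backwards from \<open>v\<close> and prolonged beyond its start
    by lowest points. Adding 2 modulo 3 goes one branch back, so every step remains a black covering
    step.\<close>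
  define e where "e = (\<lambda>t. if t \<le> m then c (m - t) else low ((idx (c 0) + 2 * (t - m)) mod 3))"
  have e_low: "lowest (e t) \<and> idx (e t) = (idx (c 0) + 2 * (t - m)) mod 3" if "t \<ge> m" for t
    using that c0 low by (cases "t = m") (auto simp: e_def)
  have e0: "e 0 = v" by (simp add: e_def v_def)
  have eP: "e t \<in> P" for t
    using e_low[of t] cP by (cases "t \<le> m") (auto simp: e_def lowest_def)
  have e_black: "d (e (Suc t)) = 1 / 3" for t
  proof (cases "Suc t \<le> m")
    case True
    then show ?thesis using black[of "m - Suc t"] by (simp add: e_def)
  next
    case False
    then show ?thesis using e_low[of "Suc t"] lowest_d by simp
  qed
  have e_covers: "covers g (e (Suc t)) (e t)" for t
  proof (cases "Suc t \<le> m")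
    case True
    then have "covers g (c (m - Suc t)) (c (Suc (m - Suc t)))" using c by (auto simp: path_def)
    then show ?thesis using True by (simp add: e_def Suc_diff_Suc)
  next
    case False
    define s where "s = t - m"
    have t: "t = m + s" using False by (simp add: s_def)
    have "idx (e t) = (idx (c 0) + 2 * s) mod 3" using e_low[of t] t by simp
    moreover have "idx (e (Suc t)) = (idx (c 0) + 2 * Suc s) mod 3"
      using e_low[of "Suc t"] t by (simp add: Suc_diff_le)
    moreover have "(idx (c 0) + 2 * s) mod 3 = ((idx (c 0) + 2 * Suc s) mod 3 + 1) mod 3"
      by (simp add: mod_simps)
    ultimately have "idx (e t) = (idx (e (Suc t)) + 1) mod 3" by simp
    then show ?thesis
      using lowest_covers[OF eP _ e_black] e_low[of t] t by simp
  qed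
  have e_idx: "idx (e t) = (idx (e (Suc t)) + 1) mod 3" for t
  proof -
    have "idx (g (e (Suc t))) = idx (e t)"
      using e_covers[of t] idx_eq_iff[OF g_in[OF eP] eP] by (simp add: covers_def)
    then show ?thesis using black_idx[OF eP e_black] by simp
  qed
  have e_idx3: "idx (e (t + 3)) = idx (e t)" for t
  proof -
    have "t + 3 = Suc (Suc (Suc t))" by simp
    moreover have "(((n + 1) mod 3 + 1) mod 3 + 1) mod 3 = n" if "n < 3" for n :: nat
      using that by (simp add: mod_simps)
    ultimately show ?thesis
      using e_idx[of t, unfolded e_idx[of "Suc t"], unfolded e_idx[of "Suc (Suc t)"]]
        idx_less[OF eP, of "Suc (Suc (Suc t))"] by metis
  qed
  \<comment> \<open>A red step forwards and a black step backwards from \<open>v\<close> lead to the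
    same branch, as 2 and -1 agree modulo 3.\<close>
  have e1: "idx (e 1) = idx (g v)"
  proof -
    have "idx (g v) = (idx v + 2) mod 3" using red_idx v by simp
    moreover have "idx v = (idx (e 1) + 1) mod 3" using e_idx[of 0] e0 by simp
    ultimately show ?thesis using idx_less[OF eP, of 1] by (simp add: mod_simps)
  qed
  have e_sgn: "sgn (e (1 + 3 * l)) = sgn (g v)" for l
  proof -
    have "idx (e (1 + 3 * l)) = idx (e 1)"
    proof (induction l)
      case (Suc l)
      then show ?case using e_idx3[of "1 + 3 * l"] by (simp add: algebra_simps)
    qed simp
    then have "idx (e (1 + 3 * l)) = idx (g v)" using e1 by simp
    then show ?thesis using idx_eq_iff[OF eP g_in[OF v(1)]] by blast
  qed
  \<comment> \<open>The black step adds \<open>1 / 3 - \<rho>\<close>, and pulling the image inwards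
    to \<open>e t\<close> can only lower \<open>lam\<close>.\<close>
  have e_lam: "lam (e t) \<le> lam (e (Suc t)) + 1 / 3 - \<rho>" for t
  proof -
    have "lam (e t) \<le> lam (g (e (Suc t)))"
    proof (cases "norm (e t) < norm (g (e (Suc t)))")
      case True
      then have "(1 / 3 - \<rho>) * (lam (g (e (Suc t))) - lam (e t)) > 0"
        using e_covers[of t] assms(1) by (intro lam_mono eP g_in) (auto simp: covers_def)
      then show ?thesis using assms(1) by (simp add: zero_less_mult_iff)
    next
      case False
      then have "e t = g (e (Suc t))"
        using e_covers[of t] by (intro complex_polar_eqI[of "e t"]) (auto simp: covers_def)
      then show ?thesis by simp
    qed
    then show ?thesis using lam_step[OF eP] e_black by (simp add: \<delta>_def)
  qed
  have reg: "regular_pattern (pattern_of g P)" using twist by (simp add: triod_twist_def)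
  have gv: "sgn (g v) \<noteq> sgn v"
  proof -
    have "idx v = 0 \<or> idx v = 1 \<or> idx v = 2" using idx_less[OF v(1)] by auto
    then have "idx (g v) \<noteq> idx v" using red_idx[OF v] by auto
    then show ?thesis using idx_eq_iff[OF g_in[OF v(1)] v(1)] by simp
  qed
  have no_cover: "\<not> (covers g v w \<and> covers g w v)" if "w \<in> P" "sgn w = sgn (g v)" for w
    using no_returning_pair[OF reg v(1) that(1)] gv that(2) by metis
  have outside: "norm (e (1 + 3 * l)) > norm (g v)" for l
  proof (induction l)
    case 0
    show ?case
      using no_cover[OF eP, of 1] e_sgn[of 0] e_covers[of 0] e0 by (auto simp: covers_def)
  next
    case (Suc l)
    show ?case
    proof (rule ccontr)
      \<comment> \<open>If \<open>w\<close> were not outside \<open>g v\<close>, then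
        \<open>v\<close> would cover \<open>w\<close>, so by regularity \<open>g w\<close> lies
        strictly inside \<open>v\<close>, giving \<open>1\<close> below. By induction the point
        three steps closer to \<open>v\<close> is outside \<open>g v\<close>, giving
        \<open>2\<close>. The three black steps between the two points account for a rise of at most
        \<open>1 - 3 * \<rho>\<close>, which is too little.\<close>
      define w where "w = e (1 + 3 * Suc l)"
      assume "\<not> norm (e (1 + 3 * Suc l)) > norm (g v)"
      then have cov: "covers g v w" using e_sgn[of "Suc l"] by (simp add: covers_def w_def)
      have wP: "w \<in> P" using eP by (simp add: w_def)
      have ws: "sgn w = sgn (g v)" using e_sgn w_def by blast
      have nc: "\<not> covers g w v" using no_cover[OF wP ws] cov by simp
      have "idx w = idx (e 1)" using ws e_sgn[of 0] idx_eq_iff[OF wP eP, of 1] by simp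
      then have "idx (g w) = idx v"
        using black_idx[OF wP] e_black[of "3 * Suc l"] e_idx[of 0] e0 by (simp add: w_def)
      then have gw: "sgn (g w) = sgn v" using idx_eq_iff[OF g_in[OF wP] v(1)] by simp
      then have "norm (g w) < norm v" using nc by (auto simp: covers_def)
      then have "(1 / 3 - \<rho>) * (lam v - lam (g w)) > 0"
        using gw v wP assms(1) by (intro lam_mono g_in) auto
      then have 1: "lam w + 1 / 3 - \<rho> < lam v"
        using assms(1) lam_step[OF wP] e_black[of "3 * Suc l"]
        by (simp add: zero_less_mult_iff \<delta>_def w_def)
      have "(1 / 3 - \<rho>) * (lam (e (1 + 3 * l)) - lam (g v)) > 0"
        using Suc e_sgn assms(1) v(1) by (intro lam_mono g_in eP) auto
      then have 2: "lam (e (1 + 3 * l)) > lam v + 2 / 3 - \<rho>"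
        using assms(1) lam_step[OF v(1)] v(2) by (simp add: zero_less_mult_iff \<delta>_def)
      have "lam (e (1 + 3 * l)) \<le> lam w + 1 - 3 * \<rho>"
      proof -
        have "lam w = lam (e (Suc (Suc (Suc (1 + 3 * l)))))" by (simp add: w_def eval_nat_numeral)
        then show ?thesis
          using e_lam[of "1 + 3 * l"] e_lam[of "Suc (1 + 3 * l)"] e_lam[of "Suc (Suc (1 + 3 * l))"]
          by linarith
      qed
      then show False using 1 2 \<rho>_nonneg by linarith
    qed
  qed
  \<comment> \<open>Since \<open>1 + 3 * m > m\<close>, this index lies in the prolongation, on the
    branch of \<open>g v\<close>.\<close>
  have "lowest (e (1 + 3 * m))" using e_low[of "1 + 3 * m"] by simp
  then have "norm (e (1 + 3 * m)) \<le> norm (g v)"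
    using e_sgn[of m] g_in[OF v(1)] by (simp add: lowest_def)
  then show False using outside[of m] by simp
qed

end


section \<open>Coprimality\<close>

context numbered_cycle
begin

lemma disp_sum_mod:
  assumes "x \<in> P"
  shows "(\<Sum>j<k. d ((g ^^ j) x)) - (real (idx ((g ^^ k) x)) - real (idx x)) / 3 \<in> \<int>"
proof (induction k)
  case (Suc k)
  define y where "y = (g ^^ k) x"
  have y: "y \<in> P" using funpow_in assms by (simp add: y_def)
  have "d y - (real (idx (g y)) - real (idx y)) / 3 \<in> \<int>"
    unfolding d_def using y g_in P_triod P_nonzero by (intro branch_disp_mod[OF numbering]) auto
  from Ints_add[OF Suc this[unfolded y_def]] show ?case
    by (simp add: y_def diff_divide_distrib algebra_simps)
qed simp

end

lemma (in twist_cycle) rotation_not_integral: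
  assumes "\<rho> \<noteq> 1 / 3" "0 < k" "k < card P"
  shows "real k * \<rho> \<notin> \<int>"
proof
  assume int: "real k * \<rho> \<in> \<int>"
  define c where "c = (\<lambda>u. (\<Sum>j<k. d ((g ^^ j) u)) - real k * \<rho>)"
  \<comment> \<open>If \<open>c u\<close> vanished, the displacement over \<open>k\<close> steps
    would be an integer, so \<open>u\<close> and its \<open>k\<close>-th image would share branch
    and \<open>lam\<close>, hence coincide before the period is over.\<close>
  have nz: "c u \<noteq> 0" if u: "u \<in> P" for u
  proof
    assume "c u = 0"
    define w where "w = (g ^^ k) u"
    have w: "w \<in> P" using funpow_in u by (simp add: w_def)
    have "(\<Sum>j<k. d ((g ^^ j) u)) \<in> \<int>" using \<open>c u = 0\<close> int by (simp add: c_def)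
    from Ints_diff[OF this disp_sum_mod[OF u, of k]] have "(real (idx w) - real (idx u)) / 3 \<in> \<int>"
      by (simp add: w_def)
    then obtain z where z: "(real (idx w) - real (idx u)) / 3 = of_int z" by (auto simp: Ints_def)
    have "real (idx w) < 3" "real (idx u) < 3" using idx_less u w by auto
    then have "\<bar>real_of_int z\<bar> < 1" unfolding z[symmetric] by (auto simp: abs_less_iff)
    then have "z = 0" by linarith
    then have "sgn u = sgn w" using z idx_eq_iff[OF u w] by simp
    moreover have "lam w = lam u"
      using lam_funpow[OF u, of k] \<open>c u = 0\<close> by (simp add: w_def c_def \<delta>_def sum_subtractf)
    ultimately have "u = w" using lam_inj[OF assms(1) u w] by simp
    then show False using funpow_neq[OF u assms(2,3)] by (simp add: w_def)
  qed
  have third: "3 * c u \<in> \<int>" if u: "u \<in> P" for u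
  proof -
    have "3 * d ((g ^^ j) u) \<in> \<int>" for j
      using idx_g[OF funpow_in[OF u], of j] by (metis Ints_of_nat nonzero_mult_div_cancel_left
          times_divide_eq_right zero_neq_numeral)
    then have "(\<Sum>j<k. 3 * d ((g ^^ j) u)) \<in> \<int>" by (rule Ints_sum)
    moreover have "3 * (real k * \<rho>) \<in> \<int>" using int by (rule Ints_mult[OF Ints_numeral])
    ultimately show ?thesis by (simp add: c_def right_diff_distrib sum_distrib_left)
  qed
  have far: "c u \<le> - 1 / 3 \<or> c u \<ge> 1 / 3" if u: "u \<in> P" for u
  proof -
    obtain z where z: "3 * c u = of_int z" using third[OF u] by (auto simp: Ints_def)
    then have "z \<noteq> 0" using nz[OF u] by auto
    then have "z \<le> - 1 \<or> z \<ge> 1" by linarith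
    then have "real_of_int z \<le> - 1 \<or> real_of_int z \<ge> 1" by linarith
    then show ?thesis using z by linarith
  qed
  have step: "c (g u) = c u + (d ((g ^^ k) u) - d u)" for u
  proof -
    have "(\<Sum>j<k. d ((g ^^ j) (g u))) + d u = (\<Sum>j<Suc k. d ((g ^^ j) u))"
      unfolding sum.lessThan_Suc_shift by (simp add: funpow_swap1)
    then show ?thesis by (simp add: c_def)
  qed
  \<comment> \<open>Values are at least 1/3 away from 0, so a change of sign needs a jump of 2/3,
    that is, a green start and a red end. One of these colours is absent.\<close>
  have no_cross: "c (g u) < 0" if u: "u \<in> P" "c u < 0" for u
  proof (rule ccontr)
    assume "\<not> c (g u) < 0"
    then have "d ((g ^^ k) u) - d u \<ge> 2 / 3"
      using far[OF u(1)] far[OF g_in[OF u(1)]] u(2) step[of u] by linarith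
    then have "d ((g ^^ k) u) = 2 / 3" "d u = 0"
      using d_cases[OF u(1)] d_cases[OF funpow_in[OF u(1), of k]] by auto
    then show False
      using no_red[OF _ funpow_in[OF u(1)]] no_green[OF _ u(1)] assms(1)
      by (metis linorder_neqE_linordered_idom)
  qed
  have sum0: "(\<Sum>u\<in>P. c u) = 0"
  proof -
    have "(\<Sum>u\<in>P. \<Sum>j<k. d ((g ^^ j) u)) = (\<Sum>j<k. \<Sum>u\<in>P. d ((g ^^ j) u))" by (rule sum.swap)
    also have "\<dots> = real k * sum d P" by (simp add: sum_shift)
    finally show ?thesis by (simp add: c_def sum_subtractf sum_d)
  qed
  have "\<exists>u\<in>P. c u < 0"
  proof (rule ccontr)
    assume "\<not> ?thesis"
    then have "\<forall>u\<in>P. c u > 0" using nz by (meson linorder_neqE_linordered_idom)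
    then show False using sum_pos[OF finite_P P_nonempty, of c] sum0 by simp
  qed
  then obtain u where u: "u \<in> P" "c u < 0" by blast
  \<comment> \<open>Excluding upward crossings is enough: once negative, \<open>c\<close> is
    negative on all of the cycle, against its mean 0.\<close>
  have "c ((g ^^ j) u) < 0" for j
    using no_cross funpow_in[OF u(1)] u(2) by (induction j) auto
  then have "c w < 0" if w: "w \<in> P" for w using funpow_reach[OF u(1) w] by metis
  then have "(\<Sum>w\<in>P. - c w) > 0" by (intro sum_pos finite_P P_nonempty) simp
  then show False using sum0 by (simp add: sum_negf)
qed

section \<open>Primitive cycles of period three\<close>

text \<open>Starting from a point \<open>y\<close> mapped outside itself by \<open>f ^^ 3\<close>, move outwards until the orbit no
  longer visits the three branches in turn: it would then pass through the branching point, so a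
  periodic point is met before.\<close>

lemma covering_triple_periodic_point:
  assumes f: "f \<in> triod_maps" and z: "z0 \<in> triod" "z1 \<in> triod" "z2 \<in> triod" "z0 \<noteq> 0" "z1 \<noteq> 0" "z2 \<noteq> 0"
    and cov: "covers f z0 z1" "covers f z1 z2" "covers f z2 z0"
  obtains y where "y \<in> triod" "sgn y = sgn z0" "sgn (f y) = sgn z1" "sgn (f (f y)) = sgn z2"
    "f (f (f y)) = y"
proof -
  note F = triod_mapsD[OF f]
  define e0 e1 e2 where "e0 = sgn z0" and "e1 = sgn z1" and "e2 = sgn z2"
  have e: "e0 ^ 3 = 1" "e1 ^ 3 = 1" "e2 ^ 3 = 1" using z triod_sgn by (auto simp: e0_def e1_def e2_def)
  \<comment> \<open>Preimages are taken on the segment towards 0, where the coordinate of the image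
    runs from 0 to beyond \<open>t\<close>.\<close>
  have pull: "\<exists>y\<in>triod. sgn y = sgn x \<and> y \<noteq> 0 \<and> norm y \<le> norm x \<and> f y = t"
    if x: "x \<in> triod" "x \<noteq> 0" "t \<in> triod" "t \<noteq> 0" "covers f x t" for x t
  proof -
    have ex: "sgn x ^ 3 = 1" "sgn t ^ 3 = 1" using triod_sgn x by auto
    define C where "C = (\<lambda>u. coord (sgn t) (f (of_real u * sgn x)))"
    have "continuous_on {0..norm x} C" unfolding C_def
      using triod_norm_le[OF x(1)]
      by (intro continuous_intros continuous_on_ray[OF F(1) ex(1)]) auto
    moreover have "C 0 \<le> norm t" by (simp add: C_def F(3))
    moreover have "norm t \<le> C (norm x)"
      using x(5) coord_sgn(1)[OF F(2)[OF x(1)] ex(2)] by (simp add: C_def norm_times_sgn covers_def)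
    ultimately obtain u where u: "0 \<le> u" "u \<le> norm x" "C u = norm t"
      using IVT'[of C 0 "norm t" "norm x"] by auto
    define y where "y = of_real u * sgn x"
    have yt: "y \<in> triod" unfolding y_def
      using of_real_times_in_triod[OF ex(1) u(1)] u(2) triod_norm_le[OF x(1)] by linarith
    have cy: "coord (sgn t) (f y) = norm t" using u by (simp add: C_def y_def)
    have "f y = of_real (norm t) * sgn t"
      using coord_nonneg_iff[OF F(2)[OF yt] ex(2)] cy by simp
    then have fy: "f y = t" by (simp add: norm_times_sgn)
    then have "y \<noteq> 0" using F(3) x(4) by auto
    then have "u > 0" using u(1) by (auto simp: y_def less_le)
    then show ?thesis using yt fy u \<open>y \<noteq> 0\<close> sgn_of_real_times[OF ex(1)] norm_of_real_times[OF ex(1)]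
      by (intro bexI[of _ y]) (auto simp: y_def)
  qed
  \<comment> \<open>Pulling \<open>z2\<close> back twice gives the starting point \<open>a\<close>,
    whose third image \<open>f z2\<close> lies at least as far out as \<open>a\<close>.\<close>
  obtain c where c: "c \<in> triod" "sgn c = e1" "c \<noteq> 0" "norm c \<le> norm z1" "f c = z2"
    using pull[OF z(2,5,3,6) cov(2)] by (auto simp: e1_def)
  have "covers f z0 c" using cov(1) c by (auto simp: covers_def e1_def)
  then obtain a where a: "a \<in> triod" "sgn a = e0" "a \<noteq> 0" "norm a \<le> norm z0" "f a = c"
    using pull[OF z(1,4) c(1,3)] by (auto simp: e0_def)
  define p where "p = (\<lambda>t. of_real t * e0 :: complex)"
  have pt: "p t \<in> triod" if "t \<in> {0..1}" for t
    using of_real_times_in_triod[OF e(1)] that by (simp add: p_def)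
  define A B C where "A = (\<lambda>t. coord e1 (f (p t)))" and "B = (\<lambda>t. coord e2 (f (f (p t))))"
    and "C = (\<lambda>t. coord e0 (f (f (f (p t)))) - t)"
  have c1: "continuous_on {0..1} (\<lambda>t. f (p t))" unfolding p_def
    by (rule continuous_on_ray[OF F(1) e(1)]) simp
  have c2: "continuous_on {0..1} (\<lambda>t. f (f (p t)))"
    by (rule continuous_on_compose2[OF F(1) c1]) (use pt F(2) in auto)
  have c3: "continuous_on {0..1} (\<lambda>t. f (f (f (p t))))"
    by (rule continuous_on_compose2[OF F(1) c2]) (use pt F(2) in auto)
  \<comment> \<open>A zero of the minimum is where one of the conditions is about to fail: leaving
    the branch of \<open>e1\<close>, leaving that of \<open>e2\<close>, or being mapped outwards by
    the third iterate.\<close>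
  define m where "m = (\<lambda>t. min (min (A t) (B t)) (C t))"
  have na: "0 < norm a" "norm a \<le> 1" using a triod_norm_le by auto
  have "continuous_on {0..1} m"
    unfolding m_def A_def B_def C_def by (intro continuous_intros c1 c2 c3)
  then have cont: "continuous_on {norm a..1} m" by (rule continuous_on_subset) auto
  have pa: "p (norm a) = a" using a norm_times_sgn[of a] by (simp add: p_def)
  have "m (norm a) \<ge> 0"
  proof -
    have "A (norm a) = norm c" using coord_sgn(1)[OF c(1) e(2)] a c by (simp add: A_def pa)
    moreover have "B (norm a) = norm z2"
      using coord_sgn(1)[OF z(3) e(3)] a c by (simp add: B_def pa e2_def)
    moreover have "C (norm a) = norm (f z2) - norm a"
      using coord_sgn(1)[OF F(2)[OF z(3)] e(1)] cov(3) a c by (simp add: C_def pa e0_def covers_def)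
    moreover have "norm a \<le> norm (f z2)" using a cov(3) by (simp add: covers_def)
    ultimately show ?thesis by (simp add: m_def)
  qed
  moreover have "m 1 \<le> 0"
  proof -
    have "coord e0 (f (f (f (p 1)))) \<le> norm (f (f (f (p 1))))" by (rule coord_le_norm[OF e(1)])
    also have "\<dots> \<le> 1" using triod_norm_le F(2) pt by simp
    finally show ?thesis by (simp add: m_def C_def min_le_iff_disj)
  qed
  ultimately obtain t where t: "norm a \<le> t" "t \<le> 1" "m t = 0"
    using IVT2'[of m 1 0 "norm a", OF _ _ na(2) cont] by auto
  define y where "y = p t"
  have t0: "t > 0" using t(1) na(1) by linarith
  have y: "y \<in> triod" "f y \<in> triod" "f (f y) \<in> triod" "f (f (f y)) \<in> triod"
    using pt[of t] t t0 F(2) by (auto simp: y_def)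
  have ABC: "A t \<ge> 0" "B t \<ge> 0" "C t \<ge> 0" "A t = 0 \<or> B t = 0 \<or> C t = 0"
    using t(3) by (auto simp: m_def min_def split: if_splits)
  \<comment> \<open>Passing through 0 would make \<open>C t\<close> negative. So \<open>A t\<close>
    and \<open>B t\<close> do not vanish, and the zero of \<open>m\<close> is one of
    \<open>C\<close>.\<close>
  have "f (f (f y)) \<noteq> 0"
  proof
    assume "f (f (f y)) = 0"
    then have "C t = - t" by (simp add: C_def y_def)
    then show False using ABC(3) t0 by simp
  qed
  then have nz: "f (f y) \<noteq> 0" "f y \<noteq> 0" using F(3) by auto
  then have "A t \<noteq> 0" "B t \<noteq> 0"
    using coord_zeroD[OF y(2) e(2)] coord_zeroD[OF y(3) e(3)] by (auto simp: A_def B_def y_def)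
  then have pos: "A t > 0" "B t > 0" "C t = 0" using ABC by auto
  then have "coord e0 (f (f (f y))) = t" by (simp add: C_def y_def)
  then have "f (f (f y)) = y"
    using coord_nonneg_iff[OF y(4) e(1)] t0 by (simp add: y_def p_def)
  moreover have "sgn y = e0" using sgn_of_real_times[OF e(1) t0] by (simp add: y_def p_def)
  moreover have "sgn (f y) = e1" using coord_pos_sgn[OF y(2) e(2)] pos by (simp add: A_def y_def)
  moreover have "sgn (f (f y)) = e2" using coord_pos_sgn[OF y(3) e(3)] pos by (simp add: B_def y_def)
  ultimately show ?thesis using that[OF y(1)] by (simp add: e0_def e1_def e2_def)
qed

text \<open>With one point on each branch there is no order to preserve.\<close>

lemma period_3_order_conj:
  assumes "g (g (g y)) = y" "h (h (h z)) = z"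
    and s: "sgn z = sgn y" "sgn (h z) = sgn (g y)" "sgn (h (h z)) = sgn (g (g y))"
    and dist: "sgn y \<noteq> sgn (g y)" "sgn y \<noteq> sgn (g (g y))" "sgn (g y) \<noteq> sgn (g (g y))"
  shows "\<exists>\<phi>. order_conj g {y, g y, g (g y)} h {z, h z, h (h z)} \<phi>"
proof -
  define \<phi> where "\<phi> = (\<lambda>x. if x = y then z else if x = g y then h z else h (h z))"
  have ne: "y \<noteq> g y" "y \<noteq> g (g y)" "g y \<noteq> g (g y)" "z \<noteq> h z" "z \<noteq> h (h z)" "h z \<noteq> h (h z)"
    using s dist by auto
  have "order_conj g {y, g y, g (g y)} h {z, h z, h (h z)} \<phi>"
    unfolding order_conj_def bij_betw_def using assms ne by (auto simp: \<phi>_def inj_on_def)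
  then show ?thesis by blast
qed

lemma period_3_cycle:
  assumes "g \<in> triod_maps" "y \<in> triod" "g (g (g y)) = y" "y \<noteq> 0"
  shows "cycle g {y, g y, g (g y)}"
proof -
  have "(g ^^ 3) y = y" using assms(3) by (simp add: numeral_3_eq_3)
  then have "orbit g y = {(g ^^ m) y |m. m < 3}" by (rule orbit_altdef_bounded) simp
  also have "\<dots> = {y, g y, g (g y)}"
  proof -
    have "{(g ^^ m) y |m. m < 3} = (\<lambda>m. (g ^^ m) y) ` {..<3}" by auto
    also have "{..<3} = {0, 1, 2::nat}" by auto
    finally show ?thesis by (simp add: numeral_2_eq_2)
  qed
  finally have "{y, g y, g (g y)} = orbit g y" by simp
  then have "cyclic_on g {y, g y, g (g y)}" unfolding cyclic_on_def by blast
  then show ?thesis unfolding cycle_def using assms triod_mapsD(2)[OF assms(1)] by auto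
qed

context numbered_cycle
begin

text \<open>The lowest points cover each other cyclically. Order conjugacies preserve this relation,
  so every map with the pattern has the periodic triple.\<close>

lemma forces_primitive_3:
  obtains Q where "cycle g Q" "card Q = 3" "forces (pattern_of g P) (pattern_of g Q)"
    "rotation_number b g Q = 1 / 3"
proof -
  obtain x0 x1 x2 where x: "lowest x0" "idx x0 = 0" "lowest x1" "idx x1 = 1" "lowest x2" "idx x2 = 2"
    using ex_lowest_idx[of 0] ex_lowest_idx[of 1] ex_lowest_idx[of 2] by auto
  have xP: "x0 \<in> P" "x1 \<in> P" "x2 \<in> P" using x by (auto simp: lowest_def)
  have cov: "covers g x0 x1" "covers g x1 x2" "covers g x2 x0"
    using x xP lowest_d by (auto intro!: lowest_covers)
  have sd: "sgn x0 \<noteq> sgn x1" "sgn x0 \<noteq> sgn x2" "sgn x1 \<noteq> sgn x2"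
    using x idx_eq_iff xP by (metis zero_neq_one, metis zero_neq_numeral, metis one_eq_numeral_iff semiring_norm(85))
  have ex: "\<exists>y. y \<in> triod \<and> sgn y = sgn x0 \<and> sgn (h y) = sgn x1 \<and> sgn (h (h y)) = sgn x2 \<and>
      h (h (h y)) = y" if "cycle h P'" "order_conj g P h P' \<phi>" for h P' \<phi>
  proof -
    interpret h: triod_cycle h P' using that(1) by unfold_locales
    note D = order_conjD[OF that(2)]
    have c: "covers h (\<phi> x0) (\<phi> x1)" "covers h (\<phi> x1) (\<phi> x2)" "covers h (\<phi> x2) (\<phi> x0)"
      using order_conj_covers[OF that(2) cycle] xP cov by auto
    obtain y where "y \<in> triod" "sgn y = sgn (\<phi> x0)" "sgn (h y) = sgn (\<phi> x1)"
      "sgn (h (h y)) = sgn (\<phi> x2)" "h (h (h y)) = y"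
      by (rule covering_triple_periodic_point[OF h.map_in _ _ _ _ _ _ c])
        (use D(2) xP h.P_triod h.P_nonzero in auto)
    then show ?thesis using D(4) xP by auto
  qed
  obtain y where y: "y \<in> triod" "sgn y = sgn x0" "sgn (g y) = sgn x1" "sgn (g (g y)) = sgn x2"
    "g (g (g y)) = y" using ex[OF cycle order_conj_id] by blast
  define Q where "Q = {y, g y, g (g y)}"
  have s0: "sgn x0 \<noteq> 0" "sgn x1 \<noteq> 0" "sgn x2 \<noteq> 0" using xP P_nonzero by (auto simp: sgn_zero_iff)
  have nz: "y \<noteq> 0" "g y \<noteq> 0" "g (g y) \<noteq> 0" using y s0 by (metis sgn_zero)+
  have yt: "g y \<in> triod" "g (g y) \<in> triod" using triod_mapsD(2)[OF map_in] y(1) by auto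
  have Q: "cycle g Q" unfolding Q_def using period_3_cycle[OF map_in y(1,5) nz(1)] .
  have ne: "y \<noteq> g y" "y \<noteq> g (g y)" "g y \<noteq> g (g y)" using y sd by auto
  have card: "card Q = 3" using ne by (simp add: Q_def)
  have dQ: "branch_disp b y (g y) = 1 / 3" "branch_disp b (g y) (g (g y)) = 1 / 3"
    "branch_disp b (g (g y)) y = 1 / 3"
    using disp_walk[OF xP(1,2)] disp_walk[OF xP(2,3)] disp_walk[OF xP(3,1)] cov y nz yt x lowest_d
    by (auto simp: covers_def)
  have rot: "rotation_number b g Q = 1 / 3"
    unfolding rotation_number_def rotation_pair_def fst_conv snd_conv card
    using ne dQ y(5) by (simp add: Q_def)
  have "forces (pattern_of g P) (pattern_of g Q)"
    unfolding forces_def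
  proof (intro ballI impI)
    fix h assume h: "h \<in> triod_maps" "\<exists>P'. (h, P') \<in> pattern_of g P"
    then obtain P' \<phi> where P': "cycle h P'" and oc: "order_conj g P h P' \<phi>"
      using pattern_of_order_conj[OF cycle] by metis
    obtain z where z: "z \<in> triod" "sgn z = sgn x0" "sgn (h z) = sgn x1" "sgn (h (h z)) = sgn x2"
      "h (h (h z)) = z" using ex[OF P' oc] by blast
    have "z \<noteq> 0" using z s0 by (metis sgn_zero)
    then have cz: "cycle h {z, h z, h (h z)}" using period_3_cycle[OF h(1) z(1,5)] by simp
    obtain \<eta> where "order_conj g Q h {z, h z, h (h z)} \<eta>"
      using period_3_order_conj[of g y h z, OF y(5) z(5)] y z sd by (auto simp: Q_def)
    then have "cycle_equiv g Q h {z, h z, h (h z)}"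
      using order_conj_imp_cycle_equiv[OF Q cz] by blast
    then show "\<exists>Q'. (h, Q') \<in> pattern_of g Q" using cz by (auto simp: pattern_of_def)
  qed
  then show ?thesis using that Q card rot by blast
qed

end

lemma (in twist_cycle) card_eq_3:
  assumes "\<rho> = 1 / 3"
  shows "card P = 3"
proof -
  obtain Q where Q: "cycle g Q" "card Q = 3" "forces (pattern_of g P) (pattern_of g Q)"
    "rotation_number b g Q = 1 / 3" using forces_primitive_3 .
  then have "pattern_of g Q = pattern_of g P" using no_other_forced assms by metis
  then have "(g, Q) \<in> pattern_of g P" using pattern_of_refl[OF Q(1)] by simp
  then obtain \<phi> where "order_conj g P g Q \<phi>" using pattern_of_order_conj[OF cycle] by metis
  then show ?thesis using order_conjD(1) bij_betw_same_card Q(2) by metis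
qed


section \<open>The conjugating map\<close>

lemma abs_circle_eq_iff: "abs_circle s = abs_circle t \<longleftrightarrow> s - t \<in> \<int>"
  by (rule circle.abs_eq_iff)

lemma continuous_on_abs_circle: "continuous_on A abs_circle"
proof -
  have "continuous_on UNIV abs_circle"
    unfolding continuous_on_open_vimage[OF open_UNIV] by (simp add: open_circle_def)
  then show ?thesis by (rule continuous_on_subset) simp
qed

lemma Ints_abs_less_1: "z \<in> \<int> \<Longrightarrow> \<bar>z\<bar> < (1::real) \<Longrightarrow> z = 0"
  by (auto simp: Ints_def)

context twist_cycle
begin

text \<open>For \<open>\<rho>\<close> other than 1/3 this is the code function modulo 1, up to a
  constant: dividing the branch index by 3 gives the fractional part of the accumulated
  displacement. It serves as position on the circle.\<close>

definition kap :: "complex \<Rightarrow> real" where "kap x = real (idx x) / 3 - lam x"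

lemma kap_step:
  assumes "x \<in> P"
  shows "kap (g x) - (kap x + \<rho>) \<in> \<int>"
proof -
  have "d x - (real (idx (g x)) - real (idx x)) / 3 \<in> \<int>"
    unfolding d_def using assms g_in P_triod P_nonzero by (intro branch_disp_mod[OF numbering]) auto
  moreover have "kap (g x) - (kap x + \<rho>) = - (d x - (real (idx (g x)) - real (idx x)) / 3)"
    using lam_step[OF assms] by (simp add: kap_def \<delta>_def diff_divide_distrib)
  ultimately show ?thesis by (simp only: Ints_minus)
qed

lemma kap_funpow: "x \<in> P \<Longrightarrow> kap ((g ^^ k) x) - (kap x + real k * \<rho>) \<in> \<int>"
proof (induction k)
  case (Suc k)
  from Ints_add[OF kap_step[OF funpow_in[OF Suc.prems, of k]] Suc.IH[OF Suc.prems]]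
  show ?case by (simp add: algebra_simps)
qed simp

lemma kap_inj:
  assumes "x \<in> P" "y \<in> P" "kap x - kap y \<in> \<int>"
  shows "x = y"
proof -
  obtain k where k: "k < card P" "x = (g ^^ k) y" using funpow_reach[OF assms(2,1)] .
  have "real k * \<rho> \<in> \<int>"
    using Ints_diff[OF assms(3) kap_funpow[OF assms(2), of k]] k(2) by simp
  have "k = 0"
  proof (rule ccontr)
    assume "k \<noteq> 0"
    show False
    proof (cases "\<rho> = 1 / 3")
      case True
      then have "real k / 3 \<in> \<int>" using \<open>real k * \<rho> \<in> \<int>\<close> unfolding True by simp
      moreover have "k < 3" using card_eq_3[OF True] k by simp
      ultimately have "real k / 3 = 0" by (intro Ints_abs_less_1) auto
      then show ?thesis using \<open>k \<noteq> 0\<close> by simp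
    next
      case False
      then show ?thesis
        using rotation_not_integral[OF False _ k(1)] \<open>k \<noteq> 0\<close> \<open>real k * \<rho> \<in> \<int>\<close> by simp
    qed
  qed
  then show ?thesis using k by simp
qed

text \<open>\<open>c\<close> is the sign of \<open>1 / 3 - \<rho>\<close>; for
  \<open>\<rho> = 1 / 3\<close> each branch carries just one point.\<close>

lemma ex_lam_direction:
  "\<exists>c::real. \<bar>c\<bar> = 1 \<and>
    (\<forall>u\<in>P. \<forall>w\<in>P. sgn u = sgn w \<longrightarrow> norm u < norm w \<longrightarrow> c * lam u < c * lam w)"
proof (cases "\<rho> = 1 / 3")
  case True
  have "{..<3} \<subseteq> idx ` P" using ex_lowest by (metis image_eqI lessThan_iff subsetI)
  then have "idx ` P = {..<3}" using idx_less by auto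
  then have "inj_on idx P" using card_eq_3[OF True] finite_P by (intro eq_card_imp_inj_on) auto
  then have "u = w" if "u \<in> P" "w \<in> P" "sgn u = sgn w" for u w
    using that idx_eq_iff by (meson inj_onD)
  then have "\<forall>u\<in>P. \<forall>w\<in>P. sgn u = sgn w \<longrightarrow> norm u < norm w \<longrightarrow> 1 * lam u < 1 * lam w"
    by (metis less_irrefl)
  then show ?thesis by (intro exI[of _ 1]) simp
next
  case False
  define c where "c = sgn (1 / 3 - \<rho>)"
  have "c * lam u < c * lam w"
    if "u \<in> P" "w \<in> P" "sgn u = sgn w" "norm u < norm w" for u w
    using lam_mono[OF False that] by (cases "\<rho> < 1 / 3") (auto simp: c_def zero_less_mult_iff)
  then show ?thesis using False by (intro exI[of _ c]) (auto simp: c_def abs_sgn_eq)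
qed

text \<open>\<open>G\<close> is a real lift of the map on one branch. \<open>G 0 = 0\<close> lets
  the three branches be glued, and strictness is asked only from the points of \<open>P\<close>
  outwards, where concordant pieces lie.\<close>

lemma ex_branch_lift:
  assumes c: "\<bar>c\<bar> = 1" and mono: "\<And>u w. u \<in> P \<Longrightarrow> w \<in> P \<Longrightarrow> sgn u = sgn w \<Longrightarrow> norm u < norm w \<Longrightarrow>
    c * lam u < c * lam w" and e: "e ^ 3 = 1"
  shows "\<exists>G. continuous_on UNIV G \<and> G 0 = 0 \<and> (\<forall>x\<in>P. sgn x = e \<longrightarrow> G (norm x) = kap x) \<and>
    (\<forall>x\<in>P. \<forall>s t. sgn x = e \<longrightarrow> norm x \<le> s \<longrightarrow> s < t \<longrightarrow> c * G t < c * G s)"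
proof (cases "{x \<in> P. sgn x = e} = {}")
  case True
  then show ?thesis by (intro exI[of _ "\<lambda>_. 0"]) auto
next
  case False
  define A where "A = norm ` {x \<in> P. sgn x = e}"
  have A: "finite A" "A \<noteq> {}" using finite_P False by (auto simp: A_def)
  define f where "f = (\<lambda>t. c * lam (of_real t * e))"
  have f: "f (norm x) = c * lam x" if "x \<in> P" "sgn x = e" for x
    using that norm_times_sgn[of x] by (simp add: f_def)
  have "strict_mono_on A f"
    by (rule strict_mono_onI) (use f mono in \<open>auto simp: A_def\<close>)
  then obtain F where F: "continuous_on UNIV F" "strict_mono F" "\<And>a. a \<in> A \<Longrightarrow> F a = f a"
    using finite_strict_mono_extension[OF A(1)] by blast
  have Fx: "F (norm x) = c * lam x" if "x \<in> P" "sgn x = e" for x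
    using F(3)[of "norm x"] f[OF that] that by (auto simp: A_def)
  obtain x0 where x0: "x0 \<in> P" "sgn x0 = e" using False by auto
  define m where "m = Min A"
  have m: "m > 0" "\<And>x. x \<in> P \<Longrightarrow> sgn x = e \<Longrightarrow> m \<le> norm x"
    using A P_nonzero unfolding m_def by (auto simp: A_def)
  define K where "K = (\<lambda>t. real (idx x0) / 3 - c * F t)"
  \<comment> \<open>Beyond the innermost norm \<open>m\<close> this is \<open>K\<close>; between 0
    and \<open>m\<close> it is the line from 0 to \<open>K m\<close>.\<close>
  define G where "G = (\<lambda>t. K (max t m) - K m * (1 - min t m / m))"
  have cc: "c * c = 1" using c by (metis abs_mult_self_eq mult_1)
  have "continuous_on UNIV G"
    unfolding G_def K_def using m(1)
    by (intro continuous_intros continuous_on_compose2[OF F(1)]) auto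
  moreover have "G 0 = 0" using m(1) by (simp add: G_def max_def min_def)
  moreover have GK: "G t = K t" if "m \<le> t" for t using that m(1) by (simp add: G_def max_def min_def)
  have "G (norm x) = kap x" if x: "x \<in> P" "sgn x = e" for x
  proof -
    have "idx x = idx x0" using idx_eq_iff x x0 by simp
    moreover have "c * F (norm x) = lam x" using Fx[OF x] cc by (simp flip: mult.assoc)
    ultimately show ?thesis using GK m(2)[OF x] by (simp add: K_def kap_def)
  qed
  moreover have "c * G t < c * G s" if "x \<in> P" "sgn x = e" "norm x \<le> s" "s < t" for x s t
  proof -
    have "m \<le> s" using m(2) that by fastforce
    then have "c * G t - c * G s = c * K t - c * K s" using GK[of s] GK[of t] that by simp
    also have "\<dots> = c * c * (F s - F t)" by (simp add: K_def algebra_simps)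
    also have "\<dots> < 0" using cc strict_monoD[OF F(2) that(4)] by simp
    finally show ?thesis by simp
  qed
  ultimately show ?thesis by blast
qed

text \<open>Between points of one branch the accumulated displacements differ by an integer, so
  their integer parts differ by the same amount and the floors cancel.\<close>

lemma code_function_diff:
  assumes "code_function b f P \<psi>" and f: "\<And>x. x \<in> P \<Longrightarrow> f x = g x"
    and "x \<in> P" "y \<in> P" "sgn x = sgn y"
  shows "\<psi> x - \<psi> y = lam y - lam x"
proof -
  have rot: "rotation_number b f P = \<rho>"
    by (simp add: \<rho>_def rotation_number_def rotation_pair_def f)
  obtain x0 where x0: "x0 \<in> P" and \<psi>': "\<And>k. \<psi> ((f ^^ k) x0) = \<psi> x0 + real k * rotation_number b f P
      - of_int \<lfloor>\<Sum>j<k. branch_disp b ((f ^^ j) x0) ((f ^^ Suc j) x0)\<rfloor>"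
    using assms(1) unfolding code_function_def by blast
  have fk: "(f ^^ k) x0 = (g ^^ k) x0" for k
    using f funpow_in[OF x0] by (induction k) auto
  define t where "t = (\<lambda>k. \<Sum>j<k. d ((g ^^ j) x0))"
  have \<psi>: "\<psi> ((g ^^ k) x0) = \<psi> x0 + real k * \<rho> - of_int \<lfloor>t k\<rfloor>" for k
    using \<psi>'[of k] unfolding rot fk t_def d_def by simp
  have lam: "lam ((g ^^ k) x0) = lam x0 + t k - real k * \<rho>" for k
    using lam_funpow[OF x0] by (simp add: t_def \<delta>_def sum_subtractf)
  obtain k l where kl: "x = (g ^^ k) x0" "y = (g ^^ l) x0"
    using funpow_reach[OF x0] assms(3,4) by metis
  have "idx x = idx y" using idx_eq_iff assms by simp
  then have "t k - t l \<in> \<int>"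
    using Ints_diff[OF disp_sum_mod[OF x0, of k] disp_sum_mod[OF x0, of l]] kl by (simp add: t_def)
  then obtain z where z: "t k = t l + of_int z" by (auto simp: Ints_def algebra_simps)
  then have "real_of_int \<lfloor>t k\<rfloor> = of_int \<lfloor>t l\<rfloor> + of_int z" by simp
  then show ?thesis using \<psi>[of k] \<psi>[of l] lam[of k] lam[of l] z kl by simp
qed

lemma ex_conjugating_map:
  "\<exists>\<Theta> :: complex \<Rightarrow> circle. continuous_on triod \<Theta> \<and>
     (\<exists>Q. cyclic_on (circle_rotation \<rho>) Q \<and> bij_betw \<Theta> P Q) \<and>
     (\<forall>x\<in>P. \<Theta> (g x) = circle_rotation \<rho> (\<Theta> x)) \<and>
     (\<forall>f \<psi>. (\<forall>x\<in>P. f x = g x) \<longrightarrow> code_function b f P \<psi> \<longrightarrow>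
        (\<forall>C\<in>concordant_pieces P \<psi>. fibre_monotone_on (triod_hull C) \<Theta>))"
proof -
  obtain c :: real where c: "\<bar>c\<bar> = 1"
    and cm: "\<And>u w. u \<in> P \<Longrightarrow> w \<in> P \<Longrightarrow> sgn u = sgn w \<Longrightarrow> norm u < norm w \<Longrightarrow> c * lam u < c * lam w"
    using ex_lam_direction by metis
  have "\<forall>e\<in>{e. e ^ 3 = 1}. \<exists>G. continuous_on UNIV G \<and> G 0 = 0 \<and>
      (\<forall>x\<in>P. sgn x = e \<longrightarrow> G (norm x) = kap x) \<and>
      (\<forall>x\<in>P. \<forall>s t. sgn x = e \<longrightarrow> norm x \<le> s \<longrightarrow> s < t \<longrightarrow> c * G t < c * G s)"
  proof
    fix e :: complex assume "e \<in> {e. e ^ 3 = 1}"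
    then have "e ^ 3 = 1" by simp
    from ex_branch_lift[OF c cm this]
    show "\<exists>G. continuous_on UNIV G \<and> G 0 = 0 \<and> (\<forall>x\<in>P. sgn x = e \<longrightarrow> G (norm x) = kap x) \<and>
      (\<forall>x\<in>P. \<forall>s t. sgn x = e \<longrightarrow> norm x \<le> s \<longrightarrow> s < t \<longrightarrow> c * G t < c * G s)" .
  qed
  from bchoice[OF this] obtain G where G': "\<forall>e\<in>{e. e ^ 3 = 1}. continuous_on UNIV (G e) \<and> G e 0 = 0 \<and>
      (\<forall>x\<in>P. sgn x = e \<longrightarrow> G e (norm x) = kap x) \<and>
      (\<forall>x\<in>P. \<forall>s t. sgn x = e \<longrightarrow> norm x \<le> s \<longrightarrow> s < t \<longrightarrow> c * G e t < c * G e s)"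
    by (rule exE)
  have G: "continuous_on UNIV (G e)" "G e 0 = 0" if "e ^ 3 = 1" for e
    using G' that by simp_all
  have G_kap: "G (sgn x) (norm x) = kap x" if "x \<in> P" for x
    using G'[rule_format, of "sgn x"] sgn_cube[OF that] that by simp
  have G_less: "c * G (sgn x) t < c * G (sgn x) s" if "x \<in> P" "norm x \<le> s" "s < t" for x s t
    using G'[rule_format, of "sgn x"] sgn_cube[OF that(1)] that by simp
  define \<Theta> where "\<Theta> = (\<lambda>z. abs_circle (if z = 0 then 0 else G (sgn z) (norm z)))"
  have \<Theta>_ray: "\<Theta> (of_real t * e) = abs_circle (G e t)" if "e ^ 3 = 1" "t \<ge> 0" for e t
  proof (cases "t = 0")
    case False
    then show ?thesis
      using that sgn_of_real_times[OF that(1), of t] norm_of_real_times[OF that(1), of t]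
      by (auto simp: \<Theta>_def)
  qed (simp add: \<Theta>_def G(2) that)
  have \<Theta>_P: "\<Theta> x = abs_circle (kap x)" if "x \<in> P" for x
    using that P_nonzero G_kap by (auto simp: \<Theta>_def)
  have triod: "triod = (\<Union>e\<in>{e. e ^ 3 = 1}. (\<lambda>t. of_real t * e) ` {0..1})"
  proof (intro equalityI subsetI)
    fix z assume z: "z \<in> triod"
    show "z \<in> (\<Union>e\<in>{e. e ^ 3 = 1}. (\<lambda>t. of_real t * e) ` {0..1})"
    proof (cases "z = 0")
      case True
      then have "z = of_real 0 * 1" by simp
      then show ?thesis by (intro UN_I[of 1] image_eqI[of _ _ 0]) auto
    next
      case False
      then show ?thesis using triod_sgn[OF z] triod_norm_le[OF z] norm_times_sgn[of z]
        by (intro UN_I[of "sgn z"] image_eqI[of _ _ "norm z"]) auto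
    qed
  qed (auto intro: of_real_times_in_triod)
  have cont: "continuous_on triod \<Theta>"
    unfolding triod
  proof (rule continuous_on_closed_Union)
    show "finite {e::complex. e ^ 3 = 1}" by (rule finite_nth_roots) simp
    fix e :: complex assume "e \<in> {e. e ^ 3 = 1}"
    then have e: "e ^ 3 = 1" by simp
    have "compact ((\<lambda>t. of_real t * e) ` {0..1::real})"
      by (intro compact_continuous_image continuous_intros) auto
    then show "closed ((\<lambda>t. of_real t * e) ` {0..1::real})" by (rule compact_imp_closed)
    have "continuous_on ((\<lambda>t. of_real t * e) ` {0..1::real}) (\<lambda>z. abs_circle (G e (norm z)))"
      by (intro continuous_on_compose2[OF continuous_on_abs_circle[of UNIV]]
          continuous_on_compose2[OF G(1)[OF e]] continuous_intros) auto
    moreover have "\<Theta> z = abs_circle (G e (norm z))" if "z \<in> (\<lambda>t. of_real t * e) ` {0..1::real}" for z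
      using that \<Theta>_ray[OF e] norm_of_real_times[OF e] by auto
    ultimately show "continuous_on ((\<lambda>t. of_real t * e) ` {0..1::real}) \<Theta>"
      by (simp cong: continuous_on_cong)
  qed
  have equiv: "\<Theta> (g x) = circle_rotation \<rho> (\<Theta> x)" if "x \<in> P" for x
    using kap_step[OF that] \<Theta>_P[OF that] \<Theta>_P[OF g_in[OF that]]
    by (simp add: circle_rotation.abs_eq abs_circle_eq_iff)
  have "inj_on \<Theta> P"
    by (rule inj_onI) (use \<Theta>_P kap_inj in \<open>simp add: abs_circle_eq_iff\<close>)
  then have bij: "bij_betw \<Theta> P (\<Theta> ` P)" by (simp add: bij_betw_def)
  have cyc: "cyclic_on (circle_rotation \<rho>) (\<Theta> ` P)"
    using cyclic by (rule cyclic_on_image) (simp add: equiv)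
  have "fibre_monotone_on (triod_hull C) \<Theta>"
    if f: "\<forall>x\<in>P. f x = g x" and code: "code_function b f P \<psi>" and C: "C \<in> concordant_pieces P \<psi>"
    for f \<psi> C
  proof -
    obtain x where x: "x \<in> P" "C = {y. (x, y) \<in> concordant P \<psi>}"
      using C by (auto simp: concordant_pieces_def quotient_def)
    define e where "e = sgn x"
    have e: "e ^ 3 = 1" using sgn_cube[OF x(1)] by (simp add: e_def)
    have yC: "y \<in> P" "sgn y = e" "\<lfloor>\<psi> y\<rfloor> = \<lfloor>\<psi> x\<rfloor>" if "y \<in> C" for y
    proof -
      have "{x, y} \<subseteq> triod_hull {x, y}" by (rule triod_hull_superset)
      then show "y \<in> P" "sgn y = e" "\<lfloor>\<psi> y\<rfloor> = \<lfloor>\<psi> x\<rfloor>"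
        using that x by (auto simp: concordant_def same_branch_iff e_def)
    qed
    \<comment> \<open>Monotonicity holds in the strong form of injectivity. The code function varies
      by less than 1 on the piece, hence so does the strictly monotone lift, and no two of its
      values agree modulo 1.\<close>
    have "inj_on \<Theta> (triod_hull C)"
    proof (cases "C = {}")
      case True
      have "triod_hull C \<subseteq> {}" using True by (intro triod_hull_least) auto
      then show ?thesis by simp
    next
      case False
      have finC: "finite C" using yC finite_P by (meson finite_subset subsetI)
      obtain u where u: "u \<in> C" "\<And>y. y \<in> C \<Longrightarrow> norm u \<le> norm y"
        using arg_min_if_finite[OF finC False, of norm] by (metis not_le)
      obtain w where w: "w \<in> C" "\<And>y. y \<in> C \<Longrightarrow> norm y \<le> norm w"
        using arg_min_if_finite[OF finC False, of "\<lambda>y. - norm y"] by (metis neg_less_iff_less not_le)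
      have "triod_hull C \<subseteq> (\<lambda>t. of_real t * e) ` {norm u..norm w}"
      proof (rule triod_hull_least)
        show "connected ((\<lambda>t. of_real t * e) ` {norm u..norm w})"
          by (intro connected_continuous_image continuous_intros) auto
        have "norm w \<le> 1" using triod_norm_le P_triod yC w by blast
        then show "(\<lambda>t. of_real t * e) ` {norm u..norm w} \<subseteq> triod"
          using of_real_times_in_triod[OF e] order_trans[OF norm_ge_zero[of u]] by force
        show "C \<subseteq> (\<lambda>t. of_real t * e) ` {norm u..norm w}"
        proof
          fix y assume y: "y \<in> C"
          then have "y = of_real (norm y) * e" using yC(2) norm_times_sgn[of y] by simp
          then show "y \<in> (\<lambda>t. of_real t * e) ` {norm u..norm w}" using u(2) w(2) y by auto
        qed
      qed
      moreover have "inj_on \<Theta> ((\<lambda>t. of_real t * e) ` {norm u..norm w})"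
      proof -
        have ub: "sgn u = e" "u \<in> P" "sgn w = e" "w \<in> P" using yC u w by auto
        have "\<bar>\<psi> w - \<psi> u\<bar> < 1" using yC(3)[OF u(1)] yC(3)[OF w(1)] by linarith
        moreover have "\<psi> w - \<psi> u = lam u - lam w"
          using code_function_diff[OF code _ ub(4,2)] f ub by simp
        moreover have "G e (norm w) - G e (norm u) = lam u - lam w"
          using G_kap[OF ub(2)] G_kap[OF ub(4)] ub idx_eq_iff[OF ub(2,4)] by (simp add: kap_def)
        ultimately have small: "\<bar>G e (norm w) - G e (norm u)\<bar> < 1" by simp
        have less: "c * G e t < c * G e s" if "norm u \<le> s" "s < t" for s t
          using G_less[OF ub(2) that] ub by simp
        have le: "c * G e t \<le> c * G e s" if "norm u \<le> s" "s \<le> t" for s t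
          using less[OF that(1), of t] that(2) by (cases "s = t") auto
        \<comment> \<open>The values at \<open>s\<close> and \<open>t\<close> lie between those at
          the ends \<open>norm u\<close> and \<open>norm w\<close>, so they differ by a nonzero
          amount less than 1.\<close>
        have sep: "abs_circle (G e s) \<noteq> abs_circle (G e t)"
          if st: "norm u \<le> s" "s < t" "t \<le> norm w" for s t
        proof
          assume "abs_circle (G e s) = abs_circle (G e t)"
          then have int: "G e s - G e t \<in> \<int>" by (simp add: abs_circle_eq_iff)
          have "c * G e (norm w) \<le> c * G e t" "c * G e t < c * G e s" "c * G e s \<le> c * G e (norm u)"
            using le[of t "norm w"] less[of s t] le[of "norm u" s] st by auto
          then have "\<bar>c * (G e s - G e t)\<bar> \<le> \<bar>c * (G e (norm w) - G e (norm u))\<bar>" "G e s \<noteq> G e t"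
            by (auto simp: right_diff_distrib)
          then have "\<bar>G e s - G e t\<bar> < 1" using small c by (simp add: abs_mult)
          then show False using Ints_abs_less_1[OF int] \<open>G e s \<noteq> G e t\<close> by simp
        qed
        show ?thesis
        proof (rule inj_onI)
          fix y z assume "y \<in> (\<lambda>t. of_real t * e) ` {norm u..norm w}"
            "z \<in> (\<lambda>t. of_real t * e) ` {norm u..norm w}" and eq: "\<Theta> y = \<Theta> z"
          then obtain s t where "y = of_real s * e" "s \<in> {norm u..norm w}"
            "z = of_real t * e" "t \<in> {norm u..norm w}" by blast
          then have st: "y = of_real s * e" "z = of_real t * e"
            "norm u \<le> s" "s \<le> norm w" "norm u \<le> t" "t \<le> norm w" by auto
          have "s \<ge> 0" "t \<ge> 0" using st norm_ge_zero[of u] by linarith+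
          then have "abs_circle (G e s) = abs_circle (G e t)" using eq st \<Theta>_ray[OF e] by simp
          then have "s = t" using sep[of s t] sep[of t s] st by (metis linorder_less_linear)
          then show "y = z" using st by simp
        qed
      qed
      ultimately show ?thesis by (metis inj_on_subset)
    qed
    then have "\<exists>a. \<Theta> -` {v} \<inter> triod_hull C \<subseteq> {a}" for v
      unfolding inj_on_def by blast
    then have "connected (\<Theta> -` {v} \<inter> triod_hull C)" for v
      by (metis connected_empty connected_sing subset_singletonD)
    then show ?thesis by (simp add: fibre_monotone_on_def)
  qed
  then show ?thesis using cont bij cyc equiv by blast
qed

end

theorem theorem3p17:
  fixes b :: "nat \<Rightarrow> complex set" and g f :: "complex \<Rightarrow> complex" and P :: "complex set"
    and p q :: nat and \<psi> :: "complex \<Rightarrow> real"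
  assumes "canonical_numbering b g P"
    and "triod_twist_cycle b g P"
    and "q > 0" and "rotation_number b g P = real p / real q"
    and "linear_map_of g P f"
    and "real p / real q \<noteq> 1 / 3 \<Longrightarrow> code_function b f P \<psi>"
  shows "\<exists>\<Theta> :: complex \<Rightarrow> circle.
           continuous_on triod \<Theta> \<and>
           (\<exists>Q. cyclic_on (circle_rotation (real p / real q)) Q \<and> bij_betw \<Theta> P Q) \<and>
           (\<forall>x\<in>P. \<Theta> (f x) = circle_rotation (real p / real q) (\<Theta> x)) \<and>
           (real p / real q \<noteq> 1 / 3 \<longrightarrow>
              (\<forall>C\<in>concordant_pieces P \<psi>. fibre_monotone_on (triod_hull C) \<Theta>))"
proof -
  interpret twist_cycle g P b
    using assms(1,2) by unfold_locales (auto simp: triod_twist_cycle_def)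
  have f: "\<forall>x\<in>P. f x = g x" using assms(5) by (simp add: linear_map_of_def)
  have \<rho>: "\<rho> = real p / real q" using assms(4) by (simp add: \<rho>_def)
  obtain \<Theta> :: "complex \<Rightarrow> circle" where \<Theta>: "continuous_on triod \<Theta>"
    "\<exists>Q. cyclic_on (circle_rotation \<rho>) Q \<and> bij_betw \<Theta> P Q"
    "\<forall>x\<in>P. \<Theta> (g x) = circle_rotation \<rho> (\<Theta> x)"
    "\<forall>f \<psi>. (\<forall>x\<in>P. f x = g x) \<longrightarrow> code_function b f P \<psi> \<longrightarrow>
        (\<forall>C\<in>concordant_pieces P \<psi>. fibre_monotone_on (triod_hull C) \<Theta>)"
    using ex_conjugating_map by blast
  have "\<forall>C\<in>concordant_pieces P \<psi>. fibre_monotone_on (triod_hull C) \<Theta>" if "real p / real q \<noteq> 1 / 3"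
    by (intro ballI \<Theta>(4)[rule_format, OF _ assms(6)[OF that]]) (use f in auto)
  moreover have "\<forall>x\<in>P. \<Theta> (f x) = circle_rotation \<rho> (\<Theta> x)" using \<Theta>(3) f by simp
  ultimately show ?thesis using \<Theta>(1,2) unfolding \<rho> by blast
qed

end
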